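(* Let $V$ be an $n$-dimensional $K$-vector space with a linear $R$-structure $V_R$, let $E,E'\subseteq V$ be $K$-subspaces of dimension $k$ and $F,F'\subseteq V$ be $K$-subspaces of dimension $\ell$. Then there exists $g\in\mathrm{GL}_n(R)$ (i.e. a $K$-linear automorphism $g$ of $V$ with $g(V_R)=V_R$) such that $g(E)=E'$ and $g(F)=F'$ if and only if the pairs of subspaces $(E,F)$ and $(E',F')$ have the same position vector.
   Context: $K$ is a nonarchimedean local field of characteristic zero with valuation ring $R$, uniformizer $\varpi$, residue field of cardinality $q$, $\varepsilon=q^{-1}$, and $|\varpi|=\varepsilon$; $\varepsilon^\infty=0$. A linear $R$-structure on a finite-dimensional $K$-space $V$ is a finitely generated $R$-submodule $V_R$ spanning $V$ (a full lattice). Subspaces $U\subseteq V$ carry $U\cap V_R$, quotients the image of $V_R$, products the product lattice. The singular values $\sigma_1\ge\sigma_2\ge\cdots\ge0$ of a $K$-linear map between spaces with linear $R$-structures are the absolute values of the diagonal entries of the Smith normal form over $R$ of its matrix with respect to $R$-bases of the lattices. Position vector. First let $E,F\subseteq V$ have dimensions $k\le\ell$ with $k+\ell\le\dim V$. The decreasing list of the $k+\ell$ singular values of the addition map $E\times F\to V$, $(e,f)\mapsto e+f$, starts with $\ell$ ones; its last $k$ entries are written $\varepsilon^{x_1}\ge\cdots\ge\varepsilon^{x_k}$ with $x_i\in\mathbb{N}\cup\{\infty\}$, and $(x_1,\ldots,x_k)$ is the position vector of $(E,F)$ (if $\dim E>\dim F$ the roles of $E$ and $F$ are exchanged). For arbitrary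 subspaces $E,F\subseteq V$, let $\bar E,\bar F$ be their images in $V/(E\cap F)$ and $d=\dim(E\cap F)$; the position vector of $(E,F)$ is that of $(\bar E,\bar F)$ followed by $d$ entries equal to $\infty$ (this agrees with the first definition when both apply). *)

theory Defs
  imports "Jordan_Normal_Form.VS_Connect" "HOL-Algebra.QuotRing" "HOL-Library.Extended_Nat"
begin

definition val_ring :: "('k::field \<Rightarrow> real) \<Rightarrow> 'k ring" where
  "val_ring absv = class_ring\<lparr>carrier := {x. absv x \<le> 1}\<rparr>"

definition max_ideal :: "('k::field \<Rightarrow> real) \<Rightarrow> 'k set" where
  "max_ideal absv = {x. absv x < 1}"

definition residue_card :: "('k::field \<Rightarrow> real) \<Rightarrow> nat" where
  "residue_card absv = card (carrier (val_ring absv Quot max_ideal absv))"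

definition eps :: "('k::field \<Rightarrow> real) \<Rightarrow> real" where
  "eps absv = 1 / real (residue_card absv)"

text \<open>The absolute value is the normalized one: a uniformizer, i.e. a generator of the maximal
  ideal, has absolute value \<open>1/q\<close>. This also makes the absolute value discrete and nontrivial.\<close>

locale nonarch_local_field =
  fixes absv :: "'k::field_char_0 \<Rightarrow> real"
  assumes absv_nonneg: "absv x \<ge> 0"
    and absv_eq_0_iff: "absv x = 0 \<longleftrightarrow> x = 0"
    and absv_mult: "absv (x * y) = absv x * absv y"
    and absv_add_le: "absv (x + y) \<le> max (absv x) (absv y)"
    and complete: "(\<forall>e>0. \<exists>N. \<forall>i\<ge>N. \<forall>j\<ge>N. absv (X i - X j) < e) \<Longrightarrow>
      \<exists>x. (\<lambda>i. absv (X i - x)) \<longlonglongrightarrow> 0"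
    and finite_residue_field: "finite (carrier (val_ring absv Quot max_ideal absv))"
    and uniformizer: "\<exists>\<pi>. absv \<pi> = eps absv \<and>
      max_ideal absv = {r * \<pi> |r. r \<in> carrier (val_ring absv)}"

text \<open>The value \<open>\<epsilon>\<^sup>x\<close>, with the convention that it is 0 for infinite \<open>x\<close>.\<close>

definition eps_pow :: "('k::field \<Rightarrow> real) \<Rightarrow> enat \<Rightarrow> real" where
  "eps_pow absv x = (case x of enat m \<Rightarrow> eps absv ^ m | \<infinity> \<Rightarrow> 0)"

text \<open>A \<open>K\<close>-vector space is a module record over \<open>class_ring\<close>; the same record serves as a module
  over the valuation ring.\<close>

definition linear_R_structure ::
    "('k::field \<Rightarrow> real) \<Rightarrow> ('k, 'v) module \<Rightarrow> 'v set \<Rightarrow> bool" where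
  "linear_R_structure absv V L \<longleftrightarrow>
     submodule (val_ring absv) L V \<and>
     (\<exists>S. finite S \<and> S \<subseteq> carrier V \<and> L = LinearCombinations.module.span (val_ring absv) V S) \<and>
     LinearCombinations.module.span class_ring V L = carrier V"

definition R_basis ::
    "('k::field \<Rightarrow> real) \<Rightarrow> ('k, 'v) module \<Rightarrow> 'v set \<Rightarrow> 'v list \<Rightarrow> bool" where
  "R_basis absv V L bs \<longleftrightarrow>
     distinct bs \<and> set bs \<subseteq> carrier V \<and>
     LinearCombinations.module.span (val_ring absv) V (set bs) = L \<and>
     \<not> LinearCombinations.module.lin_dep (val_ring absv) V (set bs)"

definition vs_quot :: "('k, 'v) module \<Rightarrow> 'v set \<Rightarrow> ('k, 'v set) module" where
  \<comment> \<open>The fields \<open>mult\<close> and \<open>one\<close> are irrelevant. Adding \<open>W\<close> in \<open>smult\<close> matters for the scalar 0.\<close>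
  "vs_quot V W =
     \<lparr>carrier = a_rcosets\<^bsub>V\<^esub> W, mult = (\<lambda>X Y. W), one = W, zero = W, add = set_add V,
      smult = (\<lambda>c X. W <+>\<^bsub>V\<^esub> ((\<odot>\<^bsub>V\<^esub>) c ` X))\<rparr>"

definition GL_val_ring :: "('k::field \<Rightarrow> real) \<Rightarrow> nat \<Rightarrow> 'k mat set" where
  "GL_val_ring absv n =
     {P \<in> carrier_mat n n. elements_mat P \<subseteq> carrier (val_ring absv) \<and>
        (\<exists>P' \<in> carrier_mat n n. elements_mat P' \<subseteq> carrier (val_ring absv) \<and>
           inverts_mat P P' \<and> inverts_mat P' P)}"

definition is_Smith_normal_form :: "('k::field \<Rightarrow> real) \<Rightarrow> 'k mat \<Rightarrow> 'k mat \<Rightarrow> bool" where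
  "is_Smith_normal_form absv M D \<longleftrightarrow>
     (\<exists>P \<in> GL_val_ring absv (dim_row M). \<exists>Q \<in> GL_val_ring absv (dim_col M). D = P * M * Q) \<and>
     diagonal_mat D \<and>
     (\<forall>i. Suc i < min (dim_row D) (dim_col D) \<longrightarrow>
        (\<exists>r \<in> carrier (val_ring absv). D $$ (Suc i, Suc i) = r * D $$ (i, i)))"

definition is_matrix_of ::
    "('k, 'w) module \<Rightarrow> ('v \<Rightarrow> 'w) \<Rightarrow> 'v list \<Rightarrow> 'w list \<Rightarrow> 'k mat \<Rightarrow> bool" where
  "is_matrix_of W T as bs M \<longleftrightarrow>
     M \<in> carrier_mat (length bs) (length as) \<and>
     (\<forall>j < length as. T (as ! j) =
        (\<Oplus>\<^bsub>W\<^esub>i\<in>{..<length bs}. M $$ (i, j) \<odot>\<^bsub>W\<^esub> (bs ! i)))"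

text \<open>The list is decreasing because of the divisibility condition in the Smith normal form.\<close>

definition singular_values ::
    "('k::field \<Rightarrow> real) \<Rightarrow> ('k, 'v) module \<Rightarrow> 'v set \<Rightarrow> ('k, 'w) module \<Rightarrow> 'w set \<Rightarrow>
     ('v \<Rightarrow> 'w) \<Rightarrow> real list" where
  "singular_values absv V LV W LW T =
     (THE s. \<exists>as bs M D. R_basis absv V LV as \<and> R_basis absv W LW bs \<and>
        is_matrix_of W T as bs M \<and> is_Smith_normal_form absv M D \<and>
        s = map (\<lambda>i. absv (D $$ (i, i))) [0..<min (dim_row D) (dim_col D)])"

abbreviation subspace_dim :: "('k::field, 'v) module \<Rightarrow> 'v set \<Rightarrow> nat" where
  "subspace_dim V E \<equiv> vectorspace.dim class_ring (V\<lparr>carrier := E\<rparr>)"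

definition addition_singular_values ::
    "('k::field \<Rightarrow> real) \<Rightarrow> ('k, 'v) module \<Rightarrow> 'v set \<Rightarrow> 'v set \<Rightarrow> 'v set \<Rightarrow> real list" where
  "addition_singular_values absv V L E F =
     singular_values absv
       (direct_sum (V\<lparr>carrier := E\<rparr>) (V\<lparr>carrier := F\<rparr>)) ((E \<inter> L) \<times> (F \<inter> L))
       V L (\<lambda>(e, f). e \<oplus>\<^bsub>V\<^esub> f)"

text \<open>Meant for \<open>dim E \<le> dim F\<close>, \<open>dim E + dim F \<le> dim V\<close>: of the \<open>dim E + dim F\<close> singular values
  the first \<open>dim F\<close>, all equal to 1, are dropped.\<close>

definition position_vector_le ::
    "('k::field \<Rightarrow> real) \<Rightarrow> ('k, 'v) module \<Rightarrow> 'v set \<Rightarrow> 'v set \<Rightarrow> 'v set \<Rightarrow> enat list" where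
  "position_vector_le absv V L E F =
     (THE xs. map (eps_pow absv) xs =
        drop (subspace_dim V F) (addition_singular_values absv V L E F))"

definition position_vector_small ::
    "('k::field \<Rightarrow> real) \<Rightarrow> ('k, 'v) module \<Rightarrow> 'v set \<Rightarrow> 'v set \<Rightarrow> 'v set \<Rightarrow> enat list" where
  "position_vector_small absv V L E F =
     (if subspace_dim V E \<le> subspace_dim V F then position_vector_le absv V L E F
      else position_vector_le absv V L F E)"

definition position_vector ::
    "('k::field \<Rightarrow> real) \<Rightarrow> ('k, 'v) module \<Rightarrow> 'v set \<Rightarrow> 'v set \<Rightarrow> 'v set \<Rightarrow> enat list" where
  "position_vector absv V L E F =
     (let W = E \<inter> F; p = (\<lambda>v. W +>\<^bsub>V\<^esub> v) in
      position_vector_small absv (vs_quot V W) (p ` L) (p ` E) (p ` F)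
        @ replicate (subspace_dim V W) \<infinity>)"

definition GL_lattice :: "('k::field, 'v) module \<Rightarrow> 'v set \<Rightarrow> ('v \<Rightarrow> 'v) set" where
  "GL_lattice V L =
     {g. linear_map class_ring V V g \<and> bij_betw g (carrier V) (carrier V) \<and> g ` L = L}"

end

theory Submission
  imports Defs "HOL-Library.Function_Algebras"
begin

text \<open>
  Every pair of subspaces has a normal form that is determined by the dimensions and the position
  vector. Suppose \<open>dim E \<le> dim F\<close>. Then the lattice \<open>V\<^sub>R\<close> has an \<open>R\<close>-basis \<open>b\<close> such that \<open>E \<inter> F\<close> is spanned by
  its first \<open>d\<close> vectors, \<open>F\<close> by its first \<open>l\<close> vectors, and \<open>E\<close> by \<open>b i\<close> for \<open>i < d\<close> and
  \<open>b (d + i) + p\<^sup>x b (l + i)\<close> for \<open>i < m\<close>, where \<open>p\<close> is a uniformizer and the exponents \<open>x = x i\<close> increase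
  (\<open>relative_position_normal_form\<close>, \<open>normal_form_exists\<close>).

  Two \<open>R\<close>-bases of \<open>V\<^sub>R\<close> are exchanged by an element of \<open>GL\<^sub>n(R)\<close>, and this element carries one pair to the
  other if both pairs have the same exponents. Conversely, an element of \<open>GL\<^sub>n(R)\<close> carries a normal
  form of \<open>(E, F)\<close> to a normal form of the image pair with the same exponents. So the theorem
  follows once the position vector is known to consist of the exponents and \<open>d\<close> infinite entries
  (\<open>position_vector_normal_form\<close>).

  Modulo \<open>E \<inter> F\<close>, the addition map \<open>E \<times> F \<rightarrow> V\<close> sends \<open>(0, b j)\<close> to \<open>b j\<close> and
  \<open>(b (d + i) + p\<^sup>x b (l + i), - b (d + i))\<close> to \<open>p\<^sup>x b (l + i)\<close>. This is a Smith normal form, with \<open>dim F - d\<close>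
  ones followed by the powers of \<open>p\<close>. The singular values are well defined because the absolute
  values of the diagonal entries do not depend on the bases (\<open>diagonal_entry_le\<close>): the \<open>i\<close>-th entry is
  characterized by the size of the images of integral vectors from spaces of dimension \<open>i + 1\<close>.

  The existence of the normal form rests on the elementary divisor theorem (\<open>stacked_bases\<close>),
  applied to \<open>F\<close>, to \<open>E \<inter> F\<close> and to the projection of \<open>E\<close> along \<open>F\<close> (\<open>adapted_basis_pair\<close>). The
  elementary divisors of this projection become the powers \<open>p\<^sup>x\<close>. The elementary divisor theorem
  also provides an \<open>R\<close>-basis of a lattice that is only known to be finitely generated
  (\<open>lattice_frame_exists\<close>).

  The linear algebra over \<open>R\<close> is carried out in a type of vectors, where finite sums are easy to handle,
  and is transported to module records by coordinates with respect to a basis.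
\<close>

section \<open>The absolute value\<close>

context nonarch_local_field
begin

lemma absv_0 [simp]: "absv 0 = 0"
  by (simp add: absv_eq_0_iff)

lemma absv_1 [simp]: "absv 1 = 1"
  using absv_mult[of 1 1] absv_eq_0_iff[of 1] by simp

lemma absv_minus_1: "absv (-1) = 1"
  using absv_mult[of "-1" "-1"] absv_nonneg[of "-1"]
  by (simp add: square_eq_1_iff)

lemma absv_minus [simp]: "absv (- x) = absv x"
  using absv_mult[of "-1" x] absv_minus_1 by simp

lemma absv_diff_le: "absv (x - y) \<le> max (absv x) (absv y)"
  using absv_add_le[of x "- y"] by simp

lemma absv_pos_iff: "absv x > 0 \<longleftrightarrow> x \<noteq> 0"
  using absv_nonneg[of x] absv_eq_0_iff[of x] by linarith

lemma absv_inverse: "absv (inverse x) = inverse (absv x)"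
proof (cases "x = 0")
  case False
  then have "absv (inverse x) * absv x = 1" by (simp flip: absv_mult)
  then show ?thesis using inverse_unique[of "absv x" "absv (inverse x)"] by (simp add: mult.commute)
qed simp

lemma absv_divide: "absv (x / y) = absv x / absv y"
  by (simp add: divide_inverse absv_mult absv_inverse)

lemma absv_power: "absv (x ^ m) = absv x ^ m"
  by (induction m) (simp_all add: absv_mult)

lemma absv_mult_le_1: "absv x \<le> 1 \<Longrightarrow> absv y \<le> 1 \<Longrightarrow> absv (x * y) \<le> 1"
  by (simp add: absv_mult absv_nonneg mult_le_one)

lemma absv_add_le_1: "absv x \<le> 1 \<Longrightarrow> absv y \<le> 1 \<Longrightarrow> absv (x + y) \<le> 1"
  using absv_add_le[of x y] by simp

lemma absv_diff_le_1: "absv x \<le> 1 \<Longrightarrow> absv y \<le> 1 \<Longrightarrow> absv (x - y) \<le> 1"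
  using absv_diff_le[of x y] by simp

lemma absv_sum_le:
  assumes "\<And>i. i \<in> I \<Longrightarrow> absv (f i) \<le> C" "0 \<le> C"
  shows "absv (sum f I) \<le> C"
  using assms
proof (induction I rule: infinite_finite_induct)
  case (insert i I)
  have "absv (f i + sum f I) \<le> max (absv (f i)) (absv (sum f I))" by (rule absv_add_le)
  also have "\<dots> \<le> C" using insert by simp
  finally show ?case using insert.hyps by simp
qed simp_all

lemma eps_pos: "0 < eps absv"
proof -
  interpret max_ideal: abelian_monoid "val_ring absv"
    by standard (auto simp: val_ring_def absv_add_le_1 algebra_simps)
  \<comment> \<open>The residue field is finite by assumption, so its cardinality is 0 only if it is empty.\<close>
  have "carrier (val_ring absv Quot max_ideal absv) \<noteq> {}"
    by (auto simp: FactRing_def A_RCOSETS_def RCOSETS_def val_ring_def intro: exI[of _ 0])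
  then have "residue_card absv > 0"
    unfolding residue_card_def using finite_residue_field by (simp add: card_gt_0_iff)
  then show ?thesis by (simp add: eps_def)
qed

text \<open>The maximal ideal is generated by the uniformizer, so no absolute value lies strictly between
  \<open>\<epsilon>\<close> and 1.\<close>

lemma discrete_valuation:
  obtains \<pi> where "absv \<pi> = eps absv" "\<And>x. absv x < 1 \<Longrightarrow> absv x \<le> eps absv"
    "eps absv < 1"
proof -
  obtain \<pi> where 1: "absv \<pi> = eps absv"
    and 2: "max_ideal absv = {r * \<pi> |r. r \<in> carrier (val_ring absv)}"
    using uniformizer by blast
  have "\<pi> \<in> max_ideal absv"
    unfolding 2 by (auto simp: val_ring_def intro!: exI[of _ 1])
  then have "eps absv < 1" using 1 by (simp add: max_ideal_def)
  moreover have "absv x \<le> eps absv" if "absv x < 1" for x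
  proof -
    have "x \<in> max_ideal absv" using that by (simp add: max_ideal_def)
    then obtain r where "x = r * \<pi>" "absv r \<le> 1" unfolding 2 by (auto simp: val_ring_def)
    then show ?thesis using 1 eps_pos by (simp add: absv_mult mult_left_le_one_le absv_nonneg)
  qed
  ultimately show ?thesis using that 1 by blast
qed

lemma eps_less_1: "eps absv < 1"
  using discrete_valuation by blast

text \<open>A nonzero element of \<open>R\<close> can be divided by the uniformizer only finitely often, because the powers
  of \<open>\<epsilon>\<close> tend to 0; what remains is a unit.\<close>

lemma absv_eq_eps_power:
  assumes "c \<noteq> 0" "absv c \<le> 1"
  obtains m where "absv c = eps absv ^ m"
proof -
  obtain \<pi> where \<pi>: "absv \<pi> = eps absv" "\<And>x. absv x < 1 \<Longrightarrow> absv x \<le> eps absv"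
    using discrete_valuation by blast
  have \<pi>0: "\<pi> \<noteq> 0" using \<pi> eps_pos by auto
  obtain N where "eps absv ^ N < absv c"
    using real_arch_pow_inv[of "absv c" "eps absv"] assms eps_less_1 by (auto simp: absv_pos_iff)
  then have "\<exists>m. absv c = eps absv ^ m"
    using assms
  proof (induction N arbitrary: c)
    case (Suc N)
    show ?case
    proof (cases "absv c = 1")
      case False
      then have le: "absv c \<le> eps absv" using \<pi>(2) Suc.prems by force
      have "absv (c / \<pi>) \<le> 1" using le eps_pos by (simp add: absv_divide \<pi>)
      moreover have "eps absv ^ N < absv (c / \<pi>)"
        using Suc.prems eps_pos by (simp add: absv_divide \<pi> field_simps)
      moreover have "c / \<pi> \<noteq> 0" using Suc.prems \<pi>0 by simp
      ultimately obtain m where "absv (c / \<pi>) = eps absv ^ m" using Suc.IH by blast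
      then have "absv c = eps absv ^ Suc m" using eps_pos by (simp add: absv_divide \<pi> field_simps)
      then show ?thesis by blast
    qed (auto intro: exI[of _ 0])
  qed simp
  then show ?thesis using that by blast
qed

end

section \<open>Lattices and the elementary divisor theorem\<close>

locale local_field_space = nonarch_local_field absv + vector_space scale
  for absv :: "'k::field_char_0 \<Rightarrow> real"
    and scale :: "'k \<Rightarrow> 'w::ab_group_add \<Rightarrow> 'w" (infixr "*s" 75)
begin

text \<open>Vectors come as families \<open>b\<close> over a finite index set \<open>I\<close>: a lattice basis is split into parts,
  recombined and reindexed below, and index sets do this without reference to the order of a list.
  \<open>Ksp\<close> and \<open>Rsp\<close> are the \<open>K\<close>-span and the \<open>R\<close>-span of a family. If \<open>b\<close> is independent over \<open>K\<close>,
  then \<open>Rsp b I\<close> is a lattice in \<open>Ksp b I\<close> with \<open>R\<close>-basis \<open>b\<close>, and another independent family over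
  \<open>I\<close> with the same \<open>R\<close>-span is another \<open>R\<close>-basis of this lattice.\<close>

definition lcomb :: "('i \<Rightarrow> 'w) \<Rightarrow> 'i set \<Rightarrow> ('i \<Rightarrow> 'k) \<Rightarrow> 'w" where
  "lcomb b I x = (\<Sum>i\<in>I. x i *s b i)"

definition Ksp :: "('i \<Rightarrow> 'w) \<Rightarrow> 'i set \<Rightarrow> 'w set" where
  "Ksp b I = range (lcomb b I)"

definition Rsp :: "('i \<Rightarrow> 'w) \<Rightarrow> 'i set \<Rightarrow> 'w set" where
  "Rsp b I = lcomb b I ` {x. \<forall>i\<in>I. absv (x i) \<le> 1}"

definition indep :: "('i \<Rightarrow> 'w) \<Rightarrow> 'i set \<Rightarrow> bool" where
  "indep b I \<longleftrightarrow> (\<forall>x. lcomb b I x = 0 \<longrightarrow> (\<forall>i\<in>I. x i = 0))"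

lemma lcomb_cong:
  "(\<And>i. i \<in> I \<Longrightarrow> x i = y i) \<Longrightarrow> (\<And>i. i \<in> I \<Longrightarrow> b i = c i) \<Longrightarrow> lcomb b I x = lcomb c I y"
  unfolding lcomb_def by (intro sum.cong) auto

lemma lcomb_add: "lcomb b I x + lcomb b I y = lcomb b I (\<lambda>i. x i + y i)"
  by (simp add: lcomb_def sum.distrib scale_left_distrib)

lemma lcomb_diff: "lcomb b I x - lcomb b I y = lcomb b I (\<lambda>i. x i - y i)"
  by (simp add: lcomb_def sum_subtractf scale_left_diff_distrib)

lemma lcomb_scale: "r *s lcomb b I x = lcomb b I (\<lambda>i. r * x i)"
  by (simp add: lcomb_def scale_sum_right)

lemma lcomb_zero: "(\<And>i. i \<in> I \<Longrightarrow> x i = 0) \<Longrightarrow> lcomb b I x = 0"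
  by (simp add: lcomb_def)

lemma lcomb_Un:
  "finite A \<Longrightarrow> finite B \<Longrightarrow> A \<inter> B = {} \<Longrightarrow> lcomb b (A \<union> B) x = lcomb b A x + lcomb b B x"
  by (simp add: lcomb_def sum.union_disjoint)

lemma lcomb_restrict:
  "finite I \<Longrightarrow> A \<subseteq> I \<Longrightarrow> lcomb b A x = lcomb b I (\<lambda>i. if i \<in> A then x i else 0)"
  unfolding lcomb_def by (intro sum.mono_neutral_cong_left) auto

lemma lcomb_single: "finite I \<Longrightarrow> i \<in> I \<Longrightarrow> lcomb b I (\<lambda>j. if j = i then r else 0) = r *s b i"
  unfolding lcomb_def by (subst sum.remove[of I i]) (auto intro: sum.neutral)

lemma lcomb_reindex:
  "inj_on h J \<Longrightarrow> lcomb b (h ` J) x = lcomb (\<lambda>j. b (h j)) J (\<lambda>j. x (h j))"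
  by (simp add: lcomb_def sum.reindex)

lemma lcomb_lcomb:
  assumes "finite I" "finite J"
  shows "lcomb (\<lambda>j. lcomb b I (X j)) J y = lcomb b I (\<lambda>i. \<Sum>j\<in>J. y j * X j i)"
  unfolding lcomb_def
  by (subst sum.swap[of _ I J] | simp add: scale_sum_right scale_sum_left)+

lemma indepD: "indep b I \<Longrightarrow> lcomb b I x = lcomb b I y \<Longrightarrow> i \<in> I \<Longrightarrow> x i = y i"
proof -
  assume a: "indep b I" "lcomb b I x = lcomb b I y" "i \<in> I"
  then have "lcomb b I (\<lambda>i. x i - y i) = 0" using lcomb_diff[of b I x y] by simp
  then show "x i = y i" using a(1,3) unfolding indep_def by (metis eq_iff_diff_eq_0)
qed

lemma indep_cong: "(\<And>i. i \<in> I \<Longrightarrow> b i = c i) \<Longrightarrow> indep b I \<longleftrightarrow> indep c I"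
  by (simp add: indep_def lcomb_def)

lemma indep_mono: "finite I \<Longrightarrow> indep b I \<Longrightarrow> A \<subseteq> I \<Longrightarrow> indep b A"
proof (unfold indep_def, intro allI impI ballI)
  fix x i assume a: "finite I" "\<forall>x. lcomb b I x = 0 \<longrightarrow> (\<forall>i\<in>I. x i = 0)" "A \<subseteq> I" "lcomb b A x = 0" "i \<in> A"
  then have "lcomb b I (\<lambda>i. if i \<in> A then x i else 0) = 0" using lcomb_restrict[of I A b x] by simp
  with a(2) have "\<forall>i\<in>I. (if i \<in> A then x i else 0) = 0" by blast
  with a(3,5) have "(if i \<in> A then x i else 0) = 0" by blast
  then show "x i = 0" using a(5) by simp
qed

lemma Ksp_cong: "(\<And>i. i \<in> I \<Longrightarrow> b i = c i) \<Longrightarrow> Ksp b I = Ksp c I"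
  by (simp add: Ksp_def lcomb_def)

lemma Rsp_cong: "(\<And>i. i \<in> I \<Longrightarrow> b i = c i) \<Longrightarrow> Rsp b I = Rsp c I"
  by (simp add: Rsp_def lcomb_def)

lemma subspace_Ksp: "subspace (Ksp b I)"
proof (rule subspaceI)
  show "0 \<in> Ksp b I" unfolding Ksp_def using lcomb_zero[of I "\<lambda>_. 0" b] by (metis rangeI)
qed (auto simp: Ksp_def lcomb_add lcomb_scale)

lemma Ksp_base: "finite I \<Longrightarrow> i \<in> I \<Longrightarrow> b i \<in> Ksp b I"
  unfolding Ksp_def using lcomb_single[of I i b 1] by (metis scale_one rangeI)

lemma lcomb_in_subspace: "subspace U \<Longrightarrow> (\<And>i. i \<in> I \<Longrightarrow> v i \<in> U) \<Longrightarrow> lcomb v I x \<in> U"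
  unfolding lcomb_def by (intro subspace_sum subspace_scale)

lemma Ksp_subset: "subspace U \<Longrightarrow> (\<And>i. i \<in> I \<Longrightarrow> v i \<in> U) \<Longrightarrow> Ksp v I \<subseteq> U"
  unfolding Ksp_def using lcomb_in_subspace by blast

lemma Ksp_mono: "finite I \<Longrightarrow> A \<subseteq> I \<Longrightarrow> Ksp b A \<subseteq> Ksp b I"
  by (intro Ksp_subset subspace_Ksp) (auto intro: Ksp_base)

lemma Rsp_subset_Ksp: "Rsp b I \<subseteq> Ksp b I"
  unfolding Rsp_def Ksp_def by auto

lemma Rsp_0: "0 \<in> Rsp b I"
  unfolding Rsp_def by (rule image_eqI[of _ _ "\<lambda>_. 0"]) (auto simp: lcomb_zero)

lemma Rsp_add: "u \<in> Rsp b I \<Longrightarrow> v \<in> Rsp b I \<Longrightarrow> u + v \<in> Rsp b I"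
  unfolding Rsp_def by (auto simp: lcomb_add intro!: imageI absv_add_le_1)

lemma Rsp_diff: "u \<in> Rsp b I \<Longrightarrow> v \<in> Rsp b I \<Longrightarrow> u - v \<in> Rsp b I"
  unfolding Rsp_def by (auto simp: lcomb_diff intro!: imageI absv_diff_le_1)

lemma Rsp_scale: "absv r \<le> 1 \<Longrightarrow> u \<in> Rsp b I \<Longrightarrow> r *s u \<in> Rsp b I"
  unfolding Rsp_def by (auto simp: lcomb_scale intro!: imageI absv_mult_le_1)

lemma Rsp_sum: "(\<And>j. j \<in> J \<Longrightarrow> f j \<in> Rsp b I) \<Longrightarrow> sum f J \<in> Rsp b I"
  by (induction J rule: infinite_finite_induct) (auto intro: Rsp_0 Rsp_add)

lemma Rsp_base: "finite I \<Longrightarrow> i \<in> I \<Longrightarrow> b i \<in> Rsp b I"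
  unfolding Rsp_def using lcomb_single[of I i b 1]
  by (intro image_eqI[of _ _ "\<lambda>j. if j = i then 1 else 0"]) auto

lemma Rsp_subset: "(\<And>i. i \<in> J \<Longrightarrow> v i \<in> Rsp b I) \<Longrightarrow> Rsp v J \<subseteq> Rsp b I"
  by (auto simp: Rsp_def[of v] lcomb_def[of v] intro!: Rsp_sum Rsp_scale)

lemma Rsp_mono: "finite I \<Longrightarrow> A \<subseteq> I \<Longrightarrow> Rsp b A \<subseteq> Rsp b I"
  by (intro Rsp_subset) (auto intro: Rsp_base)

lemma indep_lcomb_Rsp_iff:
  "indep b I \<Longrightarrow> lcomb b I x \<in> Rsp b I \<longleftrightarrow> (\<forall>i\<in>I. absv (x i) \<le> 1)"
  unfolding Rsp_def by (auto dest: indepD)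

lemma max_absv_exists:
  assumes "finite I" "I \<noteq> {}"
  obtains i where "i \<in> I" "\<And>j. j \<in> I \<Longrightarrow> absv (x j) \<le> absv (x i)"
proof -
  have "Max ((\<lambda>i. absv (x i)) ` I) \<in> (\<lambda>i. absv (x i)) ` I" using assms by (intro Max_in) auto
  then obtain i where "i \<in> I" "Max ((\<lambda>i. absv (x i)) ` I) = absv (x i)" by auto
  then show ?thesis using that[of i] Max_ge[of "(\<lambda>i. absv (x i)) ` I"] assms by (metis finite_imageI imageI)
qed

lemma bounded_by_scalar:
  assumes "finite I"
  obtains c where "absv c \<ge> 1" "\<And>i. i \<in> I \<Longrightarrow> absv (x i) \<le> absv c"
proof (cases "\<exists>i\<in>I. absv (x i) > 1")
  case True
  then obtain i where i: "i \<in> I" "\<And>j. j \<in> I \<Longrightarrow> absv (x j) \<le> absv (x i)"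
    using max_absv_exists[OF assms, of x] by auto
  then have "absv (x i) \<ge> 1" using True by force
  then show ?thesis using that[of "x i"] i by blast
next
  case False
  then show ?thesis using that[of 1] by force
qed

text \<open>Denominators can be cleared: divide by a coordinate of largest absolute value.\<close>

lemma Ksp_scaled_in_Rsp:
  assumes "finite I" "v \<in> Ksp b I"
  obtains c where "c \<noteq> 0" "absv c \<le> 1" "c *s v \<in> Rsp b I"
proof -
  obtain x where x: "v = lcomb b I x" using assms by (auto simp: Ksp_def)
  obtain c where c: "absv c \<ge> 1" "\<And>i. i \<in> I \<Longrightarrow> absv (x i) \<le> absv c"
    using bounded_by_scalar[OF assms(1), of x] by blast
  have "c \<noteq> 0" using c(1) by auto
  moreover have "inverse c *s v \<in> Rsp b I"
    unfolding x lcomb_scale Rsp_def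
  proof (intro imageI CollectI ballI)
    fix i assume "i \<in> I"
    then have "absv (x i) / absv c \<le> 1" using c(2) absv_pos_iff[of c] \<open>c \<noteq> 0\<close> by simp
    then show "absv (inverse c * x i) \<le> 1" by (simp add: absv_divide field_simps)
  qed
  moreover have "absv (inverse c) \<le> 1" using c(1) by (simp add: absv_inverse inverse_le_1_iff)
  ultimately show ?thesis using that[of "inverse c"] by auto
qed

lemma Ksp_subset_if_Rsp_subset:
  assumes "finite I" "Rsp b I \<subseteq> Rsp c J"
  shows "Ksp b I \<subseteq> Ksp c J"
proof (rule Ksp_subset[OF subspace_Ksp])
  show "b i \<in> Ksp c J" if "i \<in> I" for i
    using Rsp_base[OF assms(1) that, of b] assms Rsp_subset_Ksp[of c J] by blast
qed

lemma Ksp_eq_if_Rsp_eq: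
  "finite I \<Longrightarrow> finite J \<Longrightarrow> Rsp b I = Rsp c J \<Longrightarrow> Ksp b I = Ksp c J"
  by (intro subset_antisym Ksp_subset_if_Rsp_subset) auto

lemma Ksp_Un:
  assumes "finite A" "finite B" "A \<inter> B = {}"
  shows "Ksp b (A \<union> B) = {u + v |u v. u \<in> Ksp b A \<and> v \<in> Ksp b B}"
proof safe
  show "\<exists>u va. v = u + va \<and> u \<in> Ksp b A \<and> va \<in> Ksp b B" if "v \<in> Ksp b (A \<union> B)" for v
    using that lcomb_Un[OF assms, of b] unfolding Ksp_def by auto
  show "u + v \<in> Ksp b (A \<union> B)" if "u \<in> Ksp b A" "v \<in> Ksp b B" for u v
    using that assms Ksp_mono[of "A \<union> B" A b] Ksp_mono[of "A \<union> B" B b]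
    by (intro subspace_add[OF subspace_Ksp]) auto
qed

lemma Rsp_Un:
  assumes "finite A" "finite B" "A \<inter> B = {}"
  shows "Rsp b (A \<union> B) = {u + v |u v. u \<in> Rsp b A \<and> v \<in> Rsp b B}"
proof safe
  show "\<exists>u va. v = u + va \<and> u \<in> Rsp b A \<and> va \<in> Rsp b B" if v: "v \<in> Rsp b (A \<union> B)" for v
  proof -
    obtain x where x: "v = lcomb b (A \<union> B) x" "\<forall>i\<in>A \<union> B. absv (x i) \<le> 1"
      using v by (auto simp: Rsp_def)
    then have "lcomb b A x \<in> Rsp b A" "lcomb b B x \<in> Rsp b B" by (auto simp: Rsp_def)
    then show ?thesis using x lcomb_Un[OF assms, of b x] by blast
  qed
  show "u + v \<in> Rsp b (A \<union> B)" if "u \<in> Rsp b A" "v \<in> Rsp b B" for u v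
    using that assms Rsp_mono[of "A \<union> B" A b] Rsp_mono[of "A \<union> B" B b]
    by (intro Rsp_add) auto
qed

text \<open>An \<open>R\<close>-basis of a direct sum may be changed on one summand alone.\<close>

lemma indep_glue:
  assumes "finite A" "finite B" "A \<inter> B = {}" "indep b (A \<union> B)" "indep c A" "Rsp c A = Rsp b A"
  defines "b' \<equiv> (\<lambda>i. if i \<in> A then c i else b i)"
  shows "indep b' (A \<union> B)" "Rsp b' (A \<union> B) = Rsp b (A \<union> B)"
proof -
  have eq: "Rsp b' A = Rsp b A" "Rsp b' B = Rsp b B"
  proof -
    have "Rsp b' A = Rsp c A" by (rule Rsp_cong) (simp add: b'_def)
    then show "Rsp b' A = Rsp b A" using assms(6) by simp
    show "Rsp b' B = Rsp b B" by (rule Rsp_cong) (use assms(3) in \<open>auto simp: b'_def\<close>)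
  qed
  show "Rsp b' (A \<union> B) = Rsp b (A \<union> B)" unfolding Rsp_Un[OF assms(1-3)] eq ..
  show "indep b' (A \<union> B)" unfolding indep_def
  proof (intro allI impI)
    fix x assume 0: "lcomb b' (A \<union> B) x = 0"
    have "lcomb b' A x = lcomb c A x" "lcomb b' B x = lcomb b B x"
      using assms(3) by (auto simp: b'_def intro!: lcomb_cong)
    then have 1: "lcomb c A x + lcomb b B x = 0" using 0 by (simp add: lcomb_Un[OF assms(1-3)])
    have "lcomb c A x \<in> Ksp b A" using Ksp_eq_if_Rsp_eq[OF assms(1,1,6)] by (auto simp: Ksp_def)
    then obtain y where y: "lcomb c A x = lcomb b A y" by (auto simp: Ksp_def)
    let ?z = "\<lambda>i. if i \<in> A then y i else x i"
    have "lcomb b (A \<union> B) ?z = lcomb b A y + lcomb b B x"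
      unfolding lcomb_Un[OF assms(1-3)] using assms(3)
      by (intro arg_cong2[where f = "(+)"] lcomb_cong) auto
    then have "lcomb b (A \<union> B) ?z = 0" using 1 y by simp
    then have "\<forall>i\<in>A \<union> B. ?z i = 0" using assms(4) unfolding indep_def by blast
    then have z: "?z i = 0" if "i \<in> A \<union> B" for i using that by blast
    have "y i = 0" if "i \<in> A" for i using z[of i] that by simp
    moreover have xB: "\<forall>i\<in>B. x i = 0"
    proof
      fix i assume i: "i \<in> B"
      then have "i \<notin> A" using assms(3) by blast
      then show "x i = 0" using z[of i] i by simp
    qed
    ultimately have "\<forall>i\<in>A. y i = 0" by blast
    then have "lcomb c A x = 0" using y by (simp add: lcomb_zero)
    then have "\<forall>i\<in>A. x i = 0" using assms(5) by (simp add: indep_def)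
    then show "\<forall>i\<in>A \<union> B. x i = 0" using xB by blast
  qed
qed

text \<open>This and the next lemma: a block triangular change of basis keeps independence when the diagonal
  scalars are nonzero, and keeps the lattice when they are units and the other entries are integral.\<close>

lemma indep_triangular:
  assumes "finite A" "finite B" "A \<inter> B = {}" "indep b (A \<union> B)"
    and t0: "\<And>i. i \<in> B \<Longrightarrow> t i \<noteq> 0" and z: "\<And>i. i \<in> B \<Longrightarrow> z i \<in> Ksp b A"
  defines "b' \<equiv> (\<lambda>i. if i \<in> B then t i *s b i + z i else b i)"
  shows "indep b' (A \<union> B)"
  unfolding indep_def
proof (intro allI impI)
  fix x assume 0: "lcomb b' (A \<union> B) x = 0"
  have A: "lcomb b' A x = lcomb b A x" using assms(3) by (auto simp: b'_def intro!: lcomb_cong)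
  have "\<forall>i\<in>B. \<exists>y. z i = lcomb b A y" using z by (auto simp: Ksp_def)
  then obtain Z where Z: "\<And>i. i \<in> B \<Longrightarrow> z i = lcomb b A (Z i)" by metis
  have "lcomb b' B x = lcomb b B (\<lambda>i. x i * t i) + lcomb (\<lambda>i. lcomb b A (Z i)) B x"
    unfolding lcomb_def by (simp add: b'_def Z scale_right_distrib sum.distrib lcomb_def)
  also have "lcomb (\<lambda>i. lcomb b A (Z i)) B x = lcomb b A (\<lambda>i. \<Sum>j\<in>B. x j * Z j i)"
    using assms by (intro lcomb_lcomb) auto
  finally have "lcomb b A x + (lcomb b B (\<lambda>i. x i * t i) + lcomb b A (\<lambda>i. \<Sum>j\<in>B. x j * Z j i)) = 0"
    using 0 by (simp add: lcomb_Un[OF assms(1-3)] A)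
  then have 1: "lcomb b A (\<lambda>i. x i + (\<Sum>j\<in>B. x j * Z j i)) + lcomb b B (\<lambda>i. x i * t i) = 0"
    by (simp add: lcomb_add[symmetric] algebra_simps)
  let ?y = "\<lambda>i. if i \<in> A then x i + (\<Sum>j\<in>B. x j * Z j i) else x i * t i"
  have "lcomb b (A \<union> B) ?y = 0"
    unfolding lcomb_Un[OF assms(1-3)] 1[symmetric] using assms(3)
    by (intro arg_cong2[where f = "(+)"] lcomb_cong) auto
  then have y: "\<forall>i\<in>A \<union> B. ?y i = 0" using assms(4) unfolding indep_def by blast
  then have xB: "x i = 0" if "i \<in> B" for i
  proof -
    have "i \<notin> A" using that assms(3) by blast
    then show ?thesis using bspec[OF y, of i] t0[OF that] that by simp
  qed
  then have "x i = 0" if "i \<in> A" for i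
    using that bspec[OF y, of i] by (simp add: sum.neutral)
  then show "\<forall>i\<in>A \<union> B. x i = 0" using xB by blast
qed

lemma Rsp_triangular:
  assumes "finite A" "finite B" "A \<inter> B = {}"
    and t: "\<And>i. i \<in> B \<Longrightarrow> absv (t i) = 1" and z: "\<And>i. i \<in> B \<Longrightarrow> z i \<in> Rsp b A"
  defines "b' \<equiv> (\<lambda>i. if i \<in> B then t i *s b i + z i else b i)"
  shows "Rsp b' (A \<union> B) = Rsp b (A \<union> B)"
proof (rule subset_antisym; rule Rsp_subset)
  fix i assume i: "i \<in> A \<union> B"
  have A: "lcomb b' A x = lcomb b A x" for x using assms(3) by (auto simp: b'_def intro!: lcomb_cong)
  have RA: "Rsp b' A = Rsp b A" using A by (simp add: Rsp_def)
  have t0: "t i \<noteq> 0" if "i \<in> B" for i using t[OF that] by auto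
  have fin: "finite (A \<union> B)" using assms by simp
  show "b' i \<in> Rsp b (A \<union> B)"
    using i z Rsp_mono[OF fin, of A b] t Rsp_base[OF fin, of _ b]
    by (auto simp: b'_def intro!: Rsp_add Rsp_scale)
  show "b i \<in> Rsp b' (A \<union> B)"
  proof (cases "i \<in> B")
    case True
    have "b i = inverse (t i) *s (b' i - z i)" using True t0[OF True] by (simp add: b'_def)
    moreover have "z i \<in> Rsp b' (A \<union> B)" using z[OF True] RA Rsp_mono[OF fin, of A b'] by auto
    ultimately show ?thesis
      using Rsp_base[OF fin i, of b'] t[OF True] by (auto simp: absv_inverse intro!: Rsp_scale Rsp_diff)
  next
    case False
    then have "b i = b' i" by (simp add: b'_def)
    then show ?thesis using Rsp_base[OF fin i, of b'] by simp
  qed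
qed

lemma indep_image:
  assumes "finite I" "indep b I"
  shows "inj_on b I" "independent (b ` I)"
proof -
  show inj: "inj_on b I"
  proof (rule inj_onI, rule ccontr)
    fix i j assume ij: "i \<in> I" "j \<in> I" "b i = b j" "i \<noteq> j"
    have "lcomb b I (\<lambda>k. if k = i then 1 else 0) = lcomb b I (\<lambda>k. if k = j then 1 else 0)"
      using ij by (simp add: lcomb_single[OF assms(1)])
    then have "(if i = i then 1 else 0::'k) = (if i = j then 1 else 0)"
      by (rule indepD[OF assms(2) _ ij(1)])
    then show False using ij(4) by simp
  qed
  show "independent (b ` I)"
    unfolding dependent_finite[OF finite_imageI[OF assms(1)]]
  proof clarify
    fix u i assume u: "(\<Sum>v\<in>b ` I. u v *s v) = 0" "i \<in> I" "u (b i) \<noteq> 0"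
    have "lcomb b I (u \<circ> b) = 0" using u(1) by (simp add: lcomb_def sum.reindex[OF inj])
    then show False using assms(2) u by (auto simp: indep_def)
  qed
qed

lemma span_image_Ksp: "finite I \<Longrightarrow> span (b ` I) = Ksp b I"
  by (intro subset_antisym span_minimal subspace_Ksp Ksp_subset subspace_span)
    (auto intro: Ksp_base span_base)

lemma indep_card_le:
  assumes "finite I" "finite J" "indep v J" "\<And>j. j \<in> J \<Longrightarrow> v j \<in> Ksp b I"
  shows "card J \<le> card I"
proof -
  have "card (v ` J) \<le> card (b ` I)"
    using independent_span_bound[of "b ` I" "v ` J"] indep_image[OF assms(2,3)] assms
    by (auto simp: span_image_Ksp)
  then show ?thesis
    using card_image[OF indep_image(1)[OF assms(2,3)]] card_image_le[OF assms(1), of b] by simp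
qed

lemma dim_Ksp: "finite I \<Longrightarrow> indep b I \<Longrightarrow> dim (Ksp b I) = card I"
  using dim_span_eq_card_independent[of "b ` I"] indep_image[of I b]
  by (simp add: span_image_Ksp card_image)

text \<open>The elementary divisor theorem for the finitely generated \<open>R\<close>-module \<open>Rsp v J\<close>, by pivoting.
  Among all coordinates of all generators take one of largest absolute value, say the coordinate
  \<open>c0\<close> of \<open>v j0\<close> at \<open>i0\<close>. Then \<open>v j0 / c0\<close> is integral with coordinate 1 at \<open>i0\<close>, so it can replace
  \<open>b i0\<close>; and subtracting integral multiples of \<open>v j0\<close> makes the \<open>i0\<close>-coordinate of all
  generators 0, which leaves a problem over \<open>I - {i0}\<close>.\<close>

theorem stacked_bases:
  assumes "finite I" "finite J" "indep b I" "\<And>j. j \<in> J \<Longrightarrow> v j \<in> Ksp b I"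
  shows "\<exists>b' c I'. I' \<subseteq> I \<and> indep b' I \<and> Rsp b' I = Rsp b I \<and> (\<forall>i\<in>I'. c i \<noteq> 0) \<and>
    Rsp v J = Rsp (\<lambda>i. c i *s b' i) I'"
  using assms
proof (induction I arbitrary: b v rule: finite_psubset_induct)
  case (psubset I)
  show ?case
  proof (cases "\<forall>j\<in>J. v j = 0")
    case True
    have "Rsp v J = {0}" using True Rsp_0[of v J] unfolding Rsp_def by (auto simp: lcomb_def)
    moreover have "Rsp (\<lambda>i. 0 *s b i) {} = {0}" using Rsp_0[of _ "{}"] unfolding Rsp_def by (auto simp: lcomb_def)
    ultimately show ?thesis using psubset.prems by (intro exI[of _ b] exI[of _ "\<lambda>_. 0"] exI[of _ "{}"]) auto
  next
    case False
    have "\<forall>j\<in>J. \<exists>x. v j = lcomb b I x" using psubset.prems(3) by (auto simp: Ksp_def)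
    then obtain X where X: "\<And>j. j \<in> J \<Longrightarrow> v j = lcomb b I (X j)" by metis
    have "\<exists>j\<in>J. \<exists>i\<in>I. X j i \<noteq> 0" using False X lcomb_zero[of I _ b] by metis
    then have ne: "J \<times> I \<noteq> {}" by auto
    obtain p where p: "p \<in> J \<times> I" "\<And>q. q \<in> J \<times> I \<Longrightarrow> absv (X (fst q) (snd q)) \<le> absv (X (fst p) (snd p))"
      using max_absv_exists[of "J \<times> I" "\<lambda>q. X (fst q) (snd q)"] ne psubset by blast
    define j0 i0 c0 where "j0 = fst p" and "i0 = snd p" and "c0 = X j0 i0"
    have j0: "j0 \<in> J" and i0: "i0 \<in> I" using p(1) by (auto simp: j0_def i0_def)
    have mx: "absv (X j i) \<le> absv c0" if "j \<in> J" "i \<in> I" for j i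
      using p(2)[of "(j, i)"] that by (simp add: c0_def i0_def j0_def)
    have c0: "c0 \<noteq> 0"
    proof
      assume "c0 = 0"
      then have "X j i = 0" if "j \<in> J" "i \<in> I" for j i
        using mx[OF that] absv_pos_iff[of "X j i"] by auto
      then show False using \<open>\<exists>j\<in>J. \<exists>i\<in>I. X j i \<noteq> 0\<close> by blast
    qed
    have mx1: "absv (X j i / c0) \<le> 1" if "j \<in> J" "i \<in> I" for j i
      using mx[OF that] c0 by (simp add: absv_divide absv_pos_iff divide_le_eq)
    let ?A = "I - {i0}"
    have I: "I = ?A \<union> {i0}" using i0 by blast
    have fin: "finite ?A" "finite {i0}" "finite I" using psubset by auto
    define a where "a = inverse c0 *s v j0"
    have a: "a = 1 *s b i0 + lcomb b ?A (\<lambda>i. X j0 i / c0)"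
    proof -
      have "v j0 = lcomb b ?A (X j0) + lcomb b {i0} (X j0)"
        unfolding X[OF j0] by (subst I, subst lcomb_Un) (use fin in auto)
      moreover have "lcomb b {i0} (X j0) = c0 *s b i0" by (simp add: lcomb_def c0_def)
      ultimately show ?thesis using c0
        by (simp add: a_def scale_right_distrib lcomb_scale field_simps)
    qed
    define b1 where "b1 = (\<lambda>i. if i \<in> {i0} then 1 *s b i + lcomb b ?A (\<lambda>i. X j0 i / c0) else b i)"
    have ind: "indep b (?A \<union> {i0})" using psubset.prems(2) I by simp
    have zR: "lcomb b ?A (\<lambda>i. X j0 i / c0) \<in> Rsp b ?A" unfolding Rsp_def using mx1[OF j0] by auto
    let ?z = "lcomb b ?A (\<lambda>i. X j0 i / c0)"
    have "indep b1 (?A \<union> {i0})"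
      unfolding b1_def
      by (rule indep_triangular[OF fin(1,2) _ ind, of "\<lambda>_. 1" "\<lambda>_. ?z"]) (use zR Rsp_subset_Ksp in auto)
    moreover have "Rsp b1 (?A \<union> {i0}) = Rsp b (?A \<union> {i0})"
      unfolding b1_def by (rule Rsp_triangular[OF fin(1,2), of "\<lambda>_. 1" "\<lambda>_. ?z"]) (use zR in auto)
    ultimately have b1: "indep b1 (?A \<union> {i0})" "Rsp b1 (?A \<union> {i0}) = Rsp b (?A \<union> {i0})" .
    have b1a: "b1 i0 = a" by (simp add: b1_def a)
    define v' where "v' = (\<lambda>j. v j - (X j i0 / c0) *s v j0)"
    have v': "v' j \<in> Ksp b ?A" if j: "j \<in> J" for j
    proof -
      have "v' j = lcomb b I (\<lambda>i. X j i - X j i0 / c0 * X j0 i)"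
        unfolding v'_def X[OF j] X[OF j0] lcomb_scale lcomb_diff ..
      also have "\<dots> = lcomb b ?A (\<lambda>i. X j i - X j i0 / c0 * X j0 i)"
        unfolding lcomb_restrict[OF fin(3), of ?A, OF Diff_subset]
        using c0 by (intro lcomb_cong) (auto simp: c0_def[symmetric])
      finally show ?thesis by (simp add: Ksp_def)
    qed
    have "?A \<subset> I" using i0 by blast
    then have ex: "\<exists>b' c I'. I' \<subseteq> ?A \<and> indep b' ?A \<and> Rsp b' ?A = Rsp b ?A \<and> (\<forall>i\<in>I'. c i \<noteq> 0) \<and>
        Rsp v' J = Rsp (\<lambda>i. c i *s b' i) I'"
      by (rule psubset.IH) (use psubset.prems(1) indep_mono[OF fin(3) psubset.prems(2)] v' in auto)
    obtain b' c I' where IH: "I' \<subseteq> ?A" "indep b' ?A" "Rsp b' ?A = Rsp b ?A" "\<forall>i\<in>I'. c i \<noteq> 0"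
      "Rsp v' J = Rsp (\<lambda>i. c i *s b' i) I'"
      using ex by (elim exE conjE) (rule that)
    have finI': "finite I'" using IH(1) fin(1) finite_subset by blast
    have "Rsp b1 ?A = Rsp b ?A" by (rule Rsp_cong) (auto simp: b1_def)
    then have RA: "Rsp b' ?A = Rsp b1 ?A" using IH(3) by simp
    define b2 where "b2 = (\<lambda>i. if i \<in> ?A then b' i else b1 i)"
    have b2: "indep b2 (?A \<union> {i0})" "Rsp b2 (?A \<union> {i0}) = Rsp b1 (?A \<union> {i0})"
      unfolding b2_def by (rule indep_glue[OF fin(1,2) _ b1(1) IH(2) RA]; simp)+
    define c' where "c' = c(i0 := c0)"
    have b2A: "c' i *s b2 i = c i *s b' i" if "i \<in> I'" for i using that IH(1) by (auto simp: b2_def c'_def)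
    have b2i0: "c' i0 *s b2 i0 = v j0" using c0 by (simp add: b2_def c'_def b1a a_def)
    have fins: "finite (insert i0 I')" using finI' by simp
    have R: "Rsp v J = Rsp (\<lambda>i. c' i *s b2 i) (insert i0 I')"
    proof (rule subset_antisym; rule Rsp_subset)
      fix j assume j: "j \<in> J"
      have "v' j \<in> Rsp (\<lambda>i. c' i *s b2 i) I'"
        using Rsp_base[OF psubset.prems(1) j, of v'] IH(5) b2A
          Rsp_cong[of I' "\<lambda>i. c' i *s b2 i" "\<lambda>i. c i *s b' i"] by auto
      then have "v' j \<in> Rsp (\<lambda>i. c' i *s b2 i) (insert i0 I')"
        using Rsp_mono[OF fins, of I' "\<lambda>i. c' i *s b2 i"] by auto
      moreover have "v j0 \<in> Rsp (\<lambda>i. c' i *s b2 i) (insert i0 I')"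
        using Rsp_base[OF fins, of i0 "\<lambda>i. c' i *s b2 i"] b2i0 by simp
      moreover have "v j = v' j + (X j i0 / c0) *s v j0" by (simp add: v'_def)
      ultimately show "v j \<in> Rsp (\<lambda>i. c' i *s b2 i) (insert i0 I')"
        using mx1[OF j i0] by (auto intro!: Rsp_add Rsp_scale)
    next
      fix i assume i: "i \<in> insert i0 I'"
      show "c' i *s b2 i \<in> Rsp v J"
      proof (cases "i = i0")
        case True then show ?thesis using b2i0 Rsp_base[OF psubset.prems(1) j0, of v] by simp
      next
        case False
        then have iI: "i \<in> I'" using i by simp
        have "c i *s b' i \<in> Rsp v' J" unfolding IH(5) by (rule Rsp_base[OF finI' iI])
        moreover have "Rsp v' J \<subseteq> Rsp v J"
          using mx1 i0 by (intro Rsp_subset) (auto simp: v'_def intro!: Rsp_diff Rsp_scale Rsp_base psubset.prems(1) j0)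
        ultimately show ?thesis using b2A[OF iI] by auto
      qed
    qed
    show ?thesis
    proof (intro exI conjI)
      show "insert i0 I' \<subseteq> I" "\<forall>i\<in>insert i0 I'. c' i \<noteq> 0" using IH(1,4) i0 c0 by (auto simp: c'_def)
      show "indep b2 I" "Rsp b2 I = Rsp b I" using b2 b1(2) unfolding I[symmetric] by auto
    qed (rule R)
  qed
qed

lemma Ksp_scaled:
  assumes "finite I" and c: "\<And>i. i \<in> I \<Longrightarrow> c i \<noteq> 0"
  shows "Ksp (\<lambda>i. c i *s b i) I = Ksp b I"
proof (rule subset_antisym)
  show "Ksp (\<lambda>i. c i *s b i) I \<subseteq> Ksp b I"
  proof (rule Ksp_subset[OF subspace_Ksp])
    fix i assume i: "i \<in> I"
    show "c i *s b i \<in> Ksp b I"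
      using Ksp_base[OF assms(1) i, of b] by (rule subspace_scale[OF subspace_Ksp])
  qed
  show "Ksp b I \<subseteq> Ksp (\<lambda>i. c i *s b i) I"
  proof (rule Ksp_subset[OF subspace_Ksp])
    fix i assume i: "i \<in> I"
    have "inverse (c i) *s (c i *s b i) \<in> Ksp (\<lambda>i. c i *s b i) I"
      using Ksp_base[OF assms(1) i, of "\<lambda>i. c i *s b i"] by (rule subspace_scale[OF subspace_Ksp])
    then show "b i \<in> Ksp (\<lambda>i. c i *s b i) I" using c[OF i] by simp
  qed
qed

text \<open>A spanning set of \<open>U\<close> generates an \<open>R\<close>-module with a stacked basis, and over \<open>K\<close> the elementary
  divisors are invertible.\<close>

theorem adapted_basis_subspace:
  assumes "finite I" "indep b I" "subspace U" "U \<subseteq> Ksp b I"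
  obtains b' I' where "I' \<subseteq> I" "indep b' I" "Rsp b' I = Rsp b I" "U = Ksp b' I'"
proof -
  obtain B where B: "B \<subseteq> U" "independent B" "U \<subseteq> span B" using maximal_independent_subset by blast
  have finB: "finite B"
    using independent_span_bound[of "b ` I" B] B assms by (auto simp: span_image_Ksp)
  have U: "Ksp (\<lambda>x. x) B = U"
    using span_image_Ksp[OF finB, of "\<lambda>x. x"] B assms(3) span_minimal[of B U] by auto
  have BK: "x \<in> Ksp b I" if "x \<in> B" for x using that B(1) assms(4) by auto
  have "\<exists>b' c I'. I' \<subseteq> I \<and> indep b' I \<and> Rsp b' I = Rsp b I \<and> (\<forall>i\<in>I'. c i \<noteq> 0) \<and>
    Rsp (\<lambda>x. x) B = Rsp (\<lambda>i. c i *s b' i) I'"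
    by (rule stacked_bases[OF assms(1) finB assms(2) BK])
  then obtain b' c I' where s: "I' \<subseteq> I" "indep b' I" "Rsp b' I = Rsp b I" "\<forall>i\<in>I'. c i \<noteq> 0"
    "Rsp (\<lambda>x. x) B = Rsp (\<lambda>i. c i *s b' i) I'"
    by (elim exE conjE) (rule that)
  have fin: "finite I'" using s assms finite_subset by blast
  have "U = Ksp b' I'"
    using Ksp_eq_if_Rsp_eq[OF finB fin s(5)] U Ksp_scaled[OF fin, of c b'] s(4) by simp
  then show ?thesis using that[OF s(1-3)] by simp
qed

end

section \<open>The normal form of a pair of subspaces\<close>

context local_field_space
begin

lemma Ksp_Int_Rsp:
  assumes "finite I" "indep b I" "J \<subseteq> I"
  shows "Ksp b J \<inter> Rsp b I = Rsp b J"
proof (rule subset_antisym)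
  show "Rsp b J \<subseteq> Ksp b J \<inter> Rsp b I"
    using Rsp_subset_Ksp[of b J] Rsp_mono[OF assms(1,3), of b] by blast
  show "Ksp b J \<inter> Rsp b I \<subseteq> Rsp b J"
  proof
    fix v assume v: "v \<in> Ksp b J \<inter> Rsp b I"
    then obtain x where x: "v = lcomb b J x" by (auto simp: Ksp_def)
    then have "lcomb b I (\<lambda>i. if i \<in> J then x i else 0) \<in> Rsp b I"
      using v lcomb_restrict[OF assms(1,3), of b x] by simp
    then have *: "\<forall>i\<in>I. absv (if i \<in> J then x i else 0) \<le> 1"
      unfolding indep_lcomb_Rsp_iff[OF assms(2)] .
    have "absv (x i) \<le> 1" if "i \<in> J" for i
      using bspec[OF *, of i] that assms(3) by auto
    then show "v \<in> Rsp b J" using x by (auto simp: Rsp_def)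
  qed
qed

text \<open>The sum of the spans of complementary parts of a basis is direct.\<close>

lemma indep_disjoint:
  assumes "finite A" "finite B" "A \<inter> B = {}" "indep b (A \<union> B)" "lcomb b B x \<in> Ksp b A" "i \<in> B"
  shows "x i = 0"
proof -
  obtain y where y: "lcomb b B x = lcomb b A y" using assms(5) by (auto simp: Ksp_def)
  let ?z = "\<lambda>i. if i \<in> A then - y i else x i"
  have "lcomb b (A \<union> B) ?z = lcomb b A (\<lambda>i. (-1) * y i) + lcomb b B x"
    unfolding lcomb_Un[OF assms(1-3)] using assms(3)
    by (intro arg_cong2[where f = "(+)"] lcomb_cong) auto
  also have "\<dots> = 0" unfolding y lcomb_add by (rule lcomb_zero) simp
  finally have "\<forall>i\<in>A \<union> B. ?z i = 0" using assms(4) unfolding indep_def by blast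
  moreover have "i \<notin> A" using assms(3,6) by blast
  ultimately show ?thesis using assms(6) by (metis UnI2)
qed

text \<open>The normal form of a pair of subspaces, over unordered index sets: \<open>A0\<close> spans \<open>E \<inter> F\<close>,
  \<open>A0 \<union> A1\<close> spans \<open>F\<close>, and \<open>E\<close> is spanned modulo \<open>E \<inter> F\<close> by \<open>b' (h i) + p ^ x i *s b' i\<close>, where \<open>i\<close>
  runs through a set \<open>U\<close> of indices outside \<open>F\<close> and \<open>h i \<in> A1\<close>.

  Choose the lattice basis such that parts of it span \<open>E \<inter> F\<close> and \<open>F\<close>. The projection of the lattice
  of \<open>E\<close> along \<open>F\<close> has a stacked basis \<open>c i u i\<close>; lift it to vectors \<open>e i = a i + c i u i\<close> of \<open>E\<close> with
  \<open>a i\<close> in the lattice spanned by \<open>A1\<close>. If \<open>c i\<close> is a unit, then \<open>u i\<close> can absorb the difference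
  between \<open>a i\<close> and any basis vector of that lattice. The other \<open>a i\<close> must be basis vectors
  themselves, and they can be: if an integral combination of them is divisible by the uniformizer,
  then so is the combination of the \<open>e i\<close> with the same coefficients, as these \<open>c i\<close> are divisible;
  and then the coefficients are divisible, because the \<open>e i\<close> are part of a basis of the lattice of \<open>E\<close>.\<close>

theorem adapted_basis_pair:
  assumes fin: "finite I" and b: "indep b I"
    and E: "subspace E" "E \<subseteq> Ksp b I" and F: "subspace F" "F \<subseteq> Ksp b I"
    and dim: "dim E \<le> dim F" and p: "absv p = eps absv"
  shows "\<exists>b' A0 A1 U h x. indep b' I \<and> Rsp b' I = Rsp b I \<and> A0 \<inter> A1 = {} \<and> A0 \<union> A1 \<subseteq> I \<and>
    U \<subseteq> I - (A0 \<union> A1) \<and> inj_on h U \<and> h ` U \<subseteq> A1 \<and> E \<inter> F = Ksp b' A0 \<and> F = Ksp b' (A0 \<union> A1) \<and>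
    E = {w + v |w v. w \<in> Ksp b' A0 \<and> v \<in> Ksp (\<lambda>i. b' (h i) + p ^ x i *s b' i) U}"
proof -
  define L where "L = Rsp b I"
  have p0: "p \<noteq> 0" using p eps_pos by auto
  obtain b1 IF where b1: "IF \<subseteq> I" "indep b1 I" "Rsp b1 I = L" "F = Ksp b1 IF"
    using adapted_basis_subspace[OF fin b F] unfolding L_def by metis
  have finF: "finite IF" using b1(1) fin finite_subset by blast
  have indF: "indep b1 IF" using indep_mono[OF fin b1(2,1)] .
  have subW: "subspace (E \<inter> F)" using E(1) F(1) by (rule subspace_inter)
  have WK: "E \<inter> F \<subseteq> Ksp b1 IF" using b1(4) by simp
  obtain c0 A0 where c0: "A0 \<subseteq> IF" "indep c0 IF" "Rsp c0 IF = Rsp b1 IF" "E \<inter> F = Ksp c0 A0"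
    using adapted_basis_subspace[OF finF indF subW WK] by metis
  define A1 where "A1 = IF - A0"
  define B where "B = I - IF"
  have fins: "finite A0" "finite A1" "finite B"
    using c0(1) finF fin finite_subset unfolding A1_def B_def by auto
  have disj: "A0 \<inter> A1 = {}" "IF \<inter> B = {}" "A0 \<inter> B = {}" "A1 \<inter> B = {}"
    and IF: "A0 \<union> A1 = IF" and I: "IF \<union> B = I"
    using c0(1) b1(1) by (auto simp: A1_def B_def)
  define b3 where "b3 = (\<lambda>i. if i \<in> IF then c0 i else b1 i)"
  have b3: "indep b3 I" "Rsp b3 I = L"
    using indep_glue[OF finF fins(3) disj(2), of b1 c0] b1(2,3) c0(2,3) unfolding I b3_def by auto
  have b3F: "Rsp b3 IF = Rsp b1 IF" using c0(3) Rsp_cong[of IF b3 c0] by (simp add: b3_def)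
  have KF: "Ksp b3 IF = F" using Ksp_eq_if_Rsp_eq[OF finF finF b3F] b1(4) by simp
  have KW: "Ksp b3 A0 = E \<inter> F"
    unfolding c0(4) using c0(1) by (intro Ksp_cong) (auto simp: b3_def)
  have KI: "Ksp b3 I = Ksp b I" 
    by (rule Ksp_eq_if_Rsp_eq[OF fin fin]) (simp only: b3(2) L_def)

  \<comment> \<open>Project a basis \<open>e0\<close> of the lattice of \<open>E\<close> along \<open>F\<close>: \<open>e0 j\<close> is the sum of \<open>r j\<close> in \<open>F\<close> and
    \<open>v j\<close> in the span of \<open>B\<close>.\<close>
  obtain e0 J where e0: "J \<subseteq> I" "indep e0 I" "Rsp e0 I = L" "E = Ksp e0 J"
    using adapted_basis_subspace[OF fin b3(1) E(1)] E(2) KI b3(2) by metis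
  have finJ: "finite J" using e0(1) fin finite_subset by blast
  have EL: "E \<inter> L = Rsp e0 J" using Ksp_Int_Rsp[OF fin e0(2,1)] e0(3,4) by simp
  have "\<forall>j\<in>J. \<exists>y. e0 j = lcomb b3 I y \<and> (\<forall>i\<in>I. absv (y i) \<le> 1)"
    using Rsp_base[OF fin, of _ e0] e0(1,3) b3(2) unfolding Rsp_def by blast
  then obtain X where X: "\<And>j. j \<in> J \<Longrightarrow> e0 j = lcomb b3 I (X j)"
    and X1: "\<And>j i. j \<in> J \<Longrightarrow> i \<in> I \<Longrightarrow> absv (X j i) \<le> 1" by metis
  define v where "v = (\<lambda>j. lcomb b3 B (X j))"
  define r where "r = (\<lambda>j. lcomb b3 IF (X j))"
  have er: "e0 j = r j + v j" if "j \<in> J" for j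
    using X[OF that] lcomb_Un[OF finF fins(3) disj(2)] I by (simp add: r_def v_def)
  have vR: "v j \<in> Rsp b3 B" and rR: "r j \<in> Rsp b3 IF" if "j \<in> J" for j
    using X1[OF that] I unfolding v_def r_def Rsp_def by auto
  have lc_er: "lcomb e0 J y = lcomb r J y + lcomb v J y" for y
    using er by (simp add: lcomb_def scale_right_distrib sum.distrib)
  have indB: "indep b3 B" using indep_mono[OF fin b3(1)] I by auto
  have "\<exists>u c U. U \<subseteq> B \<and> indep u B \<and> Rsp u B = Rsp b3 B \<and> (\<forall>i\<in>U. c i \<noteq> 0) \<and>
    Rsp v J = Rsp (\<lambda>i. c i *s u i) U"
    using vR Rsp_subset_Ksp by (intro stacked_bases[OF fins(3) finJ indB]) blast
  then obtain u c U where U: "U \<subseteq> B" and u: "indep u B" "Rsp u B = Rsp b3 B"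
    and c: "\<forall>i\<in>U. c i \<noteq> 0" and vU: "Rsp v J = Rsp (\<lambda>i. c i *s u i) U"
    by (elim exE conjE) (rule that)
  have finU: "finite U" using U fins(3) finite_subset by blast
  have c1: "absv (c i) \<le> 1" if i: "i \<in> U" for i
  proof -
    have "Rsp v J \<subseteq> Rsp u B" using vR u(2) by (intro Rsp_subset) auto
    then have "c i *s u i \<in> Rsp u B"
      using Rsp_base[OF finU i, of "\<lambda>i. c i *s u i"] vU by auto
    then have "lcomb u B (\<lambda>j. if j = i then c i else 0) \<in> Rsp u B"
      using lcomb_single[OF fins(3), of i u "c i"] i U by auto
    then have "\<forall>j\<in>B. absv (if j = i then c i else 0) \<le> 1" unfolding indep_lcomb_Rsp_iff[OF u(1)] .
    then have "absv (if i = i then c i else 0) \<le> 1" by (rule bspec) (use i U in auto)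
    then show ?thesis by simp
  qed
  have "\<exists>a. a \<in> Rsp b3 A1 \<and> a + c i *s u i \<in> E" if i: "i \<in> U" for i
  proof -
    have "c i *s u i \<in> Rsp v J" using Rsp_base[OF finU i, of "\<lambda>i. c i *s u i"] vU by simp
    then obtain y where y: "c i *s u i = lcomb v J y" "\<forall>j\<in>J. absv (y j) \<le> 1" by (auto simp: Rsp_def)
    have "lcomb r J y \<in> Rsp r J" using y(2) by (auto simp: Rsp_def)
    moreover have "Rsp r J \<subseteq> Rsp b3 (A0 \<union> A1)" using rR unfolding IF by (rule Rsp_subset)
    ultimately obtain w a where wa: "lcomb r J y = w + a" "w \<in> Rsp b3 A0" "a \<in> Rsp b3 A1"
      unfolding Rsp_Un[OF fins(1,2) disj(1)] by blast
    have "lcomb e0 J y \<in> E" unfolding e0(4) by (simp add: Ksp_def)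
    moreover have "w \<in> E" using wa(2) Rsp_subset_Ksp[of b3 A0] KW by blast
    ultimately have "lcomb e0 J y - w \<in> E" by (rule subspace_diff[OF E(1)])
    moreover have "lcomb e0 J y - w = a + c i *s u i" by (simp add: lc_er wa(1) y(1))
    ultimately show ?thesis using wa(3) by auto
  qed
  then obtain a where a: "\<And>i. i \<in> U \<Longrightarrow> a i \<in> Rsp b3 A1" "\<And>i. i \<in> U \<Longrightarrow> a i + c i *s u i \<in> E" by metis
  define e where "e = (\<lambda>i. a i + c i *s u i)"
  have lc_e: "lcomb e U y = lcomb a U y + lcomb (\<lambda>i. c i *s u i) U y" for y
    by (simp add: e_def lcomb_def scale_right_distrib sum.distrib)
  have aF: "a i \<in> F" if "i \<in> U" for i
    using a(1)[OF that] Rsp_subset_Ksp[of b3 A1] Ksp_mono[OF finF, of A1 b3] IF KF by auto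
  have lc_aF: "lcomb a U y \<in> F" for y using aF by (rule lcomb_in_subspace[OF F(1)])
  have lc_eE: "lcomb e U y \<in> E" for y using a(2) unfolding e_def by (intro lcomb_in_subspace[OF E(1)])
  have span: "\<exists>w y. z = w + lcomb e U y \<and> w \<in> E \<inter> F \<and> (\<forall>i\<in>U. absv (y i) \<le> 1)" if z: "z \<in> E" "z \<in> L" for z
  proof -
    obtain y where y: "z = lcomb e0 J y" "\<forall>j\<in>J. absv (y j) \<le> 1" using EL z by (auto simp: Rsp_def)
    have "lcomb v J y \<in> Rsp v J" using y(2) by (auto simp: Rsp_def)
    then obtain t where t: "lcomb v J y = lcomb (\<lambda>i. c i *s u i) U t" "\<forall>i\<in>U. absv (t i) \<le> 1"
      unfolding vU by (auto simp: Rsp_def)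
    have eq: "z - lcomb e U t = lcomb r J y - lcomb a U t" by (simp add: y(1) lc_er lc_e t(1))
    have "lcomb r J y \<in> F"
      using rR Rsp_subset_Ksp[of b3 IF] KF by (intro lcomb_in_subspace[OF F(1)]) auto
    then have "z - lcomb e U t \<in> F" unfolding eq by (rule subspace_diff[OF F(1) _ lc_aF])
    moreover have "z - lcomb e U t \<in> E" by (rule subspace_diff[OF E(1) z(1) lc_eE])
    ultimately show ?thesis using t(2) by (intro exI[of _ "z - lcomb e U t"] exI[of _ t]) auto
  qed

  \<comment> \<open>A vector of \<open>E\<close> determines its coefficients with respect to \<open>e\<close>, because these can be read off
    modulo \<open>F\<close>. By \<open>span\<close>, they are integral if the vector is in the lattice.\<close>
  define b4 where "b4 = (\<lambda>i. if i \<in> B then u i else b3 i)"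
  have b4: "indep b4 (B \<union> IF)" "Rsp b4 (B \<union> IF) = Rsp b3 (B \<union> IF)"
    unfolding b4_def
    by (rule indep_glue[OF fins(3) finF _ _ u]; use disj(2) b3(1) I in \<open>auto simp: Un_commute Int_commute\<close>)+
  have b4F: "Ksp b4 IF = F"
    unfolding KF[symmetric] using disj(2) by (intro Ksp_cong) (auto simp: b4_def)
  have indIFU: "indep b4 (IF \<union> U)" using b4(1) by (rule indep_mono[rotated]) (use U fins(3) finF in auto)
  have disjU: "IF \<inter> U = {}" using U disj(2) by blast
  have coord: "y i = t i" if eq: "f + lcomb e U y = g + lcomb e U t" and fg: "f \<in> F" "g \<in> F" and i: "i \<in> U"
    for f g y t i
  proof -
    have "lcomb e U (\<lambda>i. y i - t i) = g - f"
      using eq unfolding lcomb_diff[symmetric] by (simp add: algebra_simps)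
    then have "lcomb e U (\<lambda>i. y i - t i) \<in> F" using subspace_diff[OF F(1) fg(2,1)] by simp
    then have "lcomb (\<lambda>i. c i *s u i) U (\<lambda>i. y i - t i) \<in> F"
      using subspace_diff[OF F(1) _ lc_aF[of "\<lambda>i. y i - t i"], of "lcomb e U (\<lambda>i. y i - t i)"] lc_e by simp
    also have "lcomb (\<lambda>i. c i *s u i) U (\<lambda>i. y i - t i) = lcomb b4 U (\<lambda>i. (y i - t i) * c i)"
      using U by (auto simp: lcomb_def b4_def intro!: sum.cong)
    finally have "(y i - t i) * c i = 0"
      using indep_disjoint[OF finF finU disjU indIFU] b4F i by blast
    then show ?thesis using c i by simp
  qed
  have coord1: "absv (y i) \<le> 1" if EL: "f + lcomb e U y \<in> E" "f + lcomb e U y \<in> L" and f: "f \<in> F" and i: "i \<in> U" for f y i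
  proof -
    obtain w t where wt: "f + lcomb e U y = w + lcomb e U t" "w \<in> E \<inter> F" "\<forall>i\<in>U. absv (t i) \<le> 1"
      using span[OF EL] by blast
    then have "y i = t i" using coord[OF wt(1) f _ i] by blast
    then show ?thesis using wt(3) i by simp
  qed

  \<comment> \<open>The vectors \<open>a i\<close> with \<open>i \<in> S\<close> span a saturated sublattice: otherwise some combination with
    a coefficient \<open>t j\<close> of absolute value above 1 is integral. Dividing it by \<open>p * t j\<close> keeps it
    integral, and the same combination \<open>lcomb e U s\<close> of the \<open>e i\<close> is integral as well; but its
    coefficient at \<open>j\<close> is \<open>inverse p\<close>.\<close>
  define S where "S = {i\<in>U. absv (c i) < 1}"
  have SU: "S \<subseteq> U" by (auto simp: S_def)
  have finS: "finite S" using SU finU finite_subset by blast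
  have eps_le: "absv (c i) \<le> absv p" if "i \<in> S" for i
    using that discrete_valuation p unfolding S_def by (metis (no_types, lifting) mem_Collect_eq)
  have indA1: "indep b3 A1" using indep_mono[OF fin b3(1)] IF I by auto
  have RA1L: "Rsp b3 A1 \<subseteq> L" using Rsp_mono[OF fin, of A1 b3] IF I b3(2) by auto
  have RuL: "Rsp u B \<subseteq> L" using Rsp_mono[OF fin, of B b3] I b3(2) u(2) by auto
  have L_add: "x + y \<in> L" if "x \<in> L" "y \<in> L" for x y using that unfolding L_def by (rule Rsp_add)
  have prim: "absv (t i) \<le> 1" if t: "lcomb a S t \<in> Rsp b3 A1" and i: "i \<in> S" for t i
  proof (rule ccontr)
    assume not1: "\<not> absv (t i) \<le> 1"
    obtain j where j: "j \<in> S" "\<And>i. i \<in> S \<Longrightarrow> absv (t i) \<le> absv (t j)"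
      using max_absv_exists[OF finS, of t] i by blast
    then have tj: "absv (t j) > 1" using not1 i by force
    then have tj0: "t j \<noteq> 0" by auto
    have "absv (inverse (t j)) < 1" using tj by (simp add: absv_inverse inverse_less_1_iff)
    then have tp: "absv (inverse (t j)) \<le> absv p" using discrete_valuation p by metis
    define s where "s = (\<lambda>i. if i \<in> S then inverse (p * t j) * t i else 0)"
    have "lcomb a U s = inverse (p * t j) *s lcomb a S t"
      unfolding s_def lcomb_scale using lcomb_restrict[OF finU SU, of a "\<lambda>i. inverse (p * t j) * t i"] by simp
    moreover have "absv (inverse (p * t j)) \<le> 1"
    proof -
      have "absv (inverse (p * t j)) = inverse (absv p) * absv (inverse (t j))"
        by (simp add: absv_mult absv_inverse flip: inverse_mult_distrib)
      also have "\<dots> \<le> inverse (absv p) * absv p" using tp eps_pos p by (intro mult_left_mono) auto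
      finally show ?thesis using eps_pos p by simp
    qed
    ultimately have "lcomb a U s \<in> Rsp b3 A1" using t by (simp add: Rsp_scale)
    then have 1: "lcomb a U s \<in> L" using RA1L by blast
    have "lcomb (\<lambda>i. c i *s u i) U s = lcomb u U (\<lambda>i. s i * c i)" by (simp add: lcomb_def)
    also have "\<dots> \<in> Rsp u U"
      unfolding Rsp_def
    proof (intro imageI CollectI ballI)
      fix i assume "i \<in> U"
      show "absv (s i * c i) \<le> 1"
      proof (cases "i \<in> S")
        case True
        have "absv (t i) / absv (t j) \<le> 1" using j(2)[OF True] tj by simp
        moreover have "absv (c i) / absv p \<le> 1" using eps_le[OF True] p eps_pos by simp
        ultimately have "(absv (t i) / absv (t j)) * (absv (c i) / absv p) \<le> 1"
          by (intro mult_le_one) (auto simp: absv_nonneg)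
        moreover have "absv (s i * c i) = (absv (t i) / absv (t j)) * (absv (c i) / absv p)"
          using True by (simp add: s_def absv_mult absv_inverse divide_inverse)
        ultimately show ?thesis by simp
      qed (simp add: s_def)
    qed
    finally have 2: "lcomb (\<lambda>i. c i *s u i) U s \<in> L" using RuL Rsp_mono[OF fins(3) U, of u] by blast
    have "lcomb e U s \<in> L" unfolding lc_e using 1 2 by (rule L_add)
    then have "absv (s j) \<le> 1"
      using coord1[of 0 s j] lc_eE subspace_0[OF F(1)] j(1) SU by auto
    moreover have "s j = inverse p" using j(1) tj0 p0 by (simp add: s_def)
    ultimately show False using p eps_less_1 eps_pos by (simp add: absv_inverse inverse_le_1_iff)
  qed
  have indS: "indep a S" unfolding indep_def
  proof (intro allI impI ballI, rule ccontr)
    fix t i assume t: "lcomb a S t = 0" "i \<in> S" "t i \<noteq> 0"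
    have "lcomb a S (\<lambda>j. inverse (p * t i) * t j) \<in> Rsp b3 A1"
      using t(1) Rsp_0 by (simp flip: lcomb_scale)
    from prim[OF this t(2)] have "absv (inverse (p * t i) * t i) \<le> 1" .
    moreover have "inverse (p * t i) * t i = inverse p" using t(3) p0 by simp
    ultimately have "absv (inverse p) \<le> 1" by (simp only:)
    then show False using p eps_less_1 eps_pos by (simp add: absv_inverse inverse_le_1_iff)
  qed
  have aSR: "Rsp a S \<subseteq> Rsp b3 A1" using a(1) SU by (intro Rsp_subset) auto
  have aSK: "Ksp a S \<subseteq> Ksp b3 A1" by (rule Ksp_subset_if_Rsp_subset[OF finS aSR])
  obtain f IS where f: "IS \<subseteq> A1" "indep f A1" "Rsp f A1 = Rsp b3 A1" "Ksp a S = Ksp f IS"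
    using adapted_basis_subspace[OF fins(2) indA1 subspace_Ksp aSK] by metis
  have finIS: "finite IS" using f(1) fins(2) finite_subset by blast
  have indIS: "indep f IS" using indep_mono[OF fins(2) f(2,1)] .
  have RIS: "Rsp f IS = Rsp a S"
  proof -
    have "Rsp f IS = Ksp a S \<inter> Rsp b3 A1" using Ksp_Int_Rsp[OF fins(2) f(2,1)] f(3,4) by simp
    also have "\<dots> = Rsp a S"
    proof (rule subset_antisym)
      show "Ksp a S \<inter> Rsp b3 A1 \<subseteq> Rsp a S"
      proof
        fix x assume x: "x \<in> Ksp a S \<inter> Rsp b3 A1"
        then obtain t where t: "x = lcomb a S t" by (auto simp: Ksp_def)
        then have "\<forall>i\<in>S. absv (t i) \<le> 1" using prim x by blast
        then show "x \<in> Rsp a S" using t by (auto simp: Rsp_def)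
      qed
      show "Rsp a S \<subseteq> Ksp a S \<inter> Rsp b3 A1" using aSR Rsp_subset_Ksp by blast
    qed
    finally show ?thesis .
  qed
  have cardS: "card S = card IS"
  proof (rule antisym)
    show "card S \<le> card IS"
      using Ksp_base[OF finS, of _ a] f(4) by (intro indep_card_le[OF finIS finS indS]) auto
    show "card IS \<le> card S"
      using Ksp_base[OF finIS, of _ f] f(4) by (intro indep_card_le[OF finS finIS indIS]) auto
  qed
  \<comment> \<open>This is where \<open>dim E \<le> dim F\<close> enters.\<close>
  have cardU: "card U \<le> card A1"
  proof -
    define g where "g = (\<lambda>i. if i \<in> U then c i *s b4 i + a i else b4 i)"
    have "indep g (IF \<union> U)" unfolding g_def
      by (rule indep_triangular[OF finF finU disjU indIFU]) (use c aF b4F in auto)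
    then have "indep g (A0 \<union> U)" by (rule indep_mono[rotated]) (use IF finF finU in auto)
    moreover have "g i \<in> Ksp e0 J" if "i \<in> A0 \<union> U" for i
    proof (cases "i \<in> U")
      case True
      then have "g i = a i + c i *s u i" using U by (auto simp: g_def b4_def)
      then show ?thesis using a(2)[OF True] e0(4) by simp
    next
      case False
      then have iA0: "i \<in> A0" using that by blast
      then have "g i = b3 i" using False IF disj(2) by (auto simp: g_def b4_def)
      then show ?thesis using Ksp_base[OF fins(1) iA0, of b3] KW e0(4) by auto
    qed
    ultimately have "card (A0 \<union> U) \<le> card J"
      using indep_card_le[OF finJ, of "A0 \<union> U" g e0] fins(1) finU by blast
    also have "card J = dim E" using dim_Ksp[OF finJ indep_mono[OF fin e0(2,1)]] e0(4) by simp
    also have "\<dots> \<le> card IF" using dim dim_Ksp[OF finF indF] b1(4) by simp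
    also have "card IF = card A0 + card A1" using IF disj(1) fins by (metis card_Un_disjoint)
    also have "card (A0 \<union> U) = card A0 + card U"
      using U disj fins finU by (intro card_Un_disjoint) auto
    finally show ?thesis by simp
  qed
  obtain h1 where h1: "bij_betw h1 S IS" using finite_same_card_bij[OF finS finIS cardS] by blast
  have "card (U - S) \<le> card (A1 - IS)"
    using cardU cardS card_Diff_subset[OF finS SU] card_Diff_subset[OF finIS f(1)] by simp
  then obtain h2 where h2: "h2 ` (U - S) \<subseteq> A1 - IS" "inj_on h2 (U - S)"
    using card_le_inj[of "U - S" "A1 - IS"] finU fins(2) by auto
  \<comment> \<open>On \<open>S\<close> the index \<open>h i\<close> is that of the basis vector \<open>a i\<close>; on the rest of \<open>U\<close> it is arbitrary.\<close>
  define h where "h = (\<lambda>i. if i \<in> S then h1 i else h2 i)"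
  have hS: "h ` S = IS" and hinjS: "inj_on h S" using h1 by (auto simp: h_def bij_betw_def inj_on_def)
  have hU: "h ` U \<subseteq> A1" using hS h2(1) f(1) SU by (auto simp: h_def)
  have hinj: "inj_on h U"
  proof (rule inj_onI)
    fix i j assume ij: "i \<in> U" "j \<in> U" "h i = h j"
    have h2IS: "h k \<notin> IS" if "k \<in> U" "k \<notin> S" for k using h2(1) that by (auto simp: h_def)
    have hIS: "h k \<in> IS" if "k \<in> S" for k using hS that by blast
    show "i = j"
    proof (cases "i \<in> S")
      case True
      then have "j \<in> S" using hIS[of i] h2IS[of j] ij by auto
      then show ?thesis using inj_onD[OF hinjS ij(3) True] by simp
    next
      case False
      then have "j \<notin> S" using hIS[of j] h2IS[of i] ij by auto
      then have "h2 i = h2 j" using False ij(3) by (simp add: h_def)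
      then show ?thesis by (rule inj_onD[OF h2(2)]) (use False ij \<open>j \<notin> S\<close> in auto)
    qed
  qed
  define k where "k = the_inv_into S h"
  have kh: "k (h i) = i" if "i \<in> S" for i using the_inv_into_f_f[OF hinjS that] by (simp add: k_def)
  define f2 where "f2 = (\<lambda>j. if j \<in> IS then a (k j) else f j)"
  have lc_ak: "lcomb (\<lambda>j. a (k j)) IS y = lcomb a S (\<lambda>i. y (h i))" for y
    using lcomb_reindex[OF hinjS, of "\<lambda>j. a (k j)" y] kh unfolding hS by (auto intro: lcomb_cong)
  have ind_ak: "indep (\<lambda>j. a (k j)) IS"
    unfolding indep_def lc_ak
  proof (intro allI impI ballI)
    fix y j assume y: "lcomb a S (\<lambda>i. y (h i)) = 0" and "j \<in> IS"
    then obtain i where i: "i \<in> S" "j = h i" using hS by blast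
    have "\<forall>i\<in>S. y (h i) = 0" using indS y unfolding indep_def by blast
    then show "y j = 0" using i by simp
  qed
  have R_ak: "Rsp (\<lambda>j. a (k j)) IS = Rsp f IS"
  proof -
    have "Rsp (\<lambda>j. a (k j)) IS = Rsp a S"
    proof (rule subset_antisym; rule Rsp_subset)
      fix j assume "j \<in> IS"
      then obtain i where i: "i \<in> S" "j = h i" using hS by blast
      then show "a (k j) \<in> Rsp a S" using Rsp_base[OF finS i(1)] kh by simp
    next
      fix i assume i: "i \<in> S"
      then have "h i \<in> IS" using hS by blast
      from Rsp_base[OF finIS this, of "\<lambda>j. a (k j)"] show "a i \<in> Rsp (\<lambda>j. a (k j)) IS"
        using kh[OF i] by simp
    qed
    then show ?thesis using RIS by simp
  qed
  have A1S: "IS \<union> (A1 - IS) = A1" using f(1) by blast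
  have f2: "indep f2 A1" "Rsp f2 A1 = Rsp b3 A1"
    using indep_glue[OF finIS, of "A1 - IS" f, OF _ _ _ ind_ak R_ak] fins(2) f(2,3)
    unfolding A1S f2_def by auto
  have f2h: "f2 (h i) = a i" if "i \<in> S" for i using that hS kh by (auto simp: f2_def)

  define b5 where "b5 = (\<lambda>i. if i \<in> A1 then f2 i else b4 i)"
  have I': "A1 \<union> (A0 \<union> B) = I" using IF I by auto
  have I'': "B \<union> IF = I" using I by auto
  have RA1: "Rsp f2 A1 = Rsp b4 A1"
    unfolding f2(2) using disj(4) by (intro Rsp_cong) (auto simp: b4_def)
  have b5: "indep b5 I" "Rsp b5 I = L"
  proof -
    have *: "finite (A0 \<union> B)" "A1 \<inter> (A0 \<union> B) = {}" "indep b4 (A1 \<union> (A0 \<union> B))"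
      using fins disj b4(1) unfolding I' I'' by auto
    show "indep b5 I" "Rsp b5 I = L"
      using indep_glue[OF fins(2) * f2(1) RA1] b4(2) b3(2) unfolding I' I'' b5_def by simp_all
  qed
  have b5W: "Rsp b5 A0 = Rsp b3 A0" using disj by (intro Rsp_cong) (auto simp: b5_def b4_def)
  have b5A1: "Rsp b5 A1 = Rsp b3 A1" using f2(2) Rsp_cong[of A1 b5 f2] by (simp add: b5_def)
  have b5F: "Rsp b5 IF = Rsp b3 IF"
    unfolding IF[symmetric] Rsp_Un[OF fins(1,2) disj(1)] b5W b5A1 ..

  have "\<exists>m. absv (c i) = eps absv ^ m" if "i \<in> U" for i
    using absv_eq_eps_power[of "c i"] c c1 that by blast
  then obtain x where x: "\<And>i. i \<in> U \<Longrightarrow> absv (c i) = eps absv ^ x i" by metis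
  have xS: "p ^ x i = 1" if "i \<in> U" "i \<notin> S" for i
  proof -
    have "eps absv ^ x i = 1" using that x[OF that(1)] c1[OF that(1)] by (auto simp: S_def)
    then have "x i = 0" using power_less_one_iff[of "eps absv" "x i"] eps_pos eps_less_1 by force
    then show ?thesis by simp
  qed
  \<comment> \<open>The new \<open>u i\<close>: divide \<open>c i\<close> by \<open>p ^ x i\<close>, and absorb \<open>z i\<close> where \<open>c i\<close> is a unit.\<close>
  define t where "t = (\<lambda>i. if i \<in> U then c i / p ^ x i else 1)"
  define z where "z = (\<lambda>i. if i \<in> U - S then a i - b5 (h i) else 0)"
  define b6 where "b6 = (\<lambda>i. if i \<in> B then t i *s b5 i + z i else b5 i)"
  have t1: "absv (t i) = 1" if "i \<in> B" for i
    using x eps_pos by (simp add: t_def absv_divide absv_power p)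
  have t0: "t i \<noteq> 0" if "i \<in> B" for i using t1[OF that] by auto
  have zA1: "z i \<in> Rsp b5 IF" if "i \<in> B" for i
  proof (cases "i \<in> U - S")
    case True
    have "a i \<in> Rsp b5 A1" "b5 (h i) \<in> Rsp b5 A1"
      using a(1)[of i] b5A1 Rsp_base[OF fins(2), of "h i" b5] True hU by auto
    then have "z i \<in> Rsp b5 A1" using True by (simp add: z_def Rsp_diff)
    then show ?thesis using Rsp_mono[OF finF, of A1 b5] IF by blast
  next
    case False then have "z i = 0" unfolding z_def by (rule if_not_P)
    then show ?thesis by (simp add: Rsp_0)
  qed
  have b6: "indep b6 I" "Rsp b6 I = L"
    using indep_triangular[OF finF fins(3) disj(2), of b5 t z] Rsp_triangular[OF finF fins(3) disj(2), of t z b5]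
      b5 t0 t1 zA1 Rsp_subset_Ksp[of b5 IF] unfolding I b6_def by blast+
  have b6F: "Ksp b6 IF = F"
  proof -
    have "Ksp b6 IF = Ksp b5 IF" using disj(2) by (intro Ksp_cong) (auto simp: b6_def)
    also have "\<dots> = F" using Ksp_eq_if_Rsp_eq[OF finF finF b5F] KF by simp
    finally show ?thesis .
  qed
  have b6W: "Ksp b6 A0 = E \<inter> F"
  proof -
    have "Ksp b6 A0 = Ksp b5 A0" using disj(3) by (intro Ksp_cong) (auto simp: b6_def)
    also have "\<dots> = E \<inter> F" using Ksp_eq_if_Rsp_eq[OF fins(1,1) b5W] KW by simp
    finally show ?thesis .
  qed
  have eb6: "b6 (h i) + p ^ x i *s b6 i = e i" if i: "i \<in> U" for i
  proof -
    have iB: "i \<in> B" and hi: "h i \<in> A1" using i U hU by auto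
    have h6: "b6 (h i) = f2 (h i)" using hi disj(4) by (auto simp: b6_def b5_def)
    have ui: "b5 i = u i" using iB disj(4) by (auto simp: b5_def b4_def)
    have "p ^ x i *s b6 i = c i *s u i + p ^ x i *s z i"
      using iB i p0 by (simp add: b6_def t_def ui scale_right_distrib)
    moreover have "f2 (h i) + p ^ x i *s z i = a i"
      using f2h[of i] xS[OF i] i hi by (cases "i \<in> S") (auto simp: z_def b5_def)
    ultimately show ?thesis unfolding h6 e_def by (simp add: algebra_simps)
  qed
  have eqE: "E = {w + v |w v. w \<in> Ksp b6 A0 \<and> v \<in> Ksp (\<lambda>i. b6 (h i) + p ^ x i *s b6 i) U}"
  proof -
    have Ke: "Ksp (\<lambda>i. b6 (h i) + p ^ x i *s b6 i) U = Ksp e U" using eb6 by (rule Ksp_cong)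
    have "\<exists>w v. z = w + v \<and> w \<in> E \<inter> F \<and> v \<in> Ksp e U" if z: "z \<in> E" for z
    proof -
      have "z \<in> Ksp b3 I" using z E(2) KI by auto
      then obtain q where q: "q \<noteq> 0" "q *s z \<in> L" using Ksp_scaled_in_Rsp[OF fin] b3(2) by metis
      obtain w y where wy: "q *s z = w + lcomb e U y" "w \<in> E \<inter> F"
        using span[OF subspace_scale[OF E(1) z] q(2)] by blast
      have "z = inverse q *s (q *s z)" using q(1) by simp
      also have "\<dots> = inverse q *s w + inverse q *s lcomb e U y" by (simp add: wy(1) scale_right_distrib)
      finally have "z = inverse q *s w + lcomb e U (\<lambda>i. inverse q * y i)" by (simp add: lcomb_scale)
      moreover have "inverse q *s w \<in> E \<inter> F" using wy(2) by (rule subspace_scale[OF subW])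
      ultimately show ?thesis unfolding Ksp_def by blast
    qed
    moreover have "w + v \<in> E" if "w \<in> E \<inter> F" "v \<in> Ksp e U" for w v
      using that lc_eE subspace_add[OF E(1)] unfolding Ksp_def by auto
    ultimately show ?thesis unfolding Ke b6W by blast
  qed
  show ?thesis
  proof (intro exI conjI)
    show "indep b6 I" "Rsp b6 I = Rsp b I" using b6 L_def by auto
    show "A0 \<inter> A1 = {}" "A0 \<union> A1 \<subseteq> I" "U \<subseteq> I - (A0 \<union> A1)" using disj(1) IF b1(1) U by (auto simp: B_def)
    show "F = Ksp b6 (A0 \<union> A1)" unfolding IF b6F ..
  qed (use hinj hU b6W eqE in auto)
qed

lemma Ksp_reindex: "finite J \<Longrightarrow> Ksp (\<lambda>j. b (h j)) J = Ksp b (h ` J)"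
  by (intro subset_antisym Ksp_subset subspace_Ksp) (auto intro: Ksp_base Ksp_base[of J _ "\<lambda>j. b (h j)"])

lemma Rsp_reindex: "finite J \<Longrightarrow> Rsp (\<lambda>j. b (h j)) J = Rsp b (h ` J)"
  by (intro subset_antisym Rsp_subset) (auto intro: Rsp_base Rsp_base[of J _ "\<lambda>j. b (h j)"])

lemma indep_reindex:
  assumes "inj_on h J" "indep b (h ` J)"
  shows "indep (\<lambda>j. b (h j)) J"
  unfolding indep_def
proof (intro allI impI ballI)
  fix x j assume x: "lcomb (\<lambda>j. b (h j)) J x = 0" and j: "j \<in> J"
  have "lcomb b (h ` J) (\<lambda>i. x (the_inv_into J h i)) = lcomb (\<lambda>j. b (h j)) J x"
    unfolding lcomb_reindex[OF assms(1)] by (rule lcomb_cong) (simp_all add: the_inv_into_f_f[OF assms(1)])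
  then have "lcomb b (h ` J) (\<lambda>i. x (the_inv_into J h i)) = 0" using x by simp
  then have "\<forall>i\<in>h ` J. x (the_inv_into J h i) = 0" using assms(2) unfolding indep_def by blast
  then show "x j = 0" using j by (simp add: the_inv_into_f_f[OF assms(1)])
qed

text \<open>The same normal form with the basis listed in the order \<open>E \<inter> F\<close>, the partners \<open>h i\<close> by increasing
  exponent, the rest of \<open>F\<close>, the indices \<open>i \<in> U\<close> in the same order, the rest.\<close>

theorem relative_position_normal_form:
  assumes fin: "finite I" and b: "indep b I"
    and E: "subspace E" "E \<subseteq> Ksp b I" and F: "subspace F" "F \<subseteq> Ksp b I"
    and dim: "dim E \<le> dim F" and p: "absv p = eps absv"
  shows "\<exists>(\<beta> :: nat \<Rightarrow> 'w) d l m n x. indep \<beta> {..<n} \<and> Rsp \<beta> {..<n} = Rsp b I \<and>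
    d + m \<le> l \<and> l + m \<le> n \<and> E \<inter> F = Ksp \<beta> {..<d} \<and> F = Ksp \<beta> {..<l} \<and>
    E = Ksp (\<lambda>i. if i < d then \<beta> i else \<beta> i + p ^ x (i - d) *s \<beta> (l + (i - d))) {..<d + m} \<and>
    (\<forall>i j. i \<le> j \<longrightarrow> j < m \<longrightarrow> x i \<le> (x j :: nat))"
proof -
  obtain b' A0 A1 U h x0 where b': "indep b' I" "Rsp b' I = Rsp b I"
    and disj: "A0 \<inter> A1 = {}" and sub: "A0 \<union> A1 \<subseteq> I" and U: "U \<subseteq> I - (A0 \<union> A1)"
    and h: "inj_on h U" "h ` U \<subseteq> A1" and W: "E \<inter> F = Ksp b' A0" and F': "F = Ksp b' (A0 \<union> A1)"
    and E': "E = {w + v |w v. w \<in> Ksp b' A0 \<and> v \<in> Ksp (\<lambda>i. b' (h i) + p ^ x0 i *s b' i) U}"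
    using adapted_basis_pair[OF assms] by (elim exE conjE) (rule that)
  have finite: "finite A0" "finite A1" "finite U" "finite (A1 - h ` U)" "finite (I - (A0 \<union> A1) - U)"
    using sub U fin finite_subset by auto
  obtain us0 where us0: "set us0 = U" "distinct us0" using finite_distinct_list[OF finite(3)] by blast
  define us where "us = sort_key x0 us0"
  have us: "set us = U" "distinct us" "sorted (map x0 us)" using us0 by (auto simp: us_def)
  obtain ws where ws: "set ws = A0" "distinct ws" using finite_distinct_list[OF finite(1)] by blast
  obtain fs where fs: "set fs = A1 - h ` U" "distinct fs" using finite_distinct_list[OF finite(4)] by blast
  obtain rs where rs: "set rs = I - (A0 \<union> A1) - U" "distinct rs"
    using finite_distinct_list[OF finite(5)] by blast
  define ls where "ls = ws @ map h us @ fs @ us @ rs"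
  define n where "n = length ls"
  define d where "d = length ws"
  define m where "m = length us"
  define l where "l = d + m + length fs"
  define x where "x = (\<lambda>i. x0 (us ! i))"
  define \<beta> where "\<beta> = (\<lambda>j. b' (ls ! j))"
  have dls: "distinct ls"
    unfolding ls_def distinct_append distinct_map set_append set_map us(1) ws(1) fs(1) rs(1)
    using us(2) ws(2) fs(2) rs(2) h disj U by auto
  have sls: "set ls = I"
    unfolding ls_def set_append set_map us(1) ws(1) fs(1) rs(1) using h U sub by auto
  have inj: "inj_on (nth ls) {..<n}" using dls by (auto simp: n_def intro: inj_on_nth)
  have im: "nth ls ` {..<k} = set (take k ls)" if "k \<le> n" for k
    using nth_image[of k ls] that by (simp add: n_def lessThan_atLeast0)
  have dl: "d + m \<le> l" "l + m \<le> n" by (auto simp: l_def n_def ls_def d_def m_def)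
  have imn: "nth ls ` {..<n} = I" using im[of n] sls by (simp add: n_def)
  have imd: "nth ls ` {..<d} = A0"
    using im[of d] dl ws(1) by (simp add: ls_def d_def)
  have iml: "nth ls ` {..<l} = A0 \<union> A1"
    using im[of l] dl ws(1) fs(1) us(1) h(2) by (auto simp: ls_def d_def m_def l_def)
  have nth_h: "ls ! (d + i) = h (us ! i)" "ls ! (l + i) = us ! i" if "i < m" for i
    using that by (auto simp: ls_def d_def m_def l_def nth_append)
  define g where "g = (\<lambda>i. if i < d then \<beta> i else \<beta> i + p ^ x (i - d) *s \<beta> (l + (i - d)))"
  have K0: "Ksp g {..<d} = Ksp b' A0"
  proof -
    have "Ksp g {..<d} = Ksp \<beta> {..<d}" by (rule Ksp_cong) (simp add: g_def)
    then show ?thesis using Ksp_reindex[of "{..<d}" b' "nth ls"] by (simp add: imd \<beta>_def)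
  qed
  have K1: "Ksp g {d..<d + m} = Ksp (\<lambda>i. b' (h i) + p ^ x0 i *s b' i) U"
  proof -
    have im: "(\<lambda>i. us ! (i - d)) ` {d..<d + m} = U"
    proof -
      have "(\<lambda>i. us ! (i - d)) ` {d..<d + m} = nth us ` ((\<lambda>i. i - d) ` {d..<d + m})"
        by (simp add: image_image)
      also have "(\<lambda>i. i - d) ` {d..<d + m} = {0..<m}"
      proof (rule subset_antisym)
        show "{0..<m} \<subseteq> (\<lambda>i. i - d) ` {d..<d + m}"
          by (rule subsetI, rule image_eqI[of _ _ "_ + d"]) auto
      qed auto
      also have "nth us ` {0..<m} = U" using nth_image[of m us] us(1) by (simp add: m_def)
      finally show ?thesis .
    qed
    have "Ksp g {d..<d + m} = Ksp (\<lambda>i. (\<lambda>i. b' (h i) + p ^ x0 i *s b' i) (us ! (i - d))) {d..<d + m}"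
    proof (rule Ksp_cong)
      fix i assume "i \<in> {d..<d + m}"
      then obtain k where k: "i = d + k" "k < m" using le_Suc_ex by force
      then show "g i = (\<lambda>i. b' (h i) + p ^ x0 i *s b' i) (us ! (i - d))"
        using nth_h[OF k(2)] by (simp add: g_def \<beta>_def x_def)
    qed
    also have "\<dots> = Ksp (\<lambda>i. b' (h i) + p ^ x0 i *s b' i) U"
      using Ksp_reindex[of "{d..<d + m}" "\<lambda>i. b' (h i) + p ^ x0 i *s b' i" "\<lambda>i. us ! (i - d)"]
      unfolding im by simp
    finally show ?thesis .
  qed
  have split: "{..<d + m} = {..<d} \<union> {d..<d + m}" by auto
  have Eg: "E = Ksp g {..<d + m}"
    unfolding split by (subst Ksp_Un) (auto simp: K0 K1 E')
  show ?thesis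
  proof (intro exI conjI)
    show "indep \<beta> {..<n}" unfolding \<beta>_def by (rule indep_reindex[OF inj]) (simp add: imn b'(1))
    show "Rsp \<beta> {..<n} = Rsp b I"
      using Rsp_reindex[of "{..<n}" b' "nth ls"] b'(2) by (simp add: \<beta>_def imn)
    show "E \<inter> F = Ksp \<beta> {..<d}"
      using Ksp_reindex[of "{..<d}" b' "nth ls"] W by (simp add: \<beta>_def imd)
    show "F = Ksp \<beta> {..<l}"
      using Ksp_reindex[of "{..<l}" b' "nth ls"] F' by (simp add: \<beta>_def iml)
    show "E = Ksp (\<lambda>i. if i < d then \<beta> i else \<beta> i + p ^ x (i - d) *s \<beta> (l + (i - d))) {..<d + m}"
      using Eg by (simp add: g_def)
    show "\<forall>i j. i \<le> j \<longrightarrow> j < m \<longrightarrow> x i \<le> x j"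
      using us(3) unfolding x_def m_def by (auto simp: sorted_iff_nth_mono)
  qed (use dl in auto)
qed

end

section \<open>Bases of lattices in module records\<close>

text \<open>A module record has no type of vectors, so sums are taken with its own addition; families are
  indexed by an initial segment of the natural numbers.\<close>

definition fcomb :: "('k, 'v) module \<Rightarrow> (nat \<Rightarrow> 'v) \<Rightarrow> nat \<Rightarrow> (nat \<Rightarrow> 'k) \<Rightarrow> 'v" where
  "fcomb V b n x = (\<Oplus>\<^bsub>V\<^esub>i\<in>{..<n}. x i \<odot>\<^bsub>V\<^esub> b i)"

text \<open>The basis \<open>b\<close> of \<open>V\<close> over \<open>K\<close> is at the same time an \<open>R\<close>-basis of \<open>L\<close>.\<close>

definition frame :: "('k::field \<Rightarrow> real) \<Rightarrow> ('k, 'v) module \<Rightarrow> 'v set \<Rightarrow> (nat \<Rightarrow> 'v) \<Rightarrow> nat \<Rightarrow> bool" where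
  "frame absv V L b n \<longleftrightarrow> (\<forall>i<n. b i \<in> carrier V) \<and> carrier V = range (fcomb V b n) \<and>
     (\<forall>x. fcomb V b n x = \<zero>\<^bsub>V\<^esub> \<longrightarrow> (\<forall>i<n. x i = 0)) \<and>
     L = fcomb V b n ` {x. \<forall>i<n. absv (x i) \<le> 1}"

lemma frame_carrier: "frame absv V L b n \<Longrightarrow> i < n \<Longrightarrow> b i \<in> carrier V"
  unfolding frame_def by blast

lemma frame_surj: "frame absv V L b n \<Longrightarrow> carrier V = range (fcomb V b n)"
  unfolding frame_def by blast

lemma frame_indep: "frame absv V L b n \<Longrightarrow> fcomb V b n x = \<zero>\<^bsub>V\<^esub> \<Longrightarrow> i < n \<Longrightarrow> x i = 0"
  unfolding frame_def by blast

lemma frame_lattice: "frame absv V L b n \<Longrightarrow> L = fcomb V b n ` {x. \<forall>i<n. absv (x i) \<le> 1}"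
  unfolding frame_def by blast

locale K_space = vectorspace class_ring V for V :: "('k::field, 'v) module"
begin

lemma smult_carrier [simp]: "v \<in> carrier V \<Longrightarrow> c \<odot>\<^bsub>V\<^esub> v \<in> carrier V"
  by (rule smult_closed) simp_all

lemma smult_add_left: "v \<in> carrier V \<Longrightarrow> (c + d) \<odot>\<^bsub>V\<^esub> v = c \<odot>\<^bsub>V\<^esub> v \<oplus>\<^bsub>V\<^esub> d \<odot>\<^bsub>V\<^esub> v"
  using smult_l_distr[of c d v] by simp

lemma smult_add_right:
  "u \<in> carrier V \<Longrightarrow> v \<in> carrier V \<Longrightarrow> c \<odot>\<^bsub>V\<^esub> (u \<oplus>\<^bsub>V\<^esub> v) = c \<odot>\<^bsub>V\<^esub> u \<oplus>\<^bsub>V\<^esub> c \<odot>\<^bsub>V\<^esub> v"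
  using smult_r_distr[of c u v] by simp

lemma smult_smult: "v \<in> carrier V \<Longrightarrow> c \<odot>\<^bsub>V\<^esub> (d \<odot>\<^bsub>V\<^esub> v) = (c * d) \<odot>\<^bsub>V\<^esub> v"
  using smult_assoc1[of c d v] by simp

lemma smult_0 [simp]: "v \<in> carrier V \<Longrightarrow> 0 \<odot>\<^bsub>V\<^esub> v = \<zero>\<^bsub>V\<^esub>"
  using smult_l_null[of v] by simp

lemma smult_1 [simp]: "v \<in> carrier V \<Longrightarrow> 1 \<odot>\<^bsub>V\<^esub> v = v"
  using smult_one[of v] by simp

lemma smult_zero [simp]: "c \<odot>\<^bsub>V\<^esub> \<zero>\<^bsub>V\<^esub> = \<zero>\<^bsub>V\<^esub>"
  by (rule smult_r_null) simp

lemma smult_minus: "v \<in> carrier V \<Longrightarrow> (- c) \<odot>\<^bsub>V\<^esub> v = \<ominus>\<^bsub>V\<^esub> (c \<odot>\<^bsub>V\<^esub> v)"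
  using smult_l_minus[of c v] by (simp add: class_ring_simps)

lemma add_swap:
  assumes "a \<in> carrier V" "b \<in> carrier V" "c \<in> carrier V" "d \<in> carrier V"
  shows "(a \<oplus>\<^bsub>V\<^esub> b) \<oplus>\<^bsub>V\<^esub> (c \<oplus>\<^bsub>V\<^esub> d) = (a \<oplus>\<^bsub>V\<^esub> c) \<oplus>\<^bsub>V\<^esub> (b \<oplus>\<^bsub>V\<^esub> d)"
  using assms by (simp add: M.add.m_ac)

lemma fcomb_0 [simp]: "fcomb V b 0 x = \<zero>\<^bsub>V\<^esub>"
  by (simp add: fcomb_def)

lemma fcomb_Suc:
  "(\<And>i. i < Suc n \<Longrightarrow> b i \<in> carrier V) \<Longrightarrow>
    fcomb V b (Suc n) x = fcomb V b n x \<oplus>\<^bsub>V\<^esub> x n \<odot>\<^bsub>V\<^esub> b n"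
  unfolding fcomb_def lessThan_Suc by (subst finsum_insert) (auto intro!: a_comm)

lemma fcomb_closed [simp]: "(\<And>i. i < n \<Longrightarrow> b i \<in> carrier V) \<Longrightarrow> fcomb V b n x \<in> carrier V"
  by (induction n) (simp_all add: fcomb_Suc)

lemma fcomb_cong:
  assumes "\<And>i. i < n \<Longrightarrow> b i \<in> carrier V" "\<And>i. i < n \<Longrightarrow> x i = y i" "\<And>i. i < n \<Longrightarrow> b i = c i"
  shows "fcomb V b n x = fcomb V c n y"
  unfolding fcomb_def by (intro finsum_cong') (use assms in \<open>auto simp: Pi_def\<close>)

lemma fcomb_add:
  "(\<And>i. i < n \<Longrightarrow> b i \<in> carrier V) \<Longrightarrow>
    fcomb V b n x \<oplus>\<^bsub>V\<^esub> fcomb V b n y = fcomb V b n (\<lambda>i. x i + y i)"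
proof (induction n)
  case (Suc n)
  then have "fcomb V b n x \<oplus>\<^bsub>V\<^esub> fcomb V b n y = fcomb V b n (\<lambda>i. x i + y i)" by simp
  then show ?case using Suc.prems by (simp add: fcomb_Suc smult_add_left add_swap)
qed simp

lemma fcomb_smult:
  "(\<And>i. i < n \<Longrightarrow> b i \<in> carrier V) \<Longrightarrow> c \<odot>\<^bsub>V\<^esub> fcomb V b n x = fcomb V b n (\<lambda>i. c * x i)"
  by (induction n) (simp_all add: fcomb_Suc smult_add_right smult_smult)

lemma fcomb_zero:
  "(\<And>i. i < n \<Longrightarrow> b i \<in> carrier V) \<Longrightarrow> (\<And>i. i < n \<Longrightarrow> x i = 0) \<Longrightarrow> fcomb V b n x = \<zero>\<^bsub>V\<^esub>"
  by (induction n) (simp_all add: fcomb_Suc)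

lemma fcomb_minus:
  "(\<And>i. i < n \<Longrightarrow> b i \<in> carrier V) \<Longrightarrow> \<ominus>\<^bsub>V\<^esub> fcomb V b n x = fcomb V b n (\<lambda>i. - x i)"
  using fcomb_smult[of n b "-1" x] smult_minus[of "fcomb V b n x" 1] by simp

lemma fcomb_append:
  "(\<And>i. i < n + m \<Longrightarrow> b i \<in> carrier V) \<Longrightarrow>
    fcomb V b (n + m) x = fcomb V b n x \<oplus>\<^bsub>V\<^esub> fcomb V (\<lambda>i. b (n + i)) m (\<lambda>i. x (n + i))"
  by (induction m) (simp_all add: fcomb_Suc a_assoc)

lemma fcomb_prefix:
  assumes "\<And>i. i < n \<Longrightarrow> b i \<in> carrier V" "d \<le> n"
  shows "fcomb V b d x = fcomb V b n (\<lambda>i. if i < d then x i else 0)"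
proof -
  obtain m where n: "n = d + m" using assms(2) le_Suc_ex by blast
  have "fcomb V b n (\<lambda>i. if i < d then x i else 0) = fcomb V b d (\<lambda>i. if i < d then x i else 0) \<oplus>\<^bsub>V\<^esub>
      fcomb V (\<lambda>i. b (d + i)) m (\<lambda>i. 0)"
    unfolding n using assms(1) n by (subst fcomb_append) simp_all
  moreover have "fcomb V b d (\<lambda>i. if i < d then x i else 0) = fcomb V b d x"
    by (rule fcomb_cong) (use assms in auto)
  moreover have "fcomb V (\<lambda>i. b (d + i)) m (\<lambda>i. 0) = \<zero>\<^bsub>V\<^esub>"
    by (rule fcomb_zero) (use assms n in auto)
  ultimately show ?thesis using assms n by simp
qed

lemma fcomb_single:
  "(\<And>i. i < n \<Longrightarrow> b i \<in> carrier V) \<Longrightarrow> j < n \<Longrightarrow> fcomb V b n (\<lambda>i. if i = j then c else 0) = c \<odot>\<^bsub>V\<^esub> b j"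
proof (induction n)
  case (Suc n)
  show ?case
  proof (cases "j = n")
    case True
    have "fcomb V b n (\<lambda>i. if i = j then c else 0) = \<zero>\<^bsub>V\<^esub>"
      by (rule fcomb_zero) (use Suc.prems True in auto)
    then show ?thesis using Suc.prems True by (simp add: fcomb_Suc)
  next
    case False
    then show ?thesis using Suc by (simp add: fcomb_Suc)
  qed
qed simp

lemma fcomb_fcomb:
  assumes "\<And>i. i < n \<Longrightarrow> b i \<in> carrier V"
  shows "fcomb V (\<lambda>j. fcomb V b n (X j)) m y = fcomb V b n (\<lambda>i. \<Sum>j<m. y j * X j i)"
proof (induction m)
  case 0
  then show ?case using fcomb_zero[of n b "\<lambda>_. 0"] assms by simp
next
  case (Suc m)
  then show ?case using assms by (simp add: fcomb_Suc fcomb_smult fcomb_add)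
qed

lemma fcomb_add_families:
  "(\<And>i. i < n \<Longrightarrow> b i \<in> carrier V) \<Longrightarrow> (\<And>i. i < n \<Longrightarrow> c i \<in> carrier V) \<Longrightarrow>
    fcomb V (\<lambda>i. b i \<oplus>\<^bsub>V\<^esub> c i) n x = fcomb V b n x \<oplus>\<^bsub>V\<^esub> fcomb V c n x"
proof (induction n)
  case (Suc n)
  then have "fcomb V (\<lambda>i. b i \<oplus>\<^bsub>V\<^esub> c i) n x = fcomb V b n x \<oplus>\<^bsub>V\<^esub> fcomb V c n x" by simp
  then show ?case using Suc.prems by (simp add: fcomb_Suc smult_add_right add_swap)
qed simp

lemma fcomb_scaled_family:
  "(\<And>i. i < n \<Longrightarrow> b i \<in> carrier V) \<Longrightarrow>
    fcomb V (\<lambda>i. c i \<odot>\<^bsub>V\<^esub> b i) n x = fcomb V b n (\<lambda>i. x i * c i)"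
  by (induction n) (simp_all add: fcomb_Suc smult_smult)

lemma submodule_range_fcomb:
  assumes "\<And>i. i < n \<Longrightarrow> b i \<in> carrier V"
  shows "LinearCombinations.submodule class_ring (range (fcomb V b n)) V"
proof
  show "\<zero>\<^bsub>V\<^esub> \<in> range (fcomb V b n)" using fcomb_zero[of n b "\<lambda>_. 0"] assms by (metis rangeI)
qed (use assms in \<open>auto simp: fcomb_add fcomb_smult\<close>)

lemma subspace_range_fcomb:
  "(\<And>i. i < n \<Longrightarrow> b i \<in> carrier V) \<Longrightarrow> VectorSpace.subspace class_ring (range (fcomb V b n)) V"
  unfolding VectorSpace.subspace_def using submodule_range_fcomb vectorspace_axioms by blast

lemma frame_inj:
  assumes "frame absv V L b n" "fcomb V b n x = fcomb V b n y" "i < n"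
  shows "x i = y i"
proof -
  note b = frame_carrier[OF assms(1)]
  have "fcomb V b n (\<lambda>i. x i + - y i) = fcomb V b n x \<oplus>\<^bsub>V\<^esub> \<ominus>\<^bsub>V\<^esub> fcomb V b n y"
    using b by (simp add: fcomb_minus fcomb_add)
  then have "fcomb V b n (\<lambda>i. x i + - y i) = \<zero>\<^bsub>V\<^esub>" using assms(2) b by (simp add: r_neg)
  then have "x i + - y i = 0" using frame_indep[OF assms(1) _ assms(3)] by blast
  then show ?thesis by simp
qed

lemma frame_lattice_iff:
  assumes "frame absv V L b n"
  shows "fcomb V b n x \<in> L \<longleftrightarrow> (\<forall>i<n. absv (x i) \<le> 1)"
proof
  assume "fcomb V b n x \<in> L"
  then obtain y where y: "\<forall>i<n. absv (y i) \<le> 1" "fcomb V b n x = fcomb V b n y"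
    unfolding frame_lattice[OF assms] by auto
  then show "\<forall>i<n. absv (x i) \<le> 1" using frame_inj[OF assms y(2)] by simp
qed (simp add: frame_lattice[OF assms])

end

lemma K_space_iff: "K_space V \<longleftrightarrow> vectorspace class_ring V"
  by (simp add: K_space_def)

lemma fcomb_hom:
  fixes M :: "('k::field, 'v) module" and N :: "('k, 'w) module"
  assumes "vectorspace class_ring M" "vectorspace class_ring N" "T \<in> LinearCombinations.module_hom class_ring M N"
    and "\<And>i. i < n \<Longrightarrow> b i \<in> carrier M"
  shows "T (fcomb M b n x) = fcomb N (\<lambda>i. T (b i)) n x"
proof -
  interpret M: K_space M using assms(1) by (simp add: K_space_iff)
  interpret N: K_space N using assms(2) by (simp add: K_space_iff)
  have T: "v \<in> carrier M \<Longrightarrow> T v \<in> carrier N"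
    "u \<in> carrier M \<Longrightarrow> v \<in> carrier M \<Longrightarrow> T (u \<oplus>\<^bsub>M\<^esub> v) = T u \<oplus>\<^bsub>N\<^esub> T v"
    "v \<in> carrier M \<Longrightarrow> T (c \<odot>\<^bsub>M\<^esub> v) = c \<odot>\<^bsub>N\<^esub> T v" for u v c
    using assms(3) by (auto simp: LinearCombinations.module_hom_def)
  have T0: "T \<zero>\<^bsub>M\<^esub> = \<zero>\<^bsub>N\<^esub>" using T(3)[of "\<zero>\<^bsub>M\<^esub>" 0] T(1)[of "\<zero>\<^bsub>M\<^esub>"] by simp
  show ?thesis using assms(4)
    by (induction n) (simp_all add: M.fcomb_Suc N.fcomb_Suc T T0)
qed

context nonarch_local_field
begin

lemma cring_val_ring: "cring (val_ring absv)"
proof (rule cringI)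
  show "abelian_group (val_ring absv)"
  proof (rule abelian_groupI)
    show "\<exists>y\<in>carrier (val_ring absv). y \<oplus>\<^bsub>val_ring absv\<^esub> x = \<zero>\<^bsub>val_ring absv\<^esub>"
      if "x \<in> carrier (val_ring absv)" for x
      using that by (intro bexI[of _ "- x"]) (auto simp: val_ring_def)
  qed (auto simp: val_ring_def absv_add_le_1 algebra_simps)
  show "Group.comm_monoid (val_ring absv)"
    by (rule comm_monoidI) (auto simp: val_ring_def absv_mult_le_1 algebra_simps)
qed (auto simp: val_ring_def algebra_simps)

lemma module_val_ring:
  fixes V :: "('k, 'v) module"
  assumes "vectorspace class_ring V"
  shows "Module.module (val_ring absv) V"
proof -
  interpret K_space V using assms by (simp add: K_space_iff)
  show ?thesis
    by (rule moduleI[OF cring_val_ring abelian_group_axioms])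
      (auto simp: val_ring_def smult_add_left smult_add_right smult_smult)
qed

end

context K_space
begin

lemma lincomb_set:
  assumes "distinct bs" "set bs \<subseteq> carrier V"
  shows "(\<Oplus>\<^bsub>V\<^esub>v\<in>set bs. a v \<odot>\<^bsub>V\<^esub> v) = fcomb V (nth bs) (length bs) (\<lambda>i. a (bs ! i))"
proof -
  have im: "set bs = nth bs ` {..<length bs}" by (auto simp: set_conv_nth)
  have "inj_on (nth bs) {..<length bs}" using assms(1) by (auto intro: inj_on_nth)
  then show ?thesis
    unfolding fcomb_def im using assms(2) nth_mem[of _ bs] by (subst finsum_reindex) (auto intro!: smult_carrier)
qed

lemma coeff_of_list:
  assumes "distinct bs"
  obtains a where "\<And>i. i < length bs \<Longrightarrow> a (bs ! i) = x i"
proof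
  have "inj_on (nth bs) {..<length bs}" using assms by (auto intro: inj_on_nth)
  then show "x (the_inv_into {..<length bs} (nth bs) (bs ! i)) = x i" if "i < length bs" for i
    using that by (simp add: the_inv_into_f_f)
qed

text \<open>This and the next lemma serve the valuation ring as well as the field: linear combinations depend on
  the ring of scalars only through the range of the coefficients.\<close>

lemma span_list:
  assumes "Module.module R V" "distinct bs" "set bs \<subseteq> carrier V"
  shows "LinearCombinations.module.span R V (set bs) =
    fcomb V (nth bs) (length bs) ` {x. \<forall>i<length bs. x i \<in> carrier R}"
proof -
  interpret R: Module.module R V by fact
  have eq: "R.span (set bs) = {R.lincomb a (set bs) |a. a \<in> set bs \<rightarrow> carrier R}"
    using assms(3) by (intro R.finite_span) auto
  show ?thesis unfolding eq R.lincomb_def lincomb_set[OF assms(2,3)]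
  proof safe
    fix a assume "a \<in> set bs \<rightarrow> carrier R"
    then show "fcomb V (nth bs) (length bs) (\<lambda>i. a (bs ! i)) \<in>
        fcomb V (nth bs) (length bs) ` {x. \<forall>i<length bs. x i \<in> carrier R}"
      by (intro imageI) (auto simp: Pi_iff)
  next
    fix x assume x: "\<forall>i<length bs. x i \<in> carrier R"
    obtain a where a: "\<And>i. i < length bs \<Longrightarrow> a (bs ! i) = x i" using coeff_of_list[OF assms(2)] by metis
    have "fcomb V (nth bs) (length bs) x = fcomb V (nth bs) (length bs) (\<lambda>i. a (bs ! i))"
      using assms(3) a by (intro fcomb_cong) auto
    moreover have "a \<in> set bs \<rightarrow> carrier R" using x a by (auto simp: set_conv_nth)
    ultimately show "\<exists>a. fcomb V (nth bs) (length bs) x =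
        fcomb V (nth bs) (length bs) (\<lambda>i. a (bs ! i)) \<and> a \<in> set bs \<rightarrow> carrier R" by blast
  qed
qed

lemma lin_indpt_list:
  assumes "Module.module R V" "\<zero>\<^bsub>R\<^esub> = 0" "distinct bs" "set bs \<subseteq> carrier V"
  shows "\<not> LinearCombinations.module.lin_dep R V (set bs) \<longleftrightarrow>
    (\<forall>x. (\<forall>i<length bs. x i \<in> carrier R) \<longrightarrow> fcomb V (nth bs) (length bs) x = \<zero>\<^bsub>V\<^esub> \<longrightarrow>
      (\<forall>i<length bs. x i = 0))"
proof -
  interpret R: Module.module R V by fact
  show ?thesis
  proof (intro iffI allI impI)
    fix x i assume ind: "\<not> R.lin_dep (set bs)" and x: "\<forall>i<length bs. x i \<in> carrier R"
      "fcomb V (nth bs) (length bs) x = \<zero>\<^bsub>V\<^esub>" and i: "i < length bs"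
    obtain a where a: "\<And>i. i < length bs \<Longrightarrow> a (bs ! i) = x i" using coeff_of_list[OF assms(3)] by metis
    have "fcomb V (nth bs) (length bs) x = fcomb V (nth bs) (length bs) (\<lambda>i. a (bs ! i))"
      using assms(4) a by (intro fcomb_cong) auto
    then have 0: "R.lincomb a (set bs) = \<zero>\<^bsub>V\<^esub>"
      using x(2) by (simp add: R.lincomb_def lincomb_set[OF assms(3,4)])
    have a': "a \<in> set bs \<rightarrow> carrier R" using x(1) a by (auto simp: set_conv_nth)
    show "x i = 0"
    proof (rule ccontr)
      assume "x i \<noteq> 0"
      then have "a (bs ! i) \<noteq> \<zero>\<^bsub>R\<^esub>" using a i assms(2) by simp
      then show False using R.lin_dep_crit[OF _ subset_refl a' _ _ 0, of "bs ! i"] i ind by auto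
    qed
  next
    assume h: "\<forall>x. (\<forall>i<length bs. x i \<in> carrier R) \<longrightarrow> fcomb V (nth bs) (length bs) x = \<zero>\<^bsub>V\<^esub> \<longrightarrow>
      (\<forall>i<length bs. x i = 0)"
    show "\<not> R.lin_dep (set bs)"
    proof (rule R.finite_lin_indpt2)
      fix a assume a: "a \<in> set bs \<rightarrow> carrier R" "R.lincomb a (set bs) = \<zero>\<^bsub>V\<^esub>"
      then have "fcomb V (nth bs) (length bs) (\<lambda>i. a (bs ! i)) = \<zero>\<^bsub>V\<^esub>"
        by (simp add: R.lincomb_def lincomb_set[OF assms(3,4)])
      moreover have "\<forall>i<length bs. a (bs ! i) \<in> carrier R" using a(1) by auto
      ultimately have "\<forall>i<length bs. a (bs ! i) = 0" using h[THEN spec, of "\<lambda>i. a (bs ! i)"] by blast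
      then show "\<forall>v\<in>set bs. a v = \<zero>\<^bsub>R\<^esub>" using assms(2) by (auto simp: set_conv_nth)
    qed (use assms(4) in auto)
  qed
qed

lemma fcomb_nth_map:
  "(\<And>i. i < n \<Longrightarrow> b i \<in> carrier V) \<Longrightarrow> fcomb V (nth (map b [0..<n])) n x = fcomb V b n x"
  by (rule fcomb_cong) auto

lemma frame_distinct:
  assumes "frame absv V L b n"
  shows "distinct (map b [0..<n])"
proof -
  note b = frame_carrier[OF assms]
  have "inj_on b {0..<n}"
  proof (rule inj_onI, rule ccontr)
    fix i j assume ij: "i \<in> {0..<n}" "j \<in> {0..<n}" "b i = b j" "i \<noteq> j"
    have "fcomb V b n (\<lambda>k. if k = i then 1 else 0) = fcomb V b n (\<lambda>k. if k = j then 1 else 0)"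
      using ij b by (simp add: fcomb_single)
    from frame_inj[OF assms this, of i] ij show False by simp
  qed
  then show ?thesis by (simp add: distinct_map)
qed

lemma dim_frame:
  assumes "frame absv V L b n"
  shows "dim = n"
proof -
  note b = frame_carrier[OF assms]
  let ?bs = "map b [0..<n]"
  have sub: "set ?bs \<subseteq> carrier V" using b by auto
  have mod: "Module.module class_ring V" by (rule module_axioms)
  have "lin_indpt (set ?bs)"
    by (subst lin_indpt_list[OF mod _ frame_distinct[OF assms] sub])
      (use frame_indep[OF assms] fcomb_nth_map[OF b] in \<open>simp_all del: set_map\<close>)
  moreover have "gen_set (set ?bs)"
    unfolding span_list[OF mod frame_distinct[OF assms] sub]
    using frame_surj[OF assms] fcomb_nth_map[OF b] by simp
  ultimately have "basis (set ?bs)" using sub by (simp add: basis_def)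
  then have "dim = card (set ?bs)" by (intro dim_basis) simp_all
  then show ?thesis using distinct_card[OF frame_distinct[OF assms]] by simp
qed

end

locale local_K_space = nonarch_local_field absv + K_space V
  for absv :: "'k::field_char_0 \<Rightarrow> real" and V :: "('k, 'v) module"
begin

lemma R_basis_if_frame:
  assumes "frame absv V L b n"
  shows "R_basis absv V L (map b [0..<n])"
proof -
  note b = frame_carrier[OF assms(1)] and dist = frame_distinct[OF assms(1)]
  have sub: "set (map b [0..<n]) \<subseteq> carrier V" using b by auto
  have mod: "Module.module (val_ring absv) V" by (rule module_val_ring[OF vectorspace_axioms])
  have z: "\<zero>\<^bsub>val_ring absv\<^esub> = 0" by (simp add: val_ring_def)
  have "\<not> LinearCombinations.module.lin_dep (val_ring absv) V (set (map b [0..<n]))"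
    unfolding lin_indpt_list[OF mod z dist sub]
    using frame_indep[OF assms(1)] fcomb_nth_map[OF b] by simp
  moreover have "LinearCombinations.module.span (val_ring absv) V (set (map b [0..<n])) = L"
    unfolding span_list[OF mod dist sub] using frame_lattice[OF assms(1)] fcomb_nth_map[OF b]
    by (simp add: val_ring_def)
  ultimately show ?thesis using dist sub by (simp add: R_basis_def)
qed

text \<open>An \<open>R\<close>-basis of a lattice of full rank is a \<open>K\<close>-basis: multiply a vector, or a linear relation, by
  a scalar that makes it integral.\<close>

lemma frame_if_R_basis:
  assumes "frame absv V L b n" and bs: "R_basis absv V L bs"
  shows "frame absv V L (nth bs) (length bs)"
proof -
  note b = frame_carrier[OF assms(1)]
  have dist: "distinct bs" and sub: "set bs \<subseteq> carrier V" using bs by (auto simp: R_basis_def)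
  have c: "bs ! i \<in> carrier V" if "i < length bs" for i using sub that by auto
  have mod: "Module.module (val_ring absv) V" by (rule module_val_ring[OF vectorspace_axioms])
  have z: "\<zero>\<^bsub>val_ring absv\<^esub> = 0" by (simp add: val_ring_def)
  have L: "L = fcomb V (nth bs) (length bs) ` {x. \<forall>i<length bs. absv (x i) \<le> 1}"
    using bs span_list[OF mod dist sub] by (simp add: R_basis_def val_ring_def)
  have ind: "\<forall>i<length bs. x i = 0"
    if "\<forall>i<length bs. absv (x i) \<le> 1" "fcomb V (nth bs) (length bs) x = \<zero>\<^bsub>V\<^esub>" for x
    using bs that lin_indpt_list[OF mod z dist sub] by (simp add: R_basis_def val_ring_def)
  have scale: "\<exists>q. q \<noteq> 0 \<and> (\<forall>i<N. absv (q * x i) \<le> 1)" for N :: nat and x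
  proof (induction N)
    case 0 then show ?case by (intro exI[of _ 1]) simp
  next
    case (Suc N)
    then obtain q where q: "q \<noteq> 0" "\<forall>i<N. absv (q * x i) \<le> 1" by blast
    show ?case
    proof (cases "absv (q * x N) \<le> 1")
      case True
      then show ?thesis using q by (intro exI[of _ q]) (auto simp: less_Suc_eq)
    next
      case False
      then have 1: "q * x N \<noteq> 0" and 2: "absv (inverse (q * x N)) \<le> 1"
        using absv_inverse[of "q * x N"] by (auto simp: inverse_le_1_iff)
      have "absv (inverse (q * x N) * q * x i) \<le> 1" if "i < Suc N" for i
      proof (cases "i = N")
        case True
        then have "inverse (q * x N) * q * x i = 1" using 1 by (simp add: mult.assoc del: inverse_mult_distrib)
        then show ?thesis by simp
      next
        case False
        then have "absv (q * x i) \<le> 1" using q(2) that by simp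
        from absv_mult_le_1[OF 2 this] show ?thesis by (simp only: mult.assoc)
      qed
      moreover have "inverse (q * x N) * q \<noteq> 0" using 1 q(1) by simp
      ultimately show ?thesis by blast
    qed
  qed
  show ?thesis unfolding frame_def
  proof (intro conjI allI impI)
    show "carrier V = range (fcomb V (nth bs) (length bs))"
    proof (rule subset_antisym)
      show "carrier V \<subseteq> range (fcomb V (nth bs) (length bs))"
      proof
        fix v assume v: "v \<in> carrier V"
        then obtain x where x: "v = fcomb V b n x" using frame_surj[OF assms(1)] by blast
        obtain q where q: "q \<noteq> 0" "\<forall>i<n. absv (q * x i) \<le> 1" using scale by blast
        have "q \<odot>\<^bsub>V\<^esub> v \<in> L"
          using q(2) b by (simp add: x fcomb_smult frame_lattice_iff[OF assms(1)])
        then obtain y where "q \<odot>\<^bsub>V\<^esub> v = fcomb V (nth bs) (length bs) y" unfolding L by blast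
        then have "inverse q \<odot>\<^bsub>V\<^esub> (q \<odot>\<^bsub>V\<^esub> v) = fcomb V (nth bs) (length bs) (\<lambda>i. inverse q * y i)"
          using c by (simp add: fcomb_smult)
        then have "v = fcomb V (nth bs) (length bs) (\<lambda>i. inverse q * y i)"
          using v q(1) by (simp add: smult_smult)
        then show "v \<in> range (fcomb V (nth bs) (length bs))" by blast
      qed
    qed (use c in auto)
  next
    fix x i assume x: "fcomb V (nth bs) (length bs) x = \<zero>\<^bsub>V\<^esub>" and i: "i < length bs"
    obtain q where q: "q \<noteq> 0" "\<forall>i<length bs. absv (q * x i) \<le> 1" using scale by blast
    have "fcomb V (nth bs) (length bs) (\<lambda>i. q * x i) = \<zero>\<^bsub>V\<^esub>"
      using c x fcomb_smult[of "length bs" "nth bs" q x] by simp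
    then have "q * x i = 0" using ind[OF q(2)] i by blast
    then show "x i = 0" using q(1) by simp
  qed (use c L in auto)
qed

end

section \<open>Uniqueness of the singular values\<close>

lemma sum_fun_apply: "(\<Sum>i\<in>I. f i) x = (\<Sum>i\<in>I. f i x)" for f :: "'i \<Rightarrow> 'x \<Rightarrow> 'y::comm_monoid_add"
  by (induction I rule: infinite_finite_induct) simp_all

lemma sum_mult_delta:
  fixes y :: "nat \<Rightarrow> 'k::comm_semiring_1"
  shows "(\<Sum>k<n. y k * (if j = k then 1 else 0)) = (if j < n then y j else 0)"
proof -
  have "(\<Sum>k<n. y k * (if j = k then 1 else 0)) = (\<Sum>k<n. if j = k then y k else 0)"
    by (intro sum.cong) auto
  then show ?thesis by simp
qed

lemma local_field_space_fun:
  fixes absv :: "'k::field_char_0 \<Rightarrow> real"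
  assumes "nonarch_local_field absv"
  shows "local_field_space absv (\<lambda>c (f :: nat \<Rightarrow> 'k) i. c * f i)"
proof -
  have "vector_space (\<lambda>c (f :: nat \<Rightarrow> 'k) i. c * f i)"
    by standard (auto simp: fun_eq_iff algebra_simps)
  then show ?thesis using assms by (simp add: local_field_space_def)
qed

text \<open>There are \<open>i\<close> equations for the \<open>i + 1\<close> unknowns \<open>x 0, \<dots>, x i\<close>.\<close>

lemma underdetermined_system:
  fixes absv :: "'k::field_char_0 \<Rightarrow> real" and A :: "nat \<Rightarrow> nat \<Rightarrow> 'k"
  assumes "nonarch_local_field absv" "i < m"
  shows "\<exists>x. (\<exists>s\<le>i. x s \<noteq> 0) \<and> (\<forall>s>i. x s = 0) \<and> (\<forall>j<i. (\<Sum>s<m. x s * A s j) = 0)"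
proof -
  interpret X: local_field_space absv "\<lambda>c (f :: nat \<Rightarrow> 'k) i. c * f i"
    by (rule local_field_space_fun) fact
  define v :: "nat \<Rightarrow> nat \<Rightarrow> 'k" where "v = (\<lambda>s j. if j < i then A s j else 0)"
  define u :: "nat \<Rightarrow> nat \<Rightarrow> 'k" where "u = (\<lambda>k j. if j = k then 1 else 0)"
  have "v s \<in> X.Ksp u {..<i}" for s
  proof -
    have "v s = X.lcomb u {..<i} (A s)"
      by (simp add: fun_eq_iff X.lcomb_def sum_fun_apply u_def v_def sum_mult_delta)
    then show ?thesis by (simp add: X.Ksp_def)
  qed
  then have "\<not> X.indep v {..i}"
    using X.indep_card_le[of "{..<i}" "{..i}" v u] by auto
  then obtain y s where y: "X.lcomb v {..i} y = 0" "s \<le> i" "y s \<noteq> 0" unfolding X.indep_def by blast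
  define x where "x = (\<lambda>s. if s \<le> i then y s else 0)"
  have "(\<Sum>s<m. x s * A s j) = 0" if j: "j < i" for j
  proof -
    have "(\<Sum>s<m. x s * A s j) = (\<Sum>s\<in>{..i}. y s * A s j)"
      using assms(2) by (intro sum.mono_neutral_cong_right) (auto simp: x_def)
    also have "\<dots> = X.lcomb v {..i} y j" using j by (simp add: X.lcomb_def sum_fun_apply v_def)
    finally show ?thesis using y(1) by simp
  qed
  moreover have "\<exists>s\<le>i. x s \<noteq> 0" using y(2,3) by (intro exI[of _ s]) (simp add: x_def)
  moreover have "x s = 0" if "i < s" for s using that by (simp add: x_def)
  ultimately show ?thesis by blast
qed

context local_K_space
begin

text \<open>The largest absolute value of a coordinate is a norm that depends on the lattice only: it is at most
  \<open>\<bar>t\<bar>\<close> iff the vector lies in \<open>t L\<close>.\<close>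

lemma frame_coord_bound:
  assumes "frame absv V L b n" "frame absv V L b' n'" "fcomb V b n z = fcomb V b' n' z'"
    and "\<And>j. j < n' \<Longrightarrow> absv (z' j) \<le> absv t" "i < n"
  shows "absv (z i) \<le> absv t"
proof (cases "t = 0")
  case True
  note b' = frame_carrier[OF assms(2)]
  have "z' j = 0" if "j < n'" for j using assms(4)[OF that] True absv_pos_iff[of "z' j"] by auto
  then have "fcomb V b n z = \<zero>\<^bsub>V\<^esub>" unfolding assms(3) using b' by (intro fcomb_zero) auto
  then have "z i = 0" using frame_indep[OF assms(1) _ assms(5)] by blast
  then show ?thesis by (simp add: absv_nonneg)
next
  case False
  note b = frame_carrier[OF assms(1)] and b' = frame_carrier[OF assms(2)]
  have "fcomb V b' n' (\<lambda>j. inverse t * z' j) \<in> L"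
    using assms(4) False absv_pos_iff[of t]
    by (simp add: frame_lattice_iff[OF assms(2)] absv_mult absv_inverse divide_simps)
      (simp add: absv_divide divide_simps)
  moreover have "fcomb V b' n' (\<lambda>j. inverse t * z' j) = fcomb V b n (\<lambda>j. inverse t * z j)"
    using b b' assms(3) by (simp flip: fcomb_smult)
  ultimately have "fcomb V b n (\<lambda>j. inverse t * z j) \<in> L" by metis
  then have "absv (inverse t * z i) \<le> 1" unfolding frame_lattice_iff[OF assms(1)] using assms(5) by blast
  then show ?thesis using False absv_pos_iff[of t] by (simp add: absv_mult absv_inverse absv_divide divide_simps)
qed

lemma frame_dim_unique:
  "frame absv V L b n \<Longrightarrow> frame absv V L b' n' \<Longrightarrow> n = n'"
  using dim_frame by metis

text \<open>The columns of \<open>A\<close> are the coordinates of the new basis; those of the inverse matrix give the old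
  basis back.\<close>

lemma frame_change:
  assumes "frame absv V L b n" "A \<in> GL_val_ring absv n"
  shows "frame absv V L (\<lambda>j. fcomb V b n (\<lambda>i. A $$ (i, j))) n"
proof -
  note b = frame_carrier[OF assms(1)]
  obtain A' where A: "A \<in> carrier_mat n n" "elements_mat A \<subseteq> carrier (val_ring absv)"
    and A': "A' \<in> carrier_mat n n" "elements_mat A' \<subseteq> carrier (val_ring absv)"
    and inv: "inverts_mat A A'" "inverts_mat A' A"
    using assms(2) unfolding GL_val_ring_def by blast
  have el: "absv (A $$ (i, j)) \<le> 1" "absv (A' $$ (i, j)) \<le> 1" if "i < n" "j < n" for i j
    using elements_matI[OF A(1) that refl] elements_matI[OF A'(1) that refl] A(2) A'(2)
    by (auto simp: val_ring_def)
  define mul where "mul = (\<lambda>(B :: 'k mat) y i. \<Sum>j<n. y j * B $$ (i, j))"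
  have AA': "(\<Sum>k<n. A $$ (i, k) * A' $$ (k, j)) = (if i = j then 1 else 0)"
    "(\<Sum>k<n. A' $$ (i, k) * A $$ (k, j)) = (if i = j then 1 else 0)" if "i < n" "j < n" for i j
  proof -
    have "(A * A') $$ (i, j) = 1\<^sub>m n $$ (i, j)" "(A' * A) $$ (i, j) = 1\<^sub>m n $$ (i, j)"
      using inv A(1) A'(1) by (auto simp: inverts_mat_def)
    then show "(\<Sum>k<n. A $$ (i, k) * A' $$ (k, j)) = (if i = j then 1 else 0)"
      "(\<Sum>k<n. A' $$ (i, k) * A $$ (k, j)) = (if i = j then 1 else 0)"
      using that A(1) A'(1) by (simp_all add: scalar_prod_def lessThan_atLeast0)
  qed
  have mul_mul: "mul B (mul C y) i = (\<Sum>j<n. y j * (\<Sum>k<n. B $$ (i, k) * C $$ (k, j)))" for B C y i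
  proof -
    have "mul B (mul C y) i = (\<Sum>k<n. \<Sum>j<n. y j * (B $$ (i, k) * C $$ (k, j)))"
      by (simp add: mul_def sum_distrib_left sum_distrib_right mult_ac)
    also have "\<dots> = (\<Sum>j<n. y j * (\<Sum>k<n. B $$ (i, k) * C $$ (k, j)))"
      by (subst sum.swap) (simp add: sum_distrib_left)
    finally show ?thesis .
  qed
  have cancel: "mul A (mul A' y) i = y i" "mul A' (mul A y) i = y i" if "i < n" for y i
  proof -
    have "(\<Sum>j<n. y j * (\<Sum>k<n. A $$ (i, k) * A' $$ (k, j))) = (\<Sum>j<n. y j * (if i = j then 1 else 0))"
      "(\<Sum>j<n. y j * (\<Sum>k<n. A' $$ (i, k) * A $$ (k, j))) = (\<Sum>j<n. y j * (if i = j then 1 else 0))"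
      using AA' that by simp_all
    moreover have "(\<Sum>j<n. y j * (if i = j then 1 else 0)) = y i"
      using that by (simp add: sum_mult_delta)
    ultimately show "mul A (mul A' y) i = y i" "mul A' (mul A y) i = y i"
      using that by (simp_all add: mul_mul)
  qed
  have int: "absv (mul B y i) \<le> 1" if "\<And>j. j < n \<Longrightarrow> absv (B $$ (i, j)) \<le> 1" "\<forall>j<n. absv (y j) \<le> 1" for B y i
    unfolding mul_def using that by (intro absv_sum_le) (auto intro: absv_mult_le_1)
  have mul_0: "mul B y i = 0" if "\<And>k. k < n \<Longrightarrow> y k = 0" for B y i
    using that by (simp add: mul_def)
  define a where "a = (\<lambda>j. fcomb V b n (\<lambda>i. A $$ (i, j)))"
  have a: "a j \<in> carrier V" for j unfolding a_def using b by simp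
  have comb: "fcomb V a n y = fcomb V b n (mul A y)" for y
    unfolding a_def mul_def using b by (rule fcomb_fcomb)
  have comb': "fcomb V b n y = fcomb V a n (mul A' y)" for y
    unfolding comb using b cancel(1) by (intro fcomb_cong) auto
  have "frame absv V L a n" unfolding frame_def
  proof (intro conjI allI impI)
    show "carrier V = range (fcomb V a n)"
      unfolding frame_surj[OF assms(1)]
    proof (rule subset_antisym)
      show "range (fcomb V b n) \<subseteq> range (fcomb V a n)" by (auto simp: comb')
      show "range (fcomb V a n) \<subseteq> range (fcomb V b n)" by (auto simp: comb)
    qed
    show "x i = 0" if x: "fcomb V a n x = \<zero>\<^bsub>V\<^esub>" "i < n" for x i
    proof -
      have "mul A x k = 0" if "k < n" for k using frame_indep[OF assms(1) _ that] x(1) comb by simp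
      then have "mul A' (mul A x) i = 0" using mul_0 by blast
      then show ?thesis using cancel(2)[OF x(2)] by simp
    qed
    show "L = fcomb V a n ` {x. \<forall>i<n. absv (x i) \<le> 1}"
    proof (rule subset_antisym)
      show "L \<subseteq> fcomb V a n ` {x. \<forall>i<n. absv (x i) \<le> 1}"
      proof
        fix v assume "v \<in> L"
        then obtain y where y: "\<forall>i<n. absv (y i) \<le> 1" "v = fcomb V b n y"
          unfolding frame_lattice[OF assms(1)] by auto
        have "\<forall>i<n. absv (mul A' y i) \<le> 1" using int[of A' _ y] el(2) y(1) by blast
        then show "v \<in> fcomb V a n ` {x. \<forall>i<n. absv (x i) \<le> 1}"
          unfolding y(2) comb' by (intro imageI) simp
      qed
      show "fcomb V a n ` {x. \<forall>i<n. absv (x i) \<le> 1} \<subseteq> L"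
      proof safe
        fix y assume "\<forall>i<n. absv (y i) \<le> 1"
        then have "\<forall>i<n. absv (mul A y i) \<le> 1" using int[of A _ y] el(1) by blast
        then show "fcomb V a n y \<in> L" unfolding comb frame_lattice_iff[OF assms(1)] .
      qed
    qed
  qed (rule a)
  then show ?thesis by (simp add: a_def)
qed

end

text \<open>The Smith normal form of \<open>T\<close> without matrices: \<open>T\<close> maps the basis \<open>a\<close> of \<open>M\<close> to multiples of the basis
  \<open>b\<close> of \<open>N\<close>. The condition on absolute values is the divisibility of the diagonal entries.\<close>

definition diagonalizes ::
    "('k::field \<Rightarrow> real) \<Rightarrow> ('k, 'v) module \<Rightarrow> 'v set \<Rightarrow> (nat \<Rightarrow> 'v) \<Rightarrow> nat \<Rightarrow>
      ('k, 'w) module \<Rightarrow> 'w set \<Rightarrow> (nat \<Rightarrow> 'w) \<Rightarrow> nat \<Rightarrow> ('v \<Rightarrow> 'w) \<Rightarrow> (nat \<Rightarrow> 'k) \<Rightarrow> bool" where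
  "diagonalizes absv M LM a m N LN b n T d \<longleftrightarrow>
     frame absv M LM a m \<and> frame absv N LN b n \<and>
     (\<forall>j<m. T (a j) = (if j < n then d j \<odot>\<^bsub>N\<^esub> b j else \<zero>\<^bsub>N\<^esub>)) \<and>
     (\<forall>i j. i \<le> j \<longrightarrow> j < min n m \<longrightarrow> absv (d j) \<le> absv (d i))"

locale local_K_map = M: local_K_space absv M + N: local_K_space absv N
  for absv :: "'k::field_char_0 \<Rightarrow> real" and M :: "('k, 'v) module" and N :: "('k, 'w) module" +
  fixes T :: "'v \<Rightarrow> 'w"
  assumes hom: "T \<in> LinearCombinations.module_hom class_ring M N"
begin

lemma T_fcomb: "(\<And>i. i < n \<Longrightarrow> b i \<in> carrier M) \<Longrightarrow> T (fcomb M b n x) = fcomb N (\<lambda>i. T (b i)) n x"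
  by (rule fcomb_hom[OF M.vectorspace_axioms N.vectorspace_axioms hom])

lemma T_closed: "v \<in> carrier M \<Longrightarrow> T v \<in> carrier N"
  using hom by (auto simp: LinearCombinations.module_hom_def)

lemma T_diagonal:
  assumes "diagonalizes absv M LM a m N LN b n T d"
  shows "T (fcomb M a m x) = fcomb N b n (\<lambda>i. if i < m then x i * d i else 0)"
proof -
  have a: "frame absv M LM a m" and b: "frame absv N LN b n"
    and Ta: "\<And>j. j < m \<Longrightarrow> T (a j) = (if j < n then d j \<odot>\<^bsub>N\<^esub> b j else \<zero>\<^bsub>N\<^esub>)"
    using assms unfolding diagonalizes_def by blast+
  note ac = frame_carrier[OF a] and bc = frame_carrier[OF b]
  have Ta': "T (a j) = fcomb N b n (\<lambda>i. if i = j then d j else 0)" if "j < m" for j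
    using Ta[OF that] bc N.fcomb_zero[of n b "\<lambda>i. if i = j then d j else 0"]
    by (auto simp: N.fcomb_single)
  have "T (fcomb M a m x) = fcomb N (\<lambda>j. T (a j)) m x" using ac by (rule T_fcomb)
  also have "\<dots> = fcomb N (\<lambda>j. fcomb N b n (\<lambda>i. if i = j then d j else 0)) m x"
    by (intro N.fcomb_cong) (simp_all add: Ta' T_closed[OF ac] bc)
  also have "\<dots> = fcomb N b n (\<lambda>i. \<Sum>j<m. x j * (if i = j then d j else 0))"
    using bc by (rule N.fcomb_fcomb)
  also have "\<dots> = fcomb N b n (\<lambda>i. if i < m then x i * d i else 0)"
    using bc by (intro N.fcomb_cong) (auto simp: if_distrib[of "(*) _"] sum.delta cong: if_cong)
  finally show ?thesis .
qed

text \<open>Uniqueness of the elementary divisors, by counting dimensions. The span of \<open>a 0, \<dots>, a i\<close>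
  meets the span of all \<open>a' j\<close> with \<open>j \<ge> i\<close> in a nonzero vector; scale it to be integral with a
  coordinate 1 with respect to \<open>a\<close>, at \<open>s0 \<le> i\<close>. Its image has a coordinate \<open>d s0\<close> with respect to
  \<open>b\<close>, in absolute value at least that of \<open>d i\<close>, while the absolute values of all its coordinates with
  respect to \<open>b'\<close> are at most that of \<open>d' i\<close>.\<close>

lemma diagonal_entry_le:
  assumes D: "diagonalizes absv M LM a m N LN b n T d" and D': "diagonalizes absv M LM a' m N LN b' n T d'"
    and i: "i < min n m"
  shows "absv (d i) \<le> absv (d' i)"
proof -
  have a: "frame absv M LM a m" and b: "frame absv N LN b n"
    and a': "frame absv M LM a' m" and b': "frame absv N LN b' n"
    and mono: "\<And>i j. i \<le> j \<Longrightarrow> j < min n m \<Longrightarrow> absv (d j) \<le> absv (d i)"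
    and mono': "\<And>i j. i \<le> j \<Longrightarrow> j < min n m \<Longrightarrow> absv (d' j) \<le> absv (d' i)"
    using D D' unfolding diagonalizes_def by blast+
  note ac = frame_carrier[OF a] and ac' = frame_carrier[OF a']
  have "\<forall>s<m. \<exists>y. a s = fcomb M a' m y" using ac frame_surj[OF a'] by blast
  then obtain A where A: "\<And>s. s < m \<Longrightarrow> a s = fcomb M a' m (A s)" by metis
  have im: "i < m" using i by simp
  obtain x where x: "\<exists>s\<le>i. x s \<noteq> 0" "\<And>s. i < s \<Longrightarrow> x s = 0" "\<And>j. j < i \<Longrightarrow> (\<Sum>s<m. x s * A s j) = 0"
    using underdetermined_system[OF M.nonarch_local_field_axioms im, of A] by metis
  have "Max ((\<lambda>s. absv (x s)) ` {..i}) \<in> (\<lambda>s. absv (x s)) ` {..i}" by (intro Max_in) auto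
  then obtain s0 where "Max ((\<lambda>s. absv (x s)) ` {..i}) = absv (x s0)" "s0 \<in> {..i}" by (rule imageE)
  then have s0: "s0 \<le> i" "absv (x s0) = Max ((\<lambda>s. absv (x s)) ` {..i})" by simp_all
  have s0max: "absv (x s) \<le> absv (x s0)" for s
  proof (cases "s \<le> i")
    case True
    then show ?thesis unfolding s0(2) by (intro Max_ge) auto
  next
    case False
    then show ?thesis using x(2)[of s] by (simp add: M.absv_nonneg)
  qed
  have xs0: "x s0 \<noteq> 0"
  proof
    assume "x s0 = 0"
    then have "x s = 0" for s using s0max[of s] M.absv_pos_iff[of "x s"] by auto
    then show False using x(1) by blast
  qed
  define y where "y = (\<lambda>s. x s / x s0)"
  define k where "k = (\<lambda>j. \<Sum>s<m. y s * A s j)"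
  have y1: "absv (y s) \<le> 1" for s
    using s0max[of s] xs0 M.absv_pos_iff[of "x s0"] by (simp add: y_def M.absv_divide)
  have k0: "k j = 0" if "j < i" for j
  proof -
    have "k j = (\<Sum>s<m. x s * A s j) / x s0" by (simp add: k_def y_def sum_divide_distrib)
    then show ?thesis using x(3)[OF that] by simp
  qed
  have eq: "fcomb M a m y = fcomb M a' m k"
  proof -
    have "fcomb M a m y = fcomb M (\<lambda>s. fcomb M a' m (A s)) m y" using ac A by (intro M.fcomb_cong) auto
    also have "\<dots> = fcomb M a' m k" unfolding k_def using ac' by (rule M.fcomb_fcomb)
    finally show ?thesis .
  qed
  have "fcomb M a m y \<in> LM" using y1 by (simp add: M.frame_lattice_iff[OF a])
  then have k1: "\<forall>j<m. absv (k j) \<le> 1" unfolding eq M.frame_lattice_iff[OF a'] .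
  have T: "fcomb N b n (\<lambda>i. if i < m then y i * d i else 0) = fcomb N b' n (\<lambda>i. if i < m then k i * d' i else 0)"
    using T_diagonal[OF D, of y] T_diagonal[OF D', of k] eq by simp
  have "absv (if j < m then k j * d' j else 0) \<le> absv (d' i)" if "j < n" for j
  proof (cases "i \<le> j \<and> j < m")
    case True
    then have "absv (k j) * absv (d' j) \<le> 1 * absv (d' i)"
      using k1 mono'[of i j] that by (intro mult_mono) (auto simp: M.absv_nonneg)
    then show ?thesis using True by (simp add: M.absv_mult)
  next
    case False then show ?thesis using k0[of j] by (auto simp: M.absv_nonneg)
  qed
  from N.frame_coord_bound[OF b b' T this, of s0]
  have "absv (y s0 * d s0) \<le> absv (d' i)" using s0(1) i by simp
  then have "absv (d s0) \<le> absv (d' i)" using xs0 by (simp add: y_def)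
  then show ?thesis using mono[OF s0(1) i] by simp
qed

end

lemma one_in_GL_val_ring:
  assumes "nonarch_local_field absv"
  shows "1\<^sub>m n \<in> GL_val_ring absv n"
proof -
  interpret nonarch_local_field absv by fact
  have "elements_mat (1\<^sub>m n) \<subseteq> carrier (val_ring absv)"
    by (auto simp: elements_mat_def val_ring_def)
  then show ?thesis
    unfolding GL_val_ring_def by (auto simp: inverts_mat_def intro!: bexI[of _ "1\<^sub>m n"])
qed

context local_K_map
begin

text \<open>With respect to the bases \<open>a\<close> and \<open>b\<close>, the matrix of \<open>T\<close> is its own Smith normal form.\<close>

lemma singular_values_witness:
  assumes D: "diagonalizes absv M LM a m N LN b n T d"
  shows "\<exists>as bs A D. R_basis absv M LM as \<and> R_basis absv N LN bs \<and> is_matrix_of N T as bs A \<and>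
    is_Smith_normal_form absv A D \<and>
    map (\<lambda>i. absv (d i)) [0..<min n m] = map (\<lambda>i. absv (D $$ (i, i))) [0..<min (dim_row D) (dim_col D)]"
proof -
  have a: "frame absv M LM a m" and b: "frame absv N LN b n"
    and Ta: "\<And>j. j < m \<Longrightarrow> T (a j) = (if j < n then d j \<odot>\<^bsub>N\<^esub> b j else \<zero>\<^bsub>N\<^esub>)"
    and mono: "\<And>i j. i \<le> j \<Longrightarrow> j < min n m \<Longrightarrow> absv (d j) \<le> absv (d i)"
    using D unfolding diagonalizes_def by blast+
  note bc = frame_carrier[OF b]
  define A where "A = mat n m (\<lambda>(i, j). if i = j then d i else 0)"
  have A: "A \<in> carrier_mat n m" "dim_row A = n" "dim_col A = m" by (simp_all add: A_def)
  have Aij: "A $$ (i, j) = (if i = j then d i else 0)" if "i < n" "j < m" for i j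
    using that by (simp add: A_def)
  have "is_matrix_of N T (map a [0..<m]) (map b [0..<n]) A"
    unfolding is_matrix_of_def
  proof (intro conjI allI impI)
    fix j assume "j < length (map a [0..<m])"
    then have j: "j < m" by simp
    have "T (a j) = fcomb N b n (\<lambda>i. if i = j then d j else 0)"
      using Ta[OF j] bc N.fcomb_zero[of n b "\<lambda>i. if i = j then d j else 0"]
      by (auto simp: N.fcomb_single)
    also have "\<dots> = fcomb N (nth (map b [0..<n])) n (\<lambda>i. A $$ (i, j))"
      using bc by (intro N.fcomb_cong) (auto simp: Aij j)
    finally show "T (map a [0..<m] ! j) = (\<Oplus>\<^bsub>N\<^esub>i\<in>{..<length (map b [0..<n])}. A $$ (i, j) \<odot>\<^bsub>N\<^esub> map b [0..<n] ! i)"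
      using j by (simp add: fcomb_def)
  qed (simp add: A)
  moreover have "is_Smith_normal_form absv A A"
    unfolding is_Smith_normal_form_def A(2,3)
  proof (intro conjI allI impI)
    show "\<exists>P\<in>GL_val_ring absv n. \<exists>Q\<in>GL_val_ring absv m. A = P * A * Q"
      using A(1) one_in_GL_val_ring[OF M.nonarch_local_field_axioms]
      by (intro bexI[of _ "1\<^sub>m n"] bexI[of _ "1\<^sub>m m"]) auto
    show "diagonal_mat A" using Aij by (auto simp: diagonal_mat_def A(2,3))
    fix i assume i: "Suc i < min n m"
    then have le: "absv (d (Suc i)) \<le> absv (d i)" by (intro mono) auto
    show "\<exists>r\<in>carrier (val_ring absv). A $$ (Suc i, Suc i) = r * A $$ (i, i)"
    proof (cases "d i = 0")
      case True
      then have "d (Suc i) = 0" using le M.absv_pos_iff[of "d (Suc i)"] by auto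
      then show ?thesis using i True by (intro bexI[of _ 0]) (auto simp: Aij val_ring_def)
    next
      case False
      then have "absv (d (Suc i) / d i) \<le> 1"
        using le M.absv_pos_iff[of "d i"] by (simp add: M.absv_divide)
      then show ?thesis using i False
        by (intro bexI[of _ "d (Suc i) / d i"]) (auto simp: Aij val_ring_def)
    qed
  qed
  moreover have "map (\<lambda>i. absv (d i)) [0..<min n m] = map (\<lambda>i. absv (A $$ (i, i))) [0..<min (dim_row A) (dim_col A)]"
    by (simp add: A Aij)
  ultimately show ?thesis
    using M.R_basis_if_frame[OF a] N.R_basis_if_frame[OF b] by blast
qed

text \<open>If \<open>D = P A Q\<close>, then \<open>T\<close> is diagonal with respect to the bases changed by \<open>Q\<close> and by the inverse
  \<open>P'\<close> of \<open>P\<close>, because \<open>A Q = P' D\<close>.\<close>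

lemma diagonalizes_if_Smith:
  assumes a: "frame absv M LM a m" and b: "frame absv N LN b n"
    and as: "R_basis absv M LM as" and bs: "R_basis absv N LN bs"
    and A: "is_matrix_of N T as bs A" and D: "is_Smith_normal_form absv A D"
  obtains a' b' where "diagonalizes absv M LM a' m N LN b' n T (\<lambda>i. D $$ (i, i))"
    "dim_row D = n" "dim_col D = m"
proof -
  note as' = M.frame_if_R_basis[OF a as] and bs' = N.frame_if_R_basis[OF b bs]
  have len: "length as = m" "length bs = n"
    using M.frame_dim_unique[OF as' a] N.frame_dim_unique[OF bs' b] by simp_all
  have as': "frame absv M LM (nth as) m" and bs': "frame absv N LN (nth bs) n" using as' bs' len by simp_all
  note asc = frame_carrier[OF as'] and bsc = frame_carrier[OF bs']
  have Ac: "A \<in> carrier_mat n m" and Aj: "\<And>j. j < m \<Longrightarrow> T (as ! j) = fcomb N (nth bs) n (\<lambda>i. A $$ (i, j))"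
    using A unfolding is_matrix_of_def len fcomb_def by auto
  obtain P Q where P: "P \<in> GL_val_ring absv n" and Q: "Q \<in> GL_val_ring absv m" and DPQ: "D = P * A * Q"
    using D Ac unfolding is_Smith_normal_form_def by auto
  have diag: "diagonal_mat D" using D unfolding is_Smith_normal_form_def by blast
  obtain P' where P': "P' \<in> carrier_mat n n" "elements_mat P' \<subseteq> carrier (val_ring absv)"
    "inverts_mat P P'" "inverts_mat P' P" using P unfolding GL_val_ring_def by blast
  have Pc: "P \<in> carrier_mat n n" "elements_mat P \<subseteq> carrier (val_ring absv)"
    and Qc: "Q \<in> carrier_mat m m" using P Q unfolding GL_val_ring_def by auto
  have P'GL: "P' \<in> GL_val_ring absv n" unfolding GL_val_ring_def using P' Pc by blast
  have Dc: "D \<in> carrier_mat n m" using DPQ Pc Ac Qc by auto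
  have D0: "D $$ (i, j) = 0" if "i < n" "j < m" "i \<noteq> j" for i j
    using diag that Dc unfolding diagonal_mat_def by auto
  have eq: "A * Q = P' * D"
  proof -
    have "P' * D = (P' * P) * (A * Q)"
      unfolding DPQ using P'(1) Pc(1) Ac Qc by (simp add: assoc_mult_mat[of _ n n _ n _ m] assoc_mult_mat[of _ n n _ m _ m])
    also have "P' * P = 1\<^sub>m n" using P' by (auto simp: inverts_mat_def)
    finally show ?thesis using Ac Qc by simp
  qed
  define a' where "a' = (\<lambda>j. fcomb M (nth as) m (\<lambda>i. Q $$ (i, j)))"
  define b' where "b' = (\<lambda>j. fcomb N (nth bs) n (\<lambda>i. P' $$ (i, j)))"
  have a': "frame absv M LM a' m" unfolding a'_def by (rule M.frame_change[OF as' Q])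
  have b': "frame absv N LN b' n" unfolding b'_def by (rule N.frame_change[OF bs' P'GL])
  have Ta': "T (a' j) = (if j < n then D $$ (j, j) \<odot>\<^bsub>N\<^esub> b' j else \<zero>\<^bsub>N\<^esub>)" if j: "j < m" for j
  proof -
    have "T (a' j) = fcomb N (\<lambda>k. T (as ! k)) m (\<lambda>i. Q $$ (i, j))"
      unfolding a'_def using asc by (rule T_fcomb)
    also have "\<dots> = fcomb N (\<lambda>k. fcomb N (nth bs) n (\<lambda>i. A $$ (i, k))) m (\<lambda>i. Q $$ (i, j))"
      by (intro N.fcomb_cong) (simp_all add: Aj T_closed[OF asc] bsc)
    also have "\<dots> = fcomb N (nth bs) n (\<lambda>i. \<Sum>k<m. Q $$ (k, j) * A $$ (i, k))"
      using bsc by (rule N.fcomb_fcomb)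
    also have "\<dots> = fcomb N (nth bs) n (\<lambda>i. if j < n then D $$ (j, j) * P' $$ (i, j) else 0)"
    proof (rule N.fcomb_cong[OF bsc])
      fix i assume i: "i < n"
      have "(\<Sum>k<m. Q $$ (k, j) * A $$ (i, k)) = (A * Q) $$ (i, j)"
        using i j Ac Qc by (simp add: scalar_prod_def lessThan_atLeast0 mult.commute)
      also have "\<dots> = (\<Sum>k<n. P' $$ (i, k) * D $$ (k, j))"
        unfolding eq using i j P'(1) Dc by (simp add: scalar_prod_def lessThan_atLeast0)
      also have "\<dots> = (\<Sum>k<n. if k = j then D $$ (j, j) * P' $$ (i, j) else 0)"
        using D0 j by (intro sum.cong) auto
      also have "\<dots> = (if j < n then D $$ (j, j) * P' $$ (i, j) else 0)" by simp
      finally show "(\<Sum>k<m. Q $$ (k, j) * A $$ (i, k)) = (if j < n then D $$ (j, j) * P' $$ (i, j) else 0)" .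
    qed auto
    also have "\<dots> = (if j < n then D $$ (j, j) \<odot>\<^bsub>N\<^esub> b' j else \<zero>\<^bsub>N\<^esub>)"
      using bsc by (simp add: b'_def N.fcomb_smult N.fcomb_zero)
    finally show ?thesis .
  qed
  have dec: "absv (D $$ (Suc i, Suc i)) \<le> absv (D $$ (i, i))" if i: "Suc i < min n m" for i
  proof -
    have dims: "dim_row D = n" "dim_col D = m" using Dc by auto
    have "\<forall>i. Suc i < min (dim_row D) (dim_col D) \<longrightarrow>
        (\<exists>r\<in>carrier (val_ring absv). D $$ (Suc i, Suc i) = r * D $$ (i, i))"
      using D unfolding is_Smith_normal_form_def by blast
    then obtain r where "r \<in> carrier (val_ring absv)" "D $$ (Suc i, Suc i) = r * D $$ (i, i)"
      using i unfolding dims by blast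
    then show ?thesis by (simp add: val_ring_def M.absv_mult M.absv_nonneg mult_left_le_one_le)
  qed
  have mono: "absv (D $$ (j, j)) \<le> absv (D $$ (i, i))" if "i \<le> j" "j < min n m" for i j
    using that
  proof (induction j rule: dec_induct)
    case (step j)
    then show ?case using dec[of j] by (meson Suc_lessD order_trans)
  qed simp
  show ?thesis
    using that[of a' b'] a' b' Ta' mono Dc unfolding diagonalizes_def by auto
qed

theorem singular_values_eq:
  assumes D: "diagonalizes absv M LM a m N LN b n T d"
  shows "singular_values absv M LM N LN T = map (\<lambda>i. absv (d i)) [0..<min n m]"
  unfolding singular_values_def
proof (rule the_equality)
  show "\<exists>as bs A D. R_basis absv M LM as \<and> R_basis absv N LN bs \<and> is_matrix_of N T as bs A \<and>
    is_Smith_normal_form absv A D \<and>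
    map (\<lambda>i. absv (d i)) [0..<min n m] = map (\<lambda>i. absv (D $$ (i, i))) [0..<min (dim_row D) (dim_col D)]"
    by (rule singular_values_witness[OF D])
next
  fix s
  assume "\<exists>as bs A D. R_basis absv M LM as \<and> R_basis absv N LN bs \<and> is_matrix_of N T as bs A \<and>
    is_Smith_normal_form absv A D \<and> s = map (\<lambda>i. absv (D $$ (i, i))) [0..<min (dim_row D) (dim_col D)]"
  then obtain as bs A S where *: "R_basis absv M LM as" "R_basis absv N LN bs" "is_matrix_of N T as bs A"
    "is_Smith_normal_form absv A S" "s = map (\<lambda>i. absv (S $$ (i, i))) [0..<min (dim_row S) (dim_col S)]"
    by blast
  have a: "frame absv M LM a m" and b: "frame absv N LN b n" using D unfolding diagonalizes_def by blast+
  obtain a' b' where D': "diagonalizes absv M LM a' m N LN b' n T (\<lambda>i. S $$ (i, i))"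
    and dims: "dim_row S = n" "dim_col S = m"
    by (rule diagonalizes_if_Smith[OF a b *(1-4)])
  have "absv (S $$ (i, i)) = absv (d i)" if "i < min n m" for i
    using diagonal_entry_le[OF D D' that] diagonal_entry_le[OF D' D that] by simp
  then show "s = map (\<lambda>i. absv (d i)) [0..<min n m]" unfolding *(5) dims by simp
qed

end

section \<open>The addition map of a pair in normal form\<close>

context local_K_space
begin

lemma fcomb_shift:
  assumes "\<And>i. i < n \<Longrightarrow> b i \<in> carrier V" "l + m \<le> n"
  shows "fcomb V (\<lambda>i. b (l + i)) m x = fcomb V b n (\<lambda>i. if l \<le> i \<and> i < l + m then x (i - l) else 0)"
proof -
  let ?y = "\<lambda>i. if i < l then 0 else x (i - l)"
  have b: "\<And>i. i < l + m \<Longrightarrow> b i \<in> carrier V" "\<And>i. i < l \<Longrightarrow> b i \<in> carrier V"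
    "\<And>i. i < m \<Longrightarrow> b (l + i) \<in> carrier V" using assms by auto
  have "fcomb V b (l + m) ?y = fcomb V b l ?y \<oplus>\<^bsub>V\<^esub> fcomb V (\<lambda>i. b (l + i)) m (\<lambda>i. ?y (l + i))"
    using b(1) by (rule fcomb_append)
  also have "fcomb V b l ?y = \<zero>\<^bsub>V\<^esub>" using b(2) by (intro fcomb_zero) auto
  finally have "fcomb V b (l + m) ?y = fcomb V (\<lambda>i. b (l + i)) m x" using b(3) by simp
  moreover have "fcomb V b (l + m) ?y = fcomb V b n (\<lambda>i. if i < l + m then ?y i else 0)"
    using assms by (rule fcomb_prefix)
  moreover have "\<dots> = fcomb V b n (\<lambda>i. if l \<le> i \<and> i < l + m then x (i - l) else 0)"
    using assms(1) by (intro fcomb_cong) auto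
  ultimately show ?thesis by simp
qed

lemma K_space_subspace:
  assumes "VectorSpace.subspace class_ring U V"
  shows "local_K_space absv (V\<lparr>carrier := U\<rparr>)"
  using subspace_is_vs[OF assms] nonarch_local_field_axioms
  by (simp add: local_K_space_def K_space_iff)

lemma fcomb_subspace:
  assumes "VectorSpace.subspace class_ring U V" "\<And>i. i < n \<Longrightarrow> b i \<in> U"
  shows "fcomb (V\<lparr>carrier := U\<rparr>) b n x = fcomb V b n x"
proof -
  have "U \<subseteq> carrier V" using assms(1) by (simp add: VectorSpace.subspace_def submodule_def)
  then have "(\<lambda>v. v) \<in> LinearCombinations.module_hom class_ring (V\<lparr>carrier := U\<rparr>) V"
    by (auto simp: LinearCombinations.module_hom_def)
  from fcomb_hom[OF subspace_is_vs[OF assms(1)] vectorspace_axioms this, of n b x]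
  show ?thesis using assms(2) by simp
qed

lemma frame_subspace:
  assumes e: "\<And>i. i < m \<Longrightarrow> e i \<in> carrier V" and U: "U = range (fcomb V e m)"
    and ind: "\<And>x i. fcomb V e m x = \<zero>\<^bsub>V\<^esub> \<Longrightarrow> i < m \<Longrightarrow> x i = 0"
    and L: "\<And>x. fcomb V e m x \<in> L \<longleftrightarrow> (\<forall>i<m. absv (x i) \<le> 1)"
  shows "frame absv (V\<lparr>carrier := U\<rparr>) (U \<inter> L) e m"
proof -
  have sub: "VectorSpace.subspace class_ring U V" unfolding U using e by (rule subspace_range_fcomb)
  have eU: "e i \<in> U" if "i < m" for i
  proof -
    have "e i = fcomb V e m (\<lambda>j. if j = i then 1 else 0)"
      using fcomb_single[of m e i 1, OF e that] e[OF that] by simp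
    then show ?thesis unfolding U by (rule range_eqI[of _ "fcomb V e m"])
  qed
  have eq: "fcomb (V\<lparr>carrier := U\<rparr>) e m = fcomb V e m"
    using fcomb_subspace[OF sub eU] by (simp add: fun_eq_iff)
  show ?thesis unfolding frame_def eq using eU ind
    by (auto simp: U L)
qed

text \<open>The basis of the smaller space in the normal form: the first \<open>d\<close> vectors are shared with the larger
  space, and the others are basis vectors of the larger space, moved by a multiple of a vector outside.\<close>

definition position_family ::
    "(nat \<Rightarrow> 'k) \<Rightarrow> (nat \<Rightarrow> 'v) \<Rightarrow> nat \<Rightarrow> nat \<Rightarrow> nat \<Rightarrow> 'v" where
  "position_family c q d l i = (if i < d then q i else q i \<oplus>\<^bsub>V\<^esub> c (i - d) \<odot>\<^bsub>V\<^esub> q (l + (i - d)))"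

lemma position_family_closed:
  assumes "\<And>i. i < n \<Longrightarrow> q i \<in> carrier V" "d + m \<le> l" "l + m \<le> n" "i < d + m"
  shows "position_family c q d l i \<in> carrier V"
  using assms by (auto simp: position_family_def)

lemma fcomb_position_family:
  assumes qc: "\<And>i. i < n \<Longrightarrow> q i \<in> carrier V" and lm: "d + m \<le> l" "l + m \<le> n"
  shows "fcomb V (position_family c q d l) (d + m) y = fcomb V q n (\<lambda>i. if i < d + m then y i
    else if l \<le> i \<and> i < l + m then y (d + (i - l)) * c (i - l) else 0)"
proof -
  let ?e = "position_family c q d l" and ?y = "\<lambda>i. y (d + i)"
  have ec: "?e i \<in> carrier V" if "i < d + m" for i
    using qc lm that by (rule position_family_closed)
  have "fcomb V ?e (d + m) y = fcomb V ?e d y \<oplus>\<^bsub>V\<^esub> fcomb V (\<lambda>i. ?e (d + i)) m ?y"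
    using ec by (rule fcomb_append)
  also have "fcomb V ?e d y = fcomb V q d y"
    using qc lm by (intro fcomb_cong) (auto simp: position_family_def)
  also have "fcomb V (\<lambda>i. ?e (d + i)) m ?y = fcomb V (\<lambda>i. q (d + i) \<oplus>\<^bsub>V\<^esub> c i \<odot>\<^bsub>V\<^esub> q (l + i)) m ?y"
    using qc lm by (intro fcomb_cong) (auto simp: position_family_def)
  also have "\<dots> = fcomb V (\<lambda>i. q (d + i)) m ?y \<oplus>\<^bsub>V\<^esub> fcomb V (\<lambda>i. c i \<odot>\<^bsub>V\<^esub> q (l + i)) m ?y"
    using qc lm by (intro fcomb_add_families) auto
  also have "fcomb V (\<lambda>i. c i \<odot>\<^bsub>V\<^esub> q (l + i)) m ?y = fcomb V (\<lambda>i. q (l + i)) m (\<lambda>i. ?y i * c i)"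
    using qc lm by (intro fcomb_scaled_family) auto
  also have "\<dots> = fcomb V q n (\<lambda>i. if l \<le> i \<and> i < l + m then ?y (i - l) * c (i - l) else 0)" (is "_ = ?B")
    using qc lm(2) by (rule fcomb_shift)
  also have "fcomb V q d y \<oplus>\<^bsub>V\<^esub> (fcomb V (\<lambda>i. q (d + i)) m ?y \<oplus>\<^bsub>V\<^esub> ?B) = fcomb V q (d + m) y \<oplus>\<^bsub>V\<^esub> ?B"
    using qc lm by (simp add: fcomb_append a_assoc)
  also have "fcomb V q (d + m) y = fcomb V q n (\<lambda>i. if i < d + m then y i else 0)"
    using qc lm by (intro fcomb_prefix) auto
  also have "\<dots> \<oplus>\<^bsub>V\<^esub> ?B = fcomb V q n (\<lambda>i. (if i < d + m then y i else 0) +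
      (if l \<le> i \<and> i < l + m then ?y (i - l) * c (i - l) else 0))"
    using qc by (rule fcomb_add)
  also have "\<dots> = fcomb V q n (\<lambda>i. if i < d + m then y i
    else if l \<le> i \<and> i < l + m then y (d + (i - l)) * c (i - l) else 0)"
    using qc lm by (intro fcomb_cong) auto
  finally show ?thesis .
qed

text \<open>The coordinates of \<open>y\<close> reappear as the first coordinates of the combination, and the others are
  integral multiples of them. So the family is independent, and its integral combinations are those
  in the lattice.\<close>

lemma frame_position_family:
  assumes q: "frame absv V L q n" and lm: "d + m \<le> l" "l + m \<le> n"
    and c1: "\<And>i. i < m \<Longrightarrow> absv (c i) \<le> 1"
  defines "e \<equiv> position_family c q d l"
  shows "frame absv (V\<lparr>carrier := range (fcomb V e (d + m))\<rparr>) (range (fcomb V e (d + m)) \<inter> L) e (d + m)"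
proof -
  note qc = frame_carrier[OF q]
  have ec: "e i \<in> carrier V" if "i < d + m" for i
    unfolding e_def using qc lm that by (rule position_family_closed)
  define X where "X = (\<lambda>y i. if i < d + m then y i
    else if l \<le> i \<and> i < l + m then y (d + (i - l)) * c (i - l) else 0)"
  have eX: "fcomb V e (d + m) y = fcomb V q n (X y)" for y
    unfolding e_def X_def using qc lm by (rule fcomb_position_family)
  show ?thesis
  proof (rule frame_subspace[OF ec refl])
    show "x i = 0" if "fcomb V e (d + m) x = \<zero>\<^bsub>V\<^esub>" "i < d + m" for x i
    proof -
      have "fcomb V q n (X x) = \<zero>\<^bsub>V\<^esub>" using that(1) by (simp add: eX)
      moreover have "i < n" using that(2) lm by simp
      ultimately have "X x i = 0" by (rule frame_indep[OF q, of "X x" i])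
      then show ?thesis using that(2) by (simp add: X_def)
    qed
    show "fcomb V e (d + m) x \<in> L \<longleftrightarrow> (\<forall>i<d + m. absv (x i) \<le> 1)" for x
      unfolding eX frame_lattice_iff[OF q]
    proof
      assume *: "\<forall>i<n. absv (X x i) \<le> 1"
      have "absv (x i) \<le> 1" if "i < d + m" for i
        using *[rule_format, of i] that lm by (simp add: X_def)
      then show "\<forall>i<d + m. absv (x i) \<le> 1" by blast
    next
      assume *: "\<forall>i<d + m. absv (x i) \<le> 1"
      have "absv (x (d + (i - l)) * c (i - l)) \<le> 1" if "l \<le> i" "i < l + m" for i
        using * c1 that by (intro absv_mult_le_1) auto
      then show "\<forall>i<n. absv (X x i) \<le> 1" using * by (auto simp: X_def)
    qed
  qed
qed

lemma frame_prefix: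
  assumes q: "frame absv V L q n" and lm: "l \<le> n"
  shows "frame absv (V\<lparr>carrier := range (fcomb V q l)\<rparr>) (range (fcomb V q l) \<inter> L) q l"
proof -
  note qc = frame_carrier[OF q]
  show "frame absv (V\<lparr>carrier := range (fcomb V q l)\<rparr>) (range (fcomb V q l) \<inter> L) q l"
  proof (rule frame_subspace[OF _ refl])
    have pre: "fcomb V q l x = fcomb V q n (\<lambda>i. if i < l then x i else 0)" for x
      using qc lm by (intro fcomb_prefix) auto
    show "q i \<in> carrier V" if "i < l" for i using qc lm that by simp
    show "x i = 0" if "fcomb V q l x = \<zero>\<^bsub>V\<^esub>" "i < l" for x i
    proof -
      have "fcomb V q n (\<lambda>i. if i < l then x i else 0) = \<zero>\<^bsub>V\<^esub>" using that(1) by (simp add: pre)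
      moreover have "i < n" using that(2) lm by simp
      ultimately have "(if i < l then x i else 0) = 0"
        by (rule frame_indep[OF q, of "\<lambda>i. if i < l then x i else 0" i])
      then show ?thesis using that(2) by simp
    qed
    show "fcomb V q l x \<in> L \<longleftrightarrow> (\<forall>i<l. absv (x i) \<le> 1)" for x
      unfolding pre frame_lattice_iff[OF q] using lm by (auto split: if_splits)
  qed
qed

lemma eps_pow_inj: "inj (eps_pow absv)"
proof (rule injI)
  fix x y assume "eps_pow absv x = eps_pow absv y"
  then show "x = y"
    using eps_pos eps_less_1 power_inject_exp'[of "eps absv"]
    by (cases x; cases y) (auto simp: eps_pow_def power_inject_exp)
qed

text \<open>If \<open>E \<inter> F = 0\<close>, the normal form diagonalizes the addition map. It maps \<open>(0, q j)\<close> to \<open>q j\<close> for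
  \<open>j < l\<close>, and \<open>(e i, - q i)\<close> to \<open>p\<^sup>x q (l + i)\<close> for \<open>i < m\<close>; these pairs form an \<open>R\<close>-basis of the lattice
  in \<open>E \<times> F\<close>. After the \<open>l\<close> ones, the singular values are the powers \<open>\<epsilon>\<^sup>x\<close>.\<close>

lemma position_vector_le_frame:
  assumes q: "frame absv V L q n" and lm: "m \<le> l" "l + m \<le> n" and p: "absv p = eps absv"
    and x: "\<And>i j. i \<le> j \<Longrightarrow> j < m \<Longrightarrow> x i \<le> x j"
    and F: "F = range (fcomb V q l)"
    and E: "E = range (fcomb V (position_family (\<lambda>i. p ^ x i) q 0 l) m)"
  shows "subspace_dim V E = m" "subspace_dim V F = l"
    "position_vector_le absv V L E F = map (\<lambda>i. enat (x i)) [0..<m]"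
proof -
  note qc = frame_carrier[OF q]
  define c where "c = (\<lambda>i. p ^ x i)"
  have c_abs: "absv (c i) = eps absv ^ x i" for i by (simp add: c_def absv_power p)
  have c1: "absv (c i) \<le> 1" for i unfolding c_abs using eps_pos eps_less_1 by (simp add: power_le_one)
  define e where "e = position_family c q 0 l"
  have e: "e i = q i \<oplus>\<^bsub>V\<^esub> c i \<odot>\<^bsub>V\<^esub> q (l + i)" for i by (simp add: e_def position_family_def)
  have E: "E = range (fcomb V e m)" unfolding E e_def c_def ..
  have ec: "e i \<in> carrier V" if "i < m" for i using qc lm that by (simp add: e)
  have fE: "frame absv (V\<lparr>carrier := E\<rparr>) (E \<inter> L) e m"
    and fF: "frame absv (V\<lparr>carrier := F\<rparr>) (F \<inter> L) q l"
    using frame_position_family[OF q, of 0 m l c] frame_prefix[OF q, of l] lm c1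
    unfolding E F e_def by simp_all
  have subE: "VectorSpace.subspace class_ring E V" unfolding E using ec by (rule subspace_range_fcomb)
  have subF: "VectorSpace.subspace class_ring F V"
    unfolding F by (rule subspace_range_fcomb) (use qc lm in auto)
  interpret E: local_K_space absv "V\<lparr>carrier := E\<rparr>" by (rule K_space_subspace[OF subE])
  interpret F: local_K_space absv "V\<lparr>carrier := F\<rparr>" by (rule K_space_subspace[OF subF])
  show "subspace_dim V E = m" by (rule E.dim_frame[OF fE])
  show dimF: "subspace_dim V F = l" by (rule F.dim_frame[OF fF])
  have ecE: "fcomb (V\<lparr>carrier := E\<rparr>) e m y = fcomb V e m y" for y
    by (rule fcomb_subspace[OF subE]) (use frame_carrier[OF fE] in simp)
  have qF: "q i \<in> F" if "i < l" for i using frame_carrier[OF fF that] by simp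
  have eE: "e i \<in> E" if "i < m" for i using frame_carrier[OF fE that] by simp

  let ?S = "direct_sum (V\<lparr>carrier := E\<rparr>) (V\<lparr>carrier := F\<rparr>)"
  let ?LS = "(E \<inter> L) \<times> (F \<inter> L)"
  define a where "a = (\<lambda>j. if j < l then (\<zero>\<^bsub>V\<^esub>, q j) else (e (j - l), \<ominus>\<^bsub>V\<^esub> q (j - l)))"
  have zE: "\<zero>\<^bsub>V\<^esub> \<in> E" and zF: "\<zero>\<^bsub>V\<^esub> \<in> F" using E.zero_closed F.zero_closed by simp_all
  have mqF: "\<ominus>\<^bsub>V\<^esub> q i \<in> F" if "i < l" for i
  proof -
    have "(- 1) \<odot>\<^bsub>V\<^esub> q i \<in> F" using F.smult_carrier[of "q i" "-1"] qF[OF that] by simp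
    then show ?thesis using smult_minus[of "q i" 1] qc lm that by simp
  qed
  have ac: "a j \<in> E \<times> F" if "j < l + m" for j
    using that zE qF eE mqF lm by (auto simp: a_def)
  have vsS: "vectorspace class_ring ?S"
    by (rule direct_sum_is_vs[OF E.vectorspace_axioms F.vectorspace_axioms])
  interpret S: local_K_space absv ?S
    using vsS nonarch_local_field_axioms by (simp add: local_K_space_def K_space_iff)
  have cS: "carrier ?S = E \<times> F" by (simp add: direct_sum_def)
  have EV: "E \<subseteq> carrier V" "F \<subseteq> carrier V"
    using subE subF by (simp_all add: VectorSpace.subspace_def submodule_def)
  have fst: "fst \<in> LinearCombinations.module_hom class_ring ?S V"
    and snd: "snd \<in> LinearCombinations.module_hom class_ring ?S V"
    using EV by (auto simp: LinearCombinations.module_hom_def direct_sum_def)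
  \<comment> \<open>\<open>y x'\<close> and \<open>z x'\<close> are the coordinates of the two components of the combination of \<open>a\<close> with
    coefficients \<open>x'\<close>; \<open>w\<close> below inverts this.\<close>
  define y :: "(nat \<Rightarrow> 'k) \<Rightarrow> nat \<Rightarrow> 'k" where "y = (\<lambda>x' i. x' (l + i))"
  define z :: "(nat \<Rightarrow> 'k) \<Rightarrow> nat \<Rightarrow> 'k"
    where "z = (\<lambda>x' i. x' i - (if i < m then x' (l + i) else 0))"
  have fst_a: "fst (fcomb ?S a (l + m) x') = fcomb V e m (y x')" for x'
  proof -
    have "fst (fcomb ?S a (l + m) x') = fcomb V (\<lambda>j. fst (a j)) (l + m) x'"
      by (rule fcomb_hom[OF vsS vectorspace_axioms fst]) (use ac cS in auto)
    also have "\<dots> = fcomb V (\<lambda>j. fst (a j)) l x' \<oplus>\<^bsub>V\<^esub> fcomb V (\<lambda>i. fst (a (l + i))) m (y x')"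
      unfolding y_def using ac EV by (intro fcomb_append) (auto simp: mem_Times_iff)
    also have "fcomb V (\<lambda>j. fst (a j)) l x' = fcomb V (\<lambda>j. 0 \<odot>\<^bsub>V\<^esub> q j) l x'"
      using qc lm by (intro fcomb_cong) (auto simp: a_def)
    also have "\<dots> = \<zero>\<^bsub>V\<^esub>"
      using qc lm by (subst fcomb_scaled_family) (auto intro: fcomb_zero)
    also have "fcomb V (\<lambda>i. fst (a (l + i))) m (y x') = fcomb V e m (y x')"
      using ec by (intro fcomb_cong) (auto simp: a_def)
    finally show ?thesis using ec by simp
  qed
  have snd_a: "snd (fcomb ?S a (l + m) x') = fcomb V q l (z x')" for x'
  proof -
    have ql: "\<And>i. i < l \<Longrightarrow> q i \<in> carrier V" using qc lm by simp
    have "snd (fcomb ?S a (l + m) x') = fcomb V (\<lambda>j. snd (a j)) (l + m) x'"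
      by (rule fcomb_hom[OF vsS vectorspace_axioms snd]) (use ac cS in auto)
    also have "\<dots> = fcomb V (\<lambda>j. snd (a j)) l x' \<oplus>\<^bsub>V\<^esub> fcomb V (\<lambda>i. snd (a (l + i))) m (y x')"
      unfolding y_def using ac EV by (intro fcomb_append) (auto simp: mem_Times_iff)
    also have "fcomb V (\<lambda>j. snd (a j)) l x' = fcomb V q l x'"
      using qc lm by (intro fcomb_cong) (auto simp: a_def)
    also have "fcomb V (\<lambda>i. snd (a (l + i))) m (y x') = fcomb V (\<lambda>i. (- 1) \<odot>\<^bsub>V\<^esub> q i) m (y x')"
      using ql lm smult_minus[of _ 1] by (intro fcomb_cong) (auto simp: a_def)
    also have "\<dots> = fcomb V q m (\<lambda>i. y x' i * - 1)"
      using ql lm by (intro fcomb_scaled_family) auto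
    also have "\<dots> = fcomb V q l (\<lambda>i. if i < m then y x' i * - 1 else 0)"
      using ql lm by (intro fcomb_prefix) auto
    also have "fcomb V q l x' \<oplus>\<^bsub>V\<^esub> fcomb V q l (\<lambda>i. if i < m then y x' i * - 1 else 0) =
        fcomb V q l (\<lambda>i. x' i + (if i < m then y x' i * - 1 else 0))"
      using ql by (rule fcomb_add)
    also have "\<dots> = fcomb V q l (z x')"
      using ql by (intro fcomb_cong) (auto simp: z_def y_def)
    finally show ?thesis .
  qed
  have comb_a: "fcomb ?S a (l + m) x' = (fcomb V e m (y x'), fcomb V q l (z x'))" for x'
    using fst_a snd_a by (metis prod.collapse)
  define w :: "(nat \<Rightarrow> 'k) \<Rightarrow> (nat \<Rightarrow> 'k) \<Rightarrow> nat \<Rightarrow> 'k"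
    where "w = (\<lambda>y' z' j. if j < l then z' j + (if j < m then y' j else 0) else y' (j - l))"
  have w: "fcomb V e m y' = fcomb V e m (y (w y' z'))" "fcomb V q l z' = fcomb V q l (z (w y' z'))" for y' z'
    using ec qc lm by (auto intro!: fcomb_cong simp: w_def y_def z_def)
  have fcE: "E = range (fcomb V e m)" and fcF: "F = range (fcomb V q l)" using E F by simp_all
  have EcF: "fcomb V e m y' \<in> E" "fcomb V q l y' \<in> F" for y' unfolding fcE fcF by (rule rangeI)+
  have indE: "y' i = 0" if "fcomb V e m y' = \<zero>\<^bsub>V\<^esub>" "i < m" for y' i
    using frame_indep[OF fE, of y' i] that ecE by simp
  have fcqF: "fcomb (V\<lparr>carrier := F\<rparr>) q l y' = fcomb V q l y'" for y' by (rule fcomb_subspace[OF subF qF])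
  have indF: "y' i = 0" if "fcomb V q l y' = \<zero>\<^bsub>V\<^esub>" "i < l" for y' i
    using frame_indep[OF fF, of y' i] that fcqF by simp
  have LE: "fcomb V e m y' \<in> L \<longleftrightarrow> (\<forall>i<m. absv (y' i) \<le> 1)" for y'
    using E.frame_lattice_iff[OF fE, of y'] ecE fcE by auto
  have LF: "fcomb V q l y' \<in> L \<longleftrightarrow> (\<forall>i<l. absv (y' i) \<le> 1)" for y'
    using F.frame_lattice_iff[OF fF, of y'] fcqF fcF by auto
  have fS: "frame absv ?S ?LS a (l + m)"
    unfolding frame_def
  proof (intro conjI allI impI)
    show "a j \<in> carrier ?S" if "j < l + m" for j unfolding cS using ac[OF that] .
    show "carrier ?S = range (fcomb ?S a (l + m))"
    proof (rule subset_antisym)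
      show "carrier ?S \<subseteq> range (fcomb ?S a (l + m))"
      proof
        fix u assume "u \<in> carrier ?S"
        then have "u \<in> E \<times> F" unfolding cS .
        then obtain y' z' where "u = (fcomb V e m y', fcomb V q l z')" unfolding fcE fcF by auto
        then have "u = fcomb ?S a (l + m) (w y' z')" unfolding comb_a using w by metis
        then show "u \<in> range (fcomb ?S a (l + m))" by blast
      qed
      show "range (fcomb ?S a (l + m)) \<subseteq> carrier ?S" 
        using EcF by (auto simp: cS comb_a)
    qed
    show "x' j = 0" if 0: "fcomb ?S a (l + m) x' = \<zero>\<^bsub>?S\<^esub>" and j: "j < l + m" for x' j
    proof -
      have 1: "fcomb V e m (y x') = \<zero>\<^bsub>V\<^esub>" and 2: "fcomb V q l (z x') = \<zero>\<^bsub>V\<^esub>"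
        using 0 unfolding comb_a by (auto simp: direct_sum_def)
      have y0: "x' (l + i) = 0" if "i < m" for i using indE[OF 1 that] by (simp add: y_def)
      show ?thesis
      proof (cases "j < l")
        case True
        then show ?thesis using indF[OF 2 True] y0[of j] by (simp add: z_def split: if_splits)
      next
        case False then show ?thesis using y0[of "j - l"] j by simp
      qed
    qed
    show "?LS = fcomb ?S a (l + m) ` {x. \<forall>i<l + m. absv (x i) \<le> 1}"
    proof (rule subset_antisym)
      show "?LS \<subseteq> fcomb ?S a (l + m) ` {x. \<forall>i<l + m. absv (x i) \<le> 1}"
      proof
        fix u assume u: "u \<in> ?LS"
        then have "u \<in> E \<times> F" by blast
        then obtain y' z' where yz: "u = (fcomb V e m y', fcomb V q l z')" unfolding fcE fcF by auto
        have le: "\<forall>i<m. absv (y' i) \<le> 1" "\<forall>i<l. absv (z' i) \<le> 1" using u LE LF unfolding yz by auto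
        have "absv (w y' z' i) \<le> 1" if "i < l + m" for i
          using le that lm by (auto simp: w_def intro!: absv_add_le_1)
        moreover have "u = fcomb ?S a (l + m) (w y' z')" unfolding comb_a yz using w by metis
        ultimately show "u \<in> fcomb ?S a (l + m) ` {x. \<forall>i<l + m. absv (x i) \<le> 1}" by blast
      qed
      show "fcomb ?S a (l + m) ` {x. \<forall>i<l + m. absv (x i) \<le> 1} \<subseteq> ?LS"
      proof safe
        fix x' e' f' assume x': "\<forall>i<l + m. absv (x' i) \<le> 1" and ef: "(e', f') = fcomb ?S a (l + m) x'"
        then have e': "e' = fcomb V e m (y x')" and f': "f' = fcomb V q l (z x')" unfolding comb_a by auto
        show "e' \<in> E" "f' \<in> F" unfolding e' f' by (rule EcF)+
        show "e' \<in> L" unfolding e' LE using x' by (simp add: y_def)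
        show "f' \<in> L" unfolding f' LF using x' lm by (auto simp: z_def intro!: absv_diff_le_1)
      qed
    qed
  qed
  let ?T = "\<lambda>(e, f). e \<oplus>\<^bsub>V\<^esub> f"
  define d where "d = (\<lambda>j. if j < l then 1 else c (j - l))"
  have T: "?T \<in> LinearCombinations.module_hom class_ring ?S V"
    using EV by (auto simp: LinearCombinations.module_hom_def direct_sum_def add_swap smult_add_right subset_iff)
  interpret T: local_K_map absv ?S V ?T
    by (intro local_K_map.intro local_K_map_axioms.intro T S.local_K_space_axioms local_K_space_axioms)
  have diag: "diagonalizes absv ?S ?LS a (l + m) V L q n ?T d"
    unfolding diagonalizes_def
  proof (intro conjI fS q allI impI)
    fix j assume j: "j < l + m"
    have "?T (a j) = d j \<odot>\<^bsub>V\<^esub> q j"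
    proof (cases "j < l")
      case True then show ?thesis using qc[of j] lm by (simp add: a_def d_def)
    next
      case False
      then have car: "q (j - l) \<in> carrier V" "q j \<in> carrier V" and lj: "l + (j - l) = j" using j lm qc by auto
      have "e (j - l) \<oplus>\<^bsub>V\<^esub> \<ominus>\<^bsub>V\<^esub> q (j - l) = c (j - l) \<odot>\<^bsub>V\<^esub> q j \<oplus>\<^bsub>V\<^esub> (q (j - l) \<oplus>\<^bsub>V\<^esub> \<ominus>\<^bsub>V\<^esub> q (j - l))"
        unfolding e lj using car by (simp add: M.add.m_ac)
      then show ?thesis using False car by (simp add: a_def d_def r_neg)
    qed
    then show "?T (a j) = (if j < n then d j \<odot>\<^bsub>V\<^esub> q j else \<zero>\<^bsub>V\<^esub>)" using j lm by simp
  next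
    fix i j assume ij: "i \<le> j" "j < min n (l + m)"
    show "absv (d j) \<le> absv (d i)"
    proof (cases "i < l")
      case True then show ?thesis using c1 by (auto simp: d_def)
    next
      case False
      then have "x (i - l) \<le> x (j - l)" using ij by (intro x) auto
      then show ?thesis using False ij eps_pos eps_less_1 by (simp add: d_def c_abs power_decreasing)
    qed
  qed
  have "addition_singular_values absv V L E F = map (\<lambda>i. absv (d i)) [0..<l + m]"
    unfolding addition_singular_values_def T.singular_values_eq[OF diag] using lm by (simp add: min_def)
  then have "drop l (addition_singular_values absv V L E F) = map (\<lambda>i. absv (d i)) [l..<l + m]"
    by (simp add: drop_map)
  also have "\<dots> = map (eps_pow absv) (map (\<lambda>i. enat (x i)) [0..<m])"
    by (rule nth_equalityI) (auto simp: d_def c_abs eps_pow_def)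
  finally have sv: "drop (subspace_dim V F) (addition_singular_values absv V L E F) =
      map (eps_pow absv) (map (\<lambda>i. enat (x i)) [0..<m])" unfolding dimF .
  show "position_vector_le absv V L E F = map (\<lambda>i. enat (x i)) [0..<m]"
    unfolding position_vector_le_def sv by (rule the_equality) (simp_all only: inj_map_eq_map[OF eps_pow_inj])
qed

end

section \<open>The position vector of a pair in normal form\<close>

context K_space
begin

lemma abelian_subgroup_subspace:
  assumes "VectorSpace.subspace class_ring W V"
  shows "abelian_subgroup W V"
proof -
  interpret W: submodule class_ring W V using assms by (simp add: VectorSpace.subspace_def)
  have sub: "W \<subseteq> carrier V" by (rule W.subset)
  have "\<ominus>\<^bsub>V\<^esub> w \<in> W" if "w \<in> W" for w
  proof -
    have "(- 1) \<odot>\<^bsub>V\<^esub> w \<in> W" using that by simp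
    moreover have "(- 1) \<odot>\<^bsub>V\<^esub> w = \<ominus>\<^bsub>V\<^esub> w" using smult_minus[of w 1] that sub by auto
    ultimately show ?thesis by simp
  qed
  then have "subgroup W (add_monoid V)"
    using W.subset W.m_closed W.zero_closed
    by (intro subgroup.intro) (auto simp: a_inv_def)
  then show ?thesis
    by (intro abelian_subgroupI3 additive_subgroup.intro abelian_group_axioms)
qed

text \<open>Addition and scalar multiplication of cosets are those of representatives, so the projection carries
  the axioms of a vector space over to the quotient.\<close>

lemma vs_quot_projection:
  assumes W: "VectorSpace.subspace class_ring W V"
  defines "Q \<equiv> vs_quot V W" and "p \<equiv> (\<lambda>v. W +>\<^bsub>V\<^esub> v)"
  shows "vectorspace class_ring Q" "p \<in> LinearCombinations.module_hom class_ring V Q"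
    "carrier Q = p ` carrier V" "\<And>v. v \<in> carrier V \<Longrightarrow> p v = \<zero>\<^bsub>Q\<^esub> \<longleftrightarrow> v \<in> W"
proof -
  interpret W: abelian_subgroup W V by (rule abelian_subgroup_subspace[OF W])
  interpret Wm: submodule class_ring W V using W by (simp add: VectorSpace.subspace_def)
  have sub: "W \<subseteq> carrier V" by (rule Wm.subset)
  show carrier: "carrier Q = p ` carrier V"
    by (auto simp: Q_def p_def vs_quot_def A_RCOSETS_def' )
  have add: "p u \<oplus>\<^bsub>Q\<^esub> p v = p (u \<oplus>\<^bsub>V\<^esub> v)" if "u \<in> carrier V" "v \<in> carrier V" for u v
    using W.a_rcos_sum[OF that] by (simp add: Q_def p_def vs_quot_def)
  have smult: "c \<odot>\<^bsub>Q\<^esub> p v = p (c \<odot>\<^bsub>V\<^esub> v)" if v: "v \<in> carrier V" for c v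
  proof -
    have "W <+>\<^bsub>V\<^esub> ((\<odot>\<^bsub>V\<^esub>) c ` (W +>\<^bsub>V\<^esub> v)) = W +>\<^bsub>V\<^esub> (c \<odot>\<^bsub>V\<^esub> v)"
    proof (rule subset_antisym; rule subsetI)
      fix x assume "x \<in> W <+>\<^bsub>V\<^esub> ((\<odot>\<^bsub>V\<^esub>) c ` (W +>\<^bsub>V\<^esub> v))"
      then obtain w w' where w: "w \<in> W" "w' \<in> W" "x = w \<oplus>\<^bsub>V\<^esub> c \<odot>\<^bsub>V\<^esub> (w' \<oplus>\<^bsub>V\<^esub> v)"
        by (auto simp: set_add_def' a_r_coset_def')
      then have "x = (w \<oplus>\<^bsub>V\<^esub> c \<odot>\<^bsub>V\<^esub> w') \<oplus>\<^bsub>V\<^esub> c \<odot>\<^bsub>V\<^esub> v"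
        using v sub by (simp add: smult_add_right a_assoc subset_iff)
      moreover have "w \<oplus>\<^bsub>V\<^esub> c \<odot>\<^bsub>V\<^esub> w' \<in> W" using w(1,2) by simp
      ultimately show "x \<in> W +>\<^bsub>V\<^esub> (c \<odot>\<^bsub>V\<^esub> v)" by (auto simp: a_r_coset_def')
    next
      fix x assume "x \<in> W +>\<^bsub>V\<^esub> (c \<odot>\<^bsub>V\<^esub> v)"
      then obtain w where w: "w \<in> W" "x = w \<oplus>\<^bsub>V\<^esub> c \<odot>\<^bsub>V\<^esub> v" by (auto simp: a_r_coset_def')
      have "\<zero>\<^bsub>V\<^esub> \<oplus>\<^bsub>V\<^esub> v \<in> W +>\<^bsub>V\<^esub> v" unfolding a_r_coset_def' using Wm.zero_closed by blast
      then have "v \<in> W +>\<^bsub>V\<^esub> v" using v by simp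
      then show "x \<in> W <+>\<^bsub>V\<^esub> ((\<odot>\<^bsub>V\<^esub>) c ` (W +>\<^bsub>V\<^esub> v))"
        unfolding set_add_def' w(2) using w(1) by blast
    qed
    then show ?thesis by (simp add: Q_def p_def vs_quot_def)
  qed
  have zero: "p \<zero>\<^bsub>V\<^esub> = \<zero>\<^bsub>Q\<^esub>"
    using a_coset_add_zero[OF sub] by (simp add: Q_def p_def vs_quot_def)
  show "p \<in> LinearCombinations.module_hom class_ring V Q"
    using add smult carrier by (auto simp: LinearCombinations.module_hom_def)
  show "p v = \<zero>\<^bsub>Q\<^esub> \<longleftrightarrow> v \<in> W" if "v \<in> carrier V" for v
    using a_coset_join1[of W v] W.a_rcos_const[of v] that W.a_subgroup
    by (auto simp: Q_def p_def vs_quot_def)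
  have "Module.module class_ring Q"
  proof (rule module_criteria)
    show "cring (class_ring :: 'k ring)" using module_axioms by (simp add: Module.module_def)
    show "\<zero>\<^bsub>Q\<^esub> \<in> carrier Q" unfolding carrier zero[symmetric] by simp
    show "\<forall>v\<in>carrier Q. \<exists>neg_v\<in>carrier Q. v \<oplus>\<^bsub>Q\<^esub> neg_v = \<zero>\<^bsub>Q\<^esub>"
      unfolding carrier
    proof safe
      fix v assume v: "v \<in> carrier V"
      then show "\<exists>n\<in>p ` carrier V. p v \<oplus>\<^bsub>Q\<^esub> n = \<zero>\<^bsub>Q\<^esub>"
        by (intro bexI[of _ "p (\<ominus>\<^bsub>V\<^esub> v)"]) (auto simp: add r_neg zero)
    qed
  qed (auto simp: carrier add smult zero[symmetric] a_ac smult_add_left smult_add_right smult_smult)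
  then show "vectorspace class_ring Q"
    using vectorspace_axioms by (simp add: vectorspace_def)
qed

end

text \<open>The normal form of \<open>(E, F)\<close> for \<open>dim E \<le> dim F\<close>: \<open>E \<inter> F\<close> and \<open>F\<close> are spanned by the first \<open>d\<close> and the
  first \<open>l\<close> basis vectors, and \<open>x\<close> is the finite part of the position vector.\<close>

definition (in local_K_space) normal_form ::
    "'k \<Rightarrow> 'v set \<Rightarrow> 'v set \<Rightarrow> 'v set \<Rightarrow> (nat \<Rightarrow> 'v) \<Rightarrow> nat \<Rightarrow> nat \<Rightarrow> nat \<Rightarrow> nat \<Rightarrow> (nat \<Rightarrow> nat) \<Rightarrow> bool" where
  "normal_form p L E F b n d l m x \<longleftrightarrow>
     frame absv V L b n \<and> d + m \<le> l \<and> l + m \<le> n \<and> (\<forall>i j. i \<le> j \<longrightarrow> j < m \<longrightarrow> x i \<le> x j) \<and>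
     E \<inter> F = range (fcomb V b d) \<and> F = range (fcomb V b l) \<and>
     E = range (fcomb V (position_family (\<lambda>i. p ^ x i) b d l) (d + m))"

context local_K_space
begin

lemma absv_power_le_1: "absv p = eps absv \<Longrightarrow> absv (p ^ k) \<le> 1"
  using eps_pos eps_less_1 by (simp add: absv_power power_le_one)

lemma dim_normal_form:
  assumes "normal_form p L E F b n d l m x" "absv p = eps absv"
  shows "subspace_dim V E = d + m" "subspace_dim V F = l" "subspace_dim V (E \<inter> F) = d"
proof -
  have b: "frame absv V L b n" and lm: "d + m \<le> l" "l + m \<le> n"
    and W: "E \<inter> F = range (fcomb V b d)" and F: "F = range (fcomb V b l)"
    and E: "E = range (fcomb V (position_family (\<lambda>i. p ^ x i) b d l) (d + m))"
    using assms(1) unfolding normal_form_def by blast+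
  note bc = frame_carrier[OF b]
  have dim: "vectorspace.dim class_ring (V\<lparr>carrier := range (fcomb V e k)\<rparr>) = k"
    if e: "\<And>i. i < k \<Longrightarrow> e i \<in> carrier V"
      and fr: "frame absv (V\<lparr>carrier := range (fcomb V e k)\<rparr>) (range (fcomb V e k) \<inter> L) e k" for e k
  proof -
    interpret U: local_K_space absv "V\<lparr>carrier := range (fcomb V e k)\<rparr>"
      by (rule K_space_subspace[OF subspace_range_fcomb[OF e]])
    show ?thesis by (rule U.dim_frame[OF fr])
  qed
  show "subspace_dim V E = d + m" unfolding E
    by (rule dim[OF position_family_closed[OF bc lm]])
      (simp_all add: frame_position_family[OF b lm] absv_power_le_1[OF assms(2)])
  show "subspace_dim V F = l" "subspace_dim V (E \<inter> F) = d" unfolding W unfolding F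
    using dim[OF bc frame_prefix[OF b]] lm by simp_all
qed

text \<open>Modulo \<open>E \<inter> F\<close> the basis vectors from index \<open>d\<close> on form a normal form with trivial intersection. The
  second part covers the opposite order of the spaces, where the definition exchanges their roles.\<close>

theorem position_vector_normal_form:
  assumes nf: "normal_form p L E F b n d l m x" and p: "absv p = eps absv"
  defines "xs \<equiv> map (\<lambda>i. enat (x i)) [0..<m] @ replicate d \<infinity>"
  shows "position_vector absv V L E F = xs"
    and "subspace_dim V E < subspace_dim V F \<Longrightarrow> position_vector absv V L F E = xs"
proof -
  have b: "frame absv V L b n" and lm: "d + m \<le> l" "l + m \<le> n"
    and x: "\<And>i j. i \<le> j \<Longrightarrow> j < m \<Longrightarrow> x i \<le> x j"
    and W: "E \<inter> F = range (fcomb V b d)" and F: "F = range (fcomb V b l)"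
    and E: "E = range (fcomb V (position_family (\<lambda>i. p ^ x i) b d l) (d + m))"
    using nf unfolding normal_form_def by blast+
  note bc = frame_carrier[OF b]
  define W' where "W' = E \<inter> F"
  have subW: "VectorSpace.subspace class_ring W' V"
    unfolding W'_def W by (rule subspace_range_fcomb) (use bc lm in auto)
  define Q where "Q = vs_quot V W'"
  define \<pi> where "\<pi> = (\<lambda>v. W' +>\<^bsub>V\<^esub> v)"
  note Q = vs_quot_projection[OF subW, folded Q_def \<pi>_def]
  interpret Q: local_K_space absv Q
    using Q(1) nonarch_local_field_axioms by (simp add: local_K_space_def K_space_iff)
  define n' l' where "n' = n - d" and "l' = l - d"
  have nl: "n = d + n'" "l = d + l'" using lm by (simp_all add: n'_def l'_def)
  define q where "q = (\<lambda>i. \<pi> (b (d + i)))"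
  have \<pi>c: "\<pi> v \<in> carrier Q" if "v \<in> carrier V" for v unfolding Q(3) using that by simp
  have qc: "q i \<in> carrier Q" if "i < n'" for i unfolding q_def using bc nl that by (intro \<pi>c) auto
  have bW: "b i \<in> W'" if "i < d" for i
  proof -
    have "b i = fcomb V b d (\<lambda>j. if j = i then 1 else 0)"
      using fcomb_single[of d b i 1] bc that lm by simp
    then show ?thesis unfolding W'_def W by (rule range_eqI[of _ "fcomb V b d"])
  qed
  have proj: "\<pi> (fcomb V e (d + k) z) = fcomb Q (\<lambda>i. \<pi> (e (d + i))) k (\<lambda>i. z (d + i))"
    if e: "\<And>i. i < d + k \<Longrightarrow> e i \<in> carrier V" and eW: "\<And>i. i < d \<Longrightarrow> e i \<in> W'" for e k z
  proof -
    have "\<pi> (fcomb V e (d + k) z) = fcomb Q (\<lambda>i. \<pi> (e i)) (d + k) z"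
      using e by (rule fcomb_hom[OF vectorspace_axioms Q(1,2)])
    also have "\<dots> = fcomb Q (\<lambda>i. \<pi> (e i)) d z \<oplus>\<^bsub>Q\<^esub> fcomb Q (\<lambda>i. \<pi> (e (d + i))) k (\<lambda>i. z (d + i))"
      using e by (intro Q.fcomb_append \<pi>c)
    also have "fcomb Q (\<lambda>i. \<pi> (e i)) d z = fcomb Q (\<lambda>i. 0 \<odot>\<^bsub>Q\<^esub> \<zero>\<^bsub>Q\<^esub>) d z"
      using e eW Q(4) by (intro Q.fcomb_cong) (auto intro!: \<pi>c)
    also have "\<dots> = fcomb Q (\<lambda>i. \<zero>\<^bsub>Q\<^esub>) d (\<lambda>i. z i * 0)"
      by (rule Q.fcomb_scaled_family) simp
    also have "\<dots> = \<zero>\<^bsub>Q\<^esub>" by (intro Q.fcomb_zero) auto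
    finally show ?thesis using e \<pi>c by simp
  qed
  have range: "\<pi> ` range (fcomb V e (d + k)) = range (fcomb Q (\<lambda>i. \<pi> (e (d + i))) k)"
    if e: "\<And>i. i < d + k \<Longrightarrow> e i \<in> carrier V" and eW: "\<And>i. i < d \<Longrightarrow> e i \<in> W'" for e k
  proof (rule subset_antisym)
    show "\<pi> ` range (fcomb V e (d + k)) \<subseteq> range (fcomb Q (\<lambda>i. \<pi> (e (d + i))) k)"
      using proj[OF e eW] by auto
    show "range (fcomb Q (\<lambda>i. \<pi> (e (d + i))) k) \<subseteq> \<pi> ` range (fcomb V e (d + k))"
    proof safe
      fix y
      have "fcomb Q (\<lambda>i. \<pi> (e (d + i))) k y = \<pi> (fcomb V e (d + k) (\<lambda>j. y (j - d)))"
        by (subst proj[OF e eW]) simp_all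
      then show "fcomb Q (\<lambda>i. \<pi> (e (d + i))) k y \<in> \<pi> ` range (fcomb V e (d + k))" by blast
    qed
  qed
  \<comment> \<open>The projection drops the first \<open>d\<close> coordinates.\<close>
  have projb: "\<pi> (fcomb V b n z) = fcomb Q q n' (\<lambda>i. z (d + i))" for z
    unfolding nl q_def using bc bW nl by (intro proj) auto
  have fq: "frame absv Q (\<pi> ` L) q n'"
    unfolding frame_def
  proof (intro conjI allI impI qc)
    show "carrier Q = range (fcomb Q q n')"
      unfolding Q(3) frame_surj[OF b] unfolding nl q_def using bc bW nl by (intro range) auto
    show "y i = 0" if y: "fcomb Q q n' y = \<zero>\<^bsub>Q\<^esub>" and i: "i < n'" for y i
    proof -
      let ?z = "\<lambda>j. if j < d then 0 else y (j - d)"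
      have "\<pi> (fcomb V b n ?z) = \<zero>\<^bsub>Q\<^esub>" unfolding projb using y by simp
      then have "fcomb V b n ?z \<in> W'" using Q(4) bc by simp
      then obtain t where "fcomb V b n ?z = fcomb V b d t" unfolding W'_def W by blast
      also have "\<dots> = fcomb V b n (\<lambda>i. if i < d then t i else 0)"
        using bc lm by (intro fcomb_prefix) auto
      finally have "?z (d + i) = (\<lambda>i. if i < d then t i else 0) (d + i)"
        by (rule frame_inj[OF b]) (use i nl in simp)
      then show ?thesis by simp
    qed
    show "\<pi> ` L = fcomb Q q n' ` {x. \<forall>i<n'. absv (x i) \<le> 1}"
    proof (rule subset_antisym)
      show "\<pi> ` L \<subseteq> fcomb Q q n' ` {x. \<forall>i<n'. absv (x i) \<le> 1}"
      proof safe
        fix v assume "v \<in> L"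
        then obtain z where z: "\<forall>i<n. absv (z i) \<le> 1" "v = fcomb V b n z"
          unfolding frame_lattice[OF b] by auto
        have "\<forall>i<n'. absv (z (d + i)) \<le> 1" using z(1) nl(1) by auto
        then show "\<pi> v \<in> fcomb Q q n' ` {x. \<forall>i<n'. absv (x i) \<le> 1}"
          unfolding z(2) projb by (intro imageI) simp
      qed
      show "fcomb Q q n' ` {x. \<forall>i<n'. absv (x i) \<le> 1} \<subseteq> \<pi> ` L"
      proof safe
        fix y assume y: "\<forall>i<n'. absv (y i) \<le> 1"
        let ?z = "\<lambda>j. if j < d then 0 else y (j - d)"
        have "fcomb V b n ?z \<in> L" unfolding frame_lattice_iff[OF b] using y nl by auto
        moreover have "fcomb Q q n' y = \<pi> (fcomb V b n ?z)" unfolding projb by simp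
        ultimately show "fcomb Q q n' y \<in> \<pi> ` L" by blast
      qed
    qed
  qed
  have \<pi>F: "\<pi> ` F = range (fcomb Q q l')"
    unfolding F nl q_def using bc bW nl lm by (intro range) auto
  have \<pi>E: "\<pi> ` E = range (fcomb Q (Q.position_family (\<lambda>i. p ^ x i) q 0 l') m)"
  proof -
    let ?e = "position_family (\<lambda>i. p ^ x i) b d l"
    have ec: "?e i \<in> carrier V" if "i < d + m" for i using bc lm that by (rule position_family_closed)
    have "\<pi> ` E = range (fcomb Q (\<lambda>i. \<pi> (?e (d + i))) m)"
      unfolding E using ec bW by (intro range) (auto simp: position_family_def)
    moreover have "fcomb Q (\<lambda>i. \<pi> (?e (d + i))) m y = fcomb Q (Q.position_family (\<lambda>i. p ^ x i) q 0 l') m y" for y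
    proof (rule Q.fcomb_cong)
      fix i assume i: "i < m"
      show "\<pi> (?e (d + i)) \<in> carrier Q" using ec i by (intro \<pi>c) auto
      have "b (d + i) \<in> carrier V" "b (l + i) \<in> carrier V" using bc i lm by auto
      then show "\<pi> (?e (d + i)) = Q.position_family (\<lambda>i. p ^ x i) q 0 l' i"
        using Q(2) nl by (simp add: position_family_def Q.position_family_def q_def
            LinearCombinations.module_hom_def add.assoc)
    qed simp
    ultimately show ?thesis by presburger
  qed
  have ml': "m \<le> l'" "l' + m \<le> n'" using lm nl by auto
  have pv: "subspace_dim Q (\<pi> ` E) = m" "subspace_dim Q (\<pi> ` F) = l'"
    "position_vector_le absv Q (\<pi> ` L) (\<pi> ` E) (\<pi> ` F) = map (\<lambda>i. enat (x i)) [0..<m]"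
    using Q.position_vector_le_frame[OF fq ml' p _ \<pi>F \<pi>E] x by blast+
  have dims: "subspace_dim V E = d + m" "subspace_dim V F = l" "subspace_dim V W' = d"
    using dim_normal_form[OF nf p] by (simp_all add: W'_def)
  show "position_vector absv V L E F = xs"
    unfolding position_vector_def Let_def W'_def[symmetric] Q_def[symmetric] \<pi>_def[symmetric]
      position_vector_small_def pv dims xs_def using ml' by simp
  have FE: "F \<inter> E = W'" by (auto simp: W'_def)
  show "position_vector absv V L F E = xs" if "subspace_dim V E < subspace_dim V F"
    unfolding position_vector_def Let_def FE Q_def[symmetric] \<pi>_def[symmetric]
      position_vector_small_def pv dims xs_def using that dims nl by simp
qed

end

section \<open>Coordinates and the existence of lattice bases\<close>

context local_field_space
begin

lemma indep_scaled:
  assumes "indep b I" "\<And>i. i \<in> I \<Longrightarrow> c i \<noteq> 0"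
  shows "indep (\<lambda>i. c i *s b i) I"
  unfolding indep_def
proof (intro allI impI ballI)
  fix x i assume x: "lcomb (\<lambda>i. c i *s b i) I x = 0" and i: "i \<in> I"
  have "lcomb b I (\<lambda>i. x i * c i) = 0" using x by (simp add: lcomb_def)
  then have "x i * c i = 0" using assms(1) i unfolding indep_def by blast
  then show "x i = 0" using assms(2)[OF i] by simp
qed

lemma indep_card_eq:
  assumes "finite I" "finite J" "indep b I" "indep v J" "Ksp b I = Ksp v J"
  shows "card I = card J"
proof (rule antisym)
  show "card J \<le> card I"
    by (rule indep_card_le[OF assms(1,2,4), where b = b]) (simp add: assms(5) Ksp_base[OF assms(2)])
  show "card I \<le> card J"
    by (rule indep_card_le[OF assms(2,1,3), where b = v]) (simp add: assms(5)[symmetric] Ksp_base[OF assms(1)])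
qed

end

context local_K_space
begin

text \<open>The results on families in a type of vectors are applied to coordinate vectors, as functions on
  the natural numbers that vanish from \<open>n\<close> on. The unit vectors span this space and its standard
  lattice.\<close>

definition coord_unit :: "nat \<Rightarrow> nat \<Rightarrow> 'k" where
  "coord_unit k = (\<lambda>j. if j = k then 1 else 0)"

interpretation X: local_field_space absv "\<lambda>c (f :: nat \<Rightarrow> 'k) i. c * f i"
  by (rule local_field_space_fun[OF nonarch_local_field_axioms])

lemma lcomb_apply: "X.lcomb \<beta> {..<m} y i = (\<Sum>j<m. y j * \<beta> j i)"
  by (simp add: X.lcomb_def sum_fun_apply)

lemma lcomb_coord_unit: "X.lcomb coord_unit {..<n} y = (\<lambda>i. if i < n then y i else 0)"
  by (rule ext) (simp only: lcomb_apply coord_unit_def sum_mult_delta)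

lemma Ksp_coord_unit: "X.Ksp coord_unit {..<n} = {f. \<forall>i\<ge>n. f i = 0}"
proof (rule subset_antisym)
  show "X.Ksp coord_unit {..<n} \<subseteq> {f. \<forall>i\<ge>n. f i = 0}" by (auto simp: X.Ksp_def lcomb_coord_unit)
  show "{f. \<forall>i\<ge>n. f i = 0} \<subseteq> X.Ksp coord_unit {..<n}"
  proof
    fix f :: "nat \<Rightarrow> 'k" assume "f \<in> {f. \<forall>i\<ge>n. f i = 0}"
    then have "f = X.lcomb coord_unit {..<n} f" by (auto simp: lcomb_coord_unit)
    then show "f \<in> X.Ksp coord_unit {..<n}" 
      unfolding X.Ksp_def by (rule range_eqI[of _ "X.lcomb coord_unit {..<n}"])
  qed
qed

lemma indep_coord_unit: "X.indep coord_unit {..<n}"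
  unfolding X.indep_def lcomb_coord_unit
proof (intro allI impI ballI)
  fix x :: "nat \<Rightarrow> 'k" and i assume 0: "(\<lambda>i. if i < n then x i else 0) = 0" and i: "i \<in> {..<n}"
  from fun_cong[OF 0, of i] i show "x i = 0" by simp
qed

lemma fcomb_lcomb:
  assumes "\<And>i. i < n \<Longrightarrow> b i \<in> carrier V"
  shows "fcomb V b n (X.lcomb \<beta> {..<m} y) = fcomb V (\<lambda>j. fcomb V b n (\<beta> j)) m y"
  using fcomb_fcomb[of n b \<beta> m y] assms by (simp add: lcomb_apply cong: fcomb_cong)

lemma fcomb_Rsp_coord_unit:
  assumes "frame absv V L b n"
  shows "fcomb V b n ` X.Rsp coord_unit {..<n} = L"
proof -
  note b = frame_carrier[OF assms]
  have "fcomb V b n (X.lcomb coord_unit {..<n} y) = fcomb V b n y" for y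
    using b by (intro fcomb_cong) (auto simp: lcomb_coord_unit)
  then show ?thesis unfolding X.Rsp_def frame_lattice[OF assms] image_image by (simp add: Ball_def)
qed

text \<open>Coordinates with respect to a frame translate every lattice basis of the coordinate space into a
  frame.\<close>

lemma frame_from_coordinates:
  assumes b: "frame absv V L b n" and \<beta>: "X.indep \<beta> {..<m}" "X.Ksp \<beta> {..<m} = X.Ksp coord_unit {..<n}"
  shows "frame absv V (fcomb V b n ` X.Rsp \<beta> {..<m}) (\<lambda>j. fcomb V b n (\<beta> j)) m"
proof -
  note bc = frame_carrier[OF b]
  have c: "fcomb V b n (\<beta> j) \<in> carrier V" for j using bc by simp
  have comb: "fcomb V b n (X.lcomb \<beta> {..<m} y) = fcomb V (\<lambda>j. fcomb V b n (\<beta> j)) m y" for y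
    by (rule fcomb_lcomb[OF bc])
  show ?thesis unfolding frame_def
  proof (intro conjI allI impI)
    show "carrier V = range (fcomb V (\<lambda>j. fcomb V b n (\<beta> j)) m)"
    proof (rule subset_antisym)
      show "carrier V \<subseteq> range (fcomb V (\<lambda>j. fcomb V b n (\<beta> j)) m)"
      proof
        fix v assume "v \<in> carrier V"
        then obtain z where z: "v = fcomb V b n z" unfolding frame_surj[OF b] by blast
        have "(\<lambda>i. if i < n then z i else 0) \<in> X.Ksp \<beta> {..<m}" unfolding \<beta>(2) Ksp_coord_unit by simp
        then obtain y where y: "(\<lambda>i. if i < n then z i else 0) = X.lcomb \<beta> {..<m} y"
          by (auto simp: X.Ksp_def)
        have "v = fcomb V b n (\<lambda>i. if i < n then z i else 0)"
          unfolding z using bc by (intro fcomb_cong) auto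
        then have "v = fcomb V (\<lambda>j. fcomb V b n (\<beta> j)) m y" unfolding y comb .
        then show "v \<in> range (fcomb V (\<lambda>j. fcomb V b n (\<beta> j)) m)" by blast
      qed
    qed (use c in auto)
    show "y j = 0" if y: "fcomb V (\<lambda>j. fcomb V b n (\<beta> j)) m y = \<zero>\<^bsub>V\<^esub>" and j: "j < m" for y j
    proof -
      have "X.lcomb \<beta> {..<m} y \<in> X.Ksp coord_unit {..<n}" unfolding \<beta>(2)[symmetric] by (simp add: X.Ksp_def)
      then have "X.lcomb \<beta> {..<m} y i = 0" if "i \<ge> n" for i using that by (simp add: Ksp_coord_unit)
      moreover have "X.lcomb \<beta> {..<m} y i = 0" if "i < n" for i
        using frame_indep[OF b _ that, of "X.lcomb \<beta> {..<m} y"] y unfolding comb by blast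
      ultimately have "X.lcomb \<beta> {..<m} y = 0" unfolding fun_eq_iff zero_fun_def by (meson not_le)
      then show "y j = 0" using \<beta>(1) j unfolding X.indep_def by blast
    qed
    show "fcomb V b n ` X.Rsp \<beta> {..<m} =
        fcomb V (\<lambda>j. fcomb V b n (\<beta> j)) m ` {x. \<forall>i<m. absv (x i) \<le> 1}"
      unfolding X.Rsp_def image_image comb by (simp add: Ball_def)
  qed (rule c)
qed

lemma K_basis_exists:
  assumes "fin_dim"
  shows "\<exists>b n L. frame absv V L b n"
proof -
  obtain B where B: "finite B" "basis B" using finite_basis_exists[OF assms] by blast
  obtain bs where bs: "set bs = B" "distinct bs" using finite_distinct_list[OF B(1)] by blast
  have sub: "set bs \<subseteq> carrier V" and ind: "lin_indpt (set bs)" and gen: "gen_set (set bs)"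
    using B(2) bs(1) by (auto simp: basis_def)
  have c: "bs ! i \<in> carrier V" if "i < length bs" for i using sub that by auto
  have "carrier V = range (fcomb V (nth bs) (length bs))"
    using gen unfolding span_list[OF module_axioms bs(2) sub] by simp
  moreover have "\<forall>x. fcomb V (nth bs) (length bs) x = \<zero>\<^bsub>V\<^esub> \<longrightarrow> (\<forall>i<length bs. x i = 0)"
    using ind lin_indpt_list[OF module_axioms _ bs(2) sub] by simp
  ultimately have "frame absv V (fcomb V (nth bs) (length bs) ` {x. \<forall>i<length bs. absv (x i) \<le> 1}) (nth bs) (length bs)"
    unfolding frame_def using c by blast
  then show ?thesis by blast
qed

text \<open>Finitely generated torsion-free modules over \<open>R\<close> are free: take coordinates of the generators of \<open>L\<close>
  with respect to any \<open>K\<close>-basis of \<open>V\<close>. In a stacked basis all elementary divisors are nonzero, because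
  \<open>L\<close> spans \<open>V\<close>, and their multiples of the basis vectors form an \<open>R\<close>-basis of \<open>L\<close>.\<close>

theorem lattice_frame_exists:
  assumes "fin_dim" and L: "linear_R_structure absv V L"
  shows "\<exists>b n. frame absv V L b n"
proof -
  obtain b n L0 where b: "frame absv V L0 b n" using K_basis_exists[OF assms(1)] by blast
  note bc = frame_carrier[OF b]
  obtain S where S: "finite S" "S \<subseteq> carrier V" "L = LinearCombinations.module.span (val_ring absv) V S"
    and spanL: "span L = carrier V"
    using L unfolding linear_R_structure_def by blast
  obtain ss where ss: "set ss = S" "distinct ss" using finite_distinct_list[OF S(1)] by blast
  define m where "m = length ss"
  have ssc: "ss ! j \<in> carrier V" if "j < m" for j using S(2) ss(1) that by (auto simp: m_def)
  have mod: "Module.module (val_ring absv) V" by (rule module_val_ring[OF vectorspace_axioms])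
  have Lss: "L = fcomb V (nth ss) m ` {x. \<forall>i<m. absv (x i) \<le> 1}"
    using span_list[OF mod ss(2)] S(2,3) ss(1) by (simp add: m_def val_ring_def)
  have "\<forall>j<m. \<exists>f. (\<forall>i\<ge>n. f i = 0) \<and> ss ! j = fcomb V b n f"
  proof (intro allI impI)
    fix j assume "j < m"
    then obtain z where z: "ss ! j = fcomb V b n z" using ssc frame_surj[OF b] by blast
    have "ss ! j = fcomb V b n (\<lambda>i. if i < n then z i else 0)"
      unfolding z using bc by (intro fcomb_cong) auto
    then show "\<exists>f. (\<forall>i\<ge>n. f i = 0) \<and> ss ! j = fcomb V b n f"
      by (intro exI[of _ "\<lambda>i. if i < n then z i else 0"]) simp
  qed
  then obtain v where v: "\<And>j. j < m \<Longrightarrow> v j \<in> X.Ksp coord_unit {..<n}"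
    and vss: "\<And>j. j < m \<Longrightarrow> ss ! j = fcomb V b n (v j)"
    unfolding Ksp_coord_unit mem_Collect_eq by metis
  have comb: "fcomb V b n (X.lcomb v {..<m} y) = fcomb V (nth ss) m y" for y
  proof -
    have "fcomb V b n (X.lcomb v {..<m} y) = fcomb V (\<lambda>j. fcomb V b n (v j)) m y"
      by (rule fcomb_lcomb[OF bc])
    also have "\<dots> = fcomb V (nth ss) m y" using bc by (intro fcomb_cong) (auto simp: vss)
    finally show ?thesis .
  qed
  have Lv: "L = fcomb V b n ` X.Rsp v {..<m}"
    unfolding X.Rsp_def image_image comb Lss by (simp add: Ball_def)
  have Kv: "X.Ksp v {..<m} = X.Ksp coord_unit {..<n}"
  proof (rule subset_antisym)
    show "X.Ksp v {..<m} \<subseteq> X.Ksp coord_unit {..<n}"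
      by (rule X.Ksp_subset[OF X.subspace_Ksp]) (simp add: v)
    show "X.Ksp coord_unit {..<n} \<subseteq> X.Ksp v {..<m}"
    proof
      fix f assume f: "f \<in> X.Ksp coord_unit {..<n}"
      have "span L \<subseteq> range (fcomb V (nth ss) m)"
        by (rule span_is_subset[OF _ submodule_range_fcomb]) (use ssc in \<open>auto simp: Lss\<close>)
      then have "fcomb V b n f \<in> range (fcomb V (nth ss) m)" using spanL bc by auto
      then obtain y where y: "fcomb V b n f = fcomb V b n (X.lcomb v {..<m} y)" unfolding comb by blast
      have "X.lcomb v {..<m} y \<in> X.Ksp coord_unit {..<n}"
        by (rule X.lcomb_in_subspace[OF X.subspace_Ksp]) (simp add: v)
      then have "f i = X.lcomb v {..<m} y i" for i
        using f frame_inj[OF b y, of i] by (cases "i < n") (auto simp: Ksp_coord_unit)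
      then have "f = X.lcomb v {..<m} y" by (rule ext)
      then show "f \<in> X.Ksp v {..<m}" by (simp add: X.Ksp_def)
    qed
  qed
  have "\<exists>b' c I'. I' \<subseteq> {..<n} \<and> X.indep b' {..<n} \<and> X.Rsp b' {..<n} = X.Rsp coord_unit {..<n} \<and>
      (\<forall>i\<in>I'. c i \<noteq> 0) \<and> X.Rsp v {..<m} = X.Rsp (\<lambda>i k. c i * b' i k) I'"
    by (rule X.stacked_bases[OF finite_lessThan finite_lessThan indep_coord_unit]) (simp add: v)
  then obtain b' c I' where I': "I' \<subseteq> {..<n}" and b': "X.indep b' {..<n}"
    "X.Rsp b' {..<n} = X.Rsp coord_unit {..<n}" and c: "\<forall>i\<in>I'. c i \<noteq> 0"
    and R: "X.Rsp v {..<m} = X.Rsp (\<lambda>i k. c i * b' i k) I'"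
    by (elim exE conjE) (rule that)
  have finI': "finite I'" using I' finite_subset by blast
  have KI': "X.Ksp (\<lambda>i k. c i * b' i k) I' = X.Ksp coord_unit {..<n}"
    using X.Ksp_eq_if_Rsp_eq[OF _ finI' R] Kv by simp
  have "X.indep (\<lambda>i k. c i * b' i k) I'"
    by (rule X.indep_scaled[OF X.indep_mono[OF _ b'(1) I']]) (use c in auto)
  then have "card I' = card {..<n}"
    by (rule X.indep_card_eq[OF finI' finite_lessThan _ indep_coord_unit KI'])
  then have I'n: "I' = {..<n}" using I' by (intro card_subset_eq) auto
  define \<beta> where "\<beta> = (\<lambda>i k. c i * b' i k)"
  have "X.indep \<beta> {..<n}" unfolding \<beta>_def by (rule X.indep_scaled[OF b'(1)]) (use c I'n in auto)
  moreover have "X.Ksp \<beta> {..<n} = X.Ksp coord_unit {..<n}" using KI' unfolding \<beta>_def I'n .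
  ultimately have "frame absv V (fcomb V b n ` X.Rsp \<beta> {..<n}) (\<lambda>j. fcomb V b n (\<beta> j)) n"
    by (rule frame_from_coordinates[OF b])
  moreover have "fcomb V b n ` X.Rsp \<beta> {..<n} = L" unfolding Lv R I'n \<beta>_def ..
  ultimately show ?thesis by metis
qed

end

section \<open>The normal form and the action of GL\<close>

context local_K_space
begin

interpretation X: local_field_space absv "\<lambda>c (f :: nat \<Rightarrow> 'k) i. c * f i"
  by (rule local_field_space_fun[OF nonarch_local_field_axioms])

definition coords :: "(nat \<Rightarrow> 'v) \<Rightarrow> nat \<Rightarrow> 'v set \<Rightarrow> (nat \<Rightarrow> 'k) set" where
  "coords b n U = {f. (\<forall>i\<ge>n. f i = 0) \<and> fcomb V b n f \<in> U}"

lemma subspace_coords: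
  assumes "frame absv V L b n" "VectorSpace.subspace class_ring U V"
  shows "X.subspace (coords b n U)"
proof -
  note bc = frame_carrier[OF assms(1)]
  interpret U: submodule class_ring U V using assms(2) by (simp add: VectorSpace.subspace_def)
  show ?thesis
  proof (rule X.subspaceI)
    show "0 \<in> coords b n U" using fcomb_zero[of n b 0] bc by (simp add: coords_def)
    show "f + g \<in> coords b n U" if "f \<in> coords b n U" "g \<in> coords b n U" for f g
      using that U.m_closed[of "fcomb V b n f" "fcomb V b n g"] fcomb_add[of n b f g] bc
      by (simp add: coords_def plus_fun_def)
    show "(\<lambda>i. c * f i) \<in> coords b n U" if "f \<in> coords b n U" for c f
      using that U.smult_closed[of c "fcomb V b n f"] fcomb_smult[of n b c f] bc
      by (simp add: coords_def)
  qed
qed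

lemma fcomb_coords:
  assumes "frame absv V L b n" "U \<subseteq> carrier V"
  shows "fcomb V b n ` coords b n U = U"
proof (rule subset_antisym)
  show "U \<subseteq> fcomb V b n ` coords b n U"
  proof
    fix v assume v: "v \<in> U"
    then obtain z where z: "v = fcomb V b n z" using assms frame_surj[OF assms(1)] by blast
    have "v = fcomb V b n (\<lambda>i. if i < n then z i else 0)"
      unfolding z using frame_carrier[OF assms(1)] by (intro fcomb_cong) auto
    moreover from this v have "(\<lambda>i. if i < n then z i else 0) \<in> coords b n U" by (simp add: coords_def)
    ultimately show "v \<in> fcomb V b n ` coords b n U" by (rule image_eqI)
  qed
qed (auto simp: coords_def)

lemma fcomb_Ksp:
  assumes "\<And>i. i < n \<Longrightarrow> b i \<in> carrier V"
  shows "fcomb V b n ` X.Ksp \<beta> {..<k} = range (fcomb V (\<lambda>j. fcomb V b n (\<beta> j)) k)"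
proof -
  have "fcomb V b n (X.lcomb \<beta> {..<k} y) = fcomb V (\<lambda>j. fcomb V b n (\<beta> j)) k y" for y
    using assms by (rule fcomb_lcomb)
  then show ?thesis unfolding X.Ksp_def image_image by simp
qed

text \<open>Besides transporting the normal form from coordinate vectors to \<open>V\<close>, this records that \<open>l\<close> is the
  dimension of the coordinate space of \<open>F\<close>, in order to compare the two notions of dimension.\<close>

theorem normal_form_exists_coords:
  assumes b: "frame absv V L b n"
    and E: "VectorSpace.subspace class_ring E V" and F: "VectorSpace.subspace class_ring F V"
    and dim: "X.dim (coords b n E) \<le> X.dim (coords b n F)" and p: "absv p = eps absv"
  shows "\<exists>b' d l m x. normal_form p L E F b' n d l m x \<and> l = X.dim (coords b n F)"
proof -
  note bc = frame_carrier[OF b]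
  have sub: "E \<subseteq> carrier V" "F \<subseteq> carrier V" "E \<inter> F \<subseteq> carrier V"
    using E F by (auto simp: VectorSpace.subspace_def submodule_def)
  let ?E = "coords b n E" and ?F = "coords b n F"
  have cK: "coords b n U \<subseteq> X.Ksp coord_unit {..<n}" for U
    unfolding Ksp_coord_unit by (auto simp: coords_def)
  have "\<exists>(\<beta> :: nat \<Rightarrow> nat \<Rightarrow> 'k) d l m n' x. X.indep \<beta> {..<n'} \<and> X.Rsp \<beta> {..<n'} = X.Rsp coord_unit {..<n} \<and>
    d + m \<le> l \<and> l + m \<le> n' \<and> ?E \<inter> ?F = X.Ksp \<beta> {..<d} \<and> ?F = X.Ksp \<beta> {..<l} \<and>
    ?E = X.Ksp (\<lambda>i. if i < d then \<beta> i else \<beta> i + (\<lambda>k. p ^ x (i - d) * \<beta> (l + (i - d)) k)) {..<d + m} \<and>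
    (\<forall>i j. i \<le> j \<longrightarrow> j < m \<longrightarrow> x i \<le> (x j :: nat))"
    by (rule X.relative_position_normal_form[OF finite_lessThan indep_coord_unit
          subspace_coords[OF b E] cK subspace_coords[OF b F] cK dim p])
  then obtain \<beta> :: "nat \<Rightarrow> nat \<Rightarrow> 'k" and d l m n' x where ind: "X.indep \<beta> {..<n'}"
    and R: "X.Rsp \<beta> {..<n'} = X.Rsp coord_unit {..<n}" and lm: "d + m \<le> l" "l + m \<le> n'"
    and W: "?E \<inter> ?F = X.Ksp \<beta> {..<d}" and F': "?F = X.Ksp \<beta> {..<l}"
    and E': "?E = X.Ksp (\<lambda>i. if i < d then \<beta> i else \<beta> i + (\<lambda>k. p ^ x (i - d) * \<beta> (l + (i - d)) k)) {..<d + m}"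
    and x: "\<forall>i j. i \<le> j \<longrightarrow> j < m \<longrightarrow> x i \<le> (x j :: nat)"
    by (elim exE conjE) (rule that)
  have K: "X.Ksp \<beta> {..<n'} = X.Ksp coord_unit {..<n}"
    by (rule X.Ksp_eq_if_Rsp_eq[OF finite_lessThan finite_lessThan R])
  have "card {..<n'} = card {..<n}"
    by (rule X.indep_card_eq[OF finite_lessThan finite_lessThan ind indep_coord_unit K])
  then have n': "n' = n" by simp
  define b' where "b' = (\<lambda>j. fcomb V b n (\<beta> j))"
  have "frame absv V (fcomb V b n ` X.Rsp \<beta> {..<n'}) b' n'"
    unfolding b'_def by (rule frame_from_coordinates[OF b ind K])
  then have fb': "frame absv V L b' n" using fcomb_Rsp_coord_unit[OF b] R n' by simp
  let ?e = "\<lambda>i. if i < d then \<beta> i else \<beta> i + (\<lambda>k. p ^ x (i - d) * \<beta> (l + (i - d)) k)"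
  have sum: "fcomb V b n (\<beta> i + (\<lambda>k. c * \<beta> j k)) = b' i \<oplus>\<^bsub>V\<^esub> c \<odot>\<^bsub>V\<^esub> b' j" for i j c
    using fcomb_add[of n b "\<beta> i" "\<lambda>k. c * \<beta> j k", OF bc] fcomb_smult[of n b c "\<beta> j", OF bc]
    by (simp add: b'_def plus_fun_def)
  have e: "fcomb V b n (?e i) = position_family (\<lambda>i. p ^ x i) b' d l i" for i
    using sum[of i "p ^ x (i - d)" "l + (i - d)"] by (cases "i < d") (simp_all add: b'_def position_family_def)
  have "normal_form p L E F b' n d l m x"
    unfolding normal_form_def
  proof (intro conjI fb' lm(1) x)
    show "l + m \<le> n" using lm(2) n' by simp
    have "coords b n (E \<inter> F) = ?E \<inter> ?F" by (auto simp: coords_def)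
    then show "E \<inter> F = range (fcomb V b' d)"
      using fcomb_coords[OF b sub(3)] W fcomb_Ksp[of n b \<beta> d, OF bc] by (simp add: b'_def)
    show "F = range (fcomb V b' l)"
      using fcomb_coords[OF b sub(2)] F' fcomb_Ksp[of n b \<beta> l, OF bc] by (simp add: b'_def)
    have "E = range (fcomb V (\<lambda>j. fcomb V b n (?e j)) (d + m))"
      using fcomb_coords[OF b sub(1)] E' fcomb_Ksp[of n b ?e "d + m", OF bc] by simp
    then show "E = range (fcomb V (position_family (\<lambda>i. p ^ x i) b' d l) (d + m))"
      unfolding e .
  qed
  moreover have "l = X.dim ?F"
    unfolding F' using X.dim_Ksp[of "{..<l}" \<beta>] X.indep_mono[OF finite_lessThan ind, of "{..<l}"] lm by simp
  ultimately show ?thesis by blast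
qed

theorem normal_form_exists:
  assumes b: "frame absv V L b n"
    and E: "VectorSpace.subspace class_ring E V" and F: "VectorSpace.subspace class_ring F V"
    and dim: "subspace_dim V E \<le> subspace_dim V F" and p: "absv p = eps absv"
  shows "\<exists>b' d l m x. normal_form p L E F b' n d l m x"
proof -
  \<comment> \<open>In a normal form of the pair \<open>(U, U)\<close>, both dimensions are equal to \<open>l\<close>.\<close>
  have "subspace_dim V U = X.dim (coords b n U)" if U: "VectorSpace.subspace class_ring U V" for U
  proof -
    obtain b' d l m x where "normal_form p L U U b' n d l m x" "l = X.dim (coords b n U)"
      using normal_form_exists_coords[OF b U U order_refl p] by blast
    then show ?thesis using dim_normal_form(2)[OF _ p] by metis
  qed
  then show ?thesis using normal_form_exists_coords[OF b E F _ p] dim E F by metis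
qed

lemma GL_latticeD:
  assumes "g \<in> GL_lattice V L"
  shows "g \<in> LinearCombinations.module_hom class_ring V V" "bij_betw g (carrier V) (carrier V)" "g ` L = L"
  using assms by (auto simp: GL_lattice_def linear_map_def mod_hom_def mod_hom_axioms_def)

lemma image_range_fcomb:
  assumes g: "g \<in> LinearCombinations.module_hom class_ring V V" and e: "\<And>i. i < k \<Longrightarrow> e i \<in> carrier V"
    and c: "\<And>i. i < k \<Longrightarrow> g (e i) = e' i"
  shows "g ` range (fcomb V e k) = range (fcomb V e' k)"
proof -
  have gc: "g v \<in> carrier V" if "v \<in> carrier V" for v
    using g that by (auto simp: LinearCombinations.module_hom_def)
  have "g (fcomb V e k y) = fcomb V e' k y" for y
  proof -
    have "g (fcomb V e k y) = fcomb V (\<lambda>i. g (e i)) k y"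
      using e by (rule fcomb_hom[OF vectorspace_axioms vectorspace_axioms g])
    also have "\<dots> = fcomb V e' k y" by (intro fcomb_cong gc e c refl)
    finally show ?thesis .
  qed
  then show ?thesis by (auto simp: image_image)
qed

lemma image_position_family:
  assumes g: "g \<in> LinearCombinations.module_hom class_ring V V"
    and b: "\<And>i. i < n \<Longrightarrow> b i \<in> carrier V" and lm: "d + m \<le> l" "l + m \<le> n" and i: "i < d + m"
    and b': "\<And>i. i < n \<Longrightarrow> g (b i) = b' i"
  shows "g (position_family c b d l i) = position_family c b' d l i"
proof -
  have 1: "b i \<in> carrier V" "g (b i) = b' i" using b b' i lm by auto
  show ?thesis
  proof (cases "i < d")
    case False
    then have 2: "b (l + (i - d)) \<in> carrier V" "g (b (l + (i - d))) = b' (l + (i - d))"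
      using b b' i lm by auto
    show ?thesis using 1 2 g False by (simp add: position_family_def LinearCombinations.module_hom_def)
  qed (simp add: position_family_def 1)
qed

lemma normal_form_image:
  assumes g: "g \<in> LinearCombinations.module_hom class_ring V V" and nf: "normal_form p L E F b n d l m x"
    and b': "\<And>i. i < n \<Longrightarrow> g (b i) = b' i"
  shows "g ` E = range (fcomb V (position_family (\<lambda>i. p ^ x i) b' d l) (d + m))"
    "g ` F = range (fcomb V b' l)" "g ` (E \<inter> F) = range (fcomb V b' d)"
proof -
  have b: "frame absv V L b n" and lm: "d + m \<le> l" "l + m \<le> n"
    and W: "E \<inter> F = range (fcomb V b d)" and F: "F = range (fcomb V b l)"
    and E: "E = range (fcomb V (position_family (\<lambda>i. p ^ x i) b d l) (d + m))"
    using nf unfolding normal_form_def by blast+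
  note bc = frame_carrier[OF b]
  show "g ` E = range (fcomb V (position_family (\<lambda>i. p ^ x i) b' d l) (d + m))"
    unfolding E by (rule image_range_fcomb[OF g position_family_closed[OF bc lm] image_position_family[OF g bc lm _ b']])
  show "g ` F = range (fcomb V b' l)"
    unfolding F by (rule image_range_fcomb[OF g]) (use bc b' lm in auto)
  show "g ` (E \<inter> F) = range (fcomb V b' d)"
    unfolding W by (rule image_range_fcomb[OF g]) (use bc b' lm in auto)
qed

lemma frame_image:
  assumes g: "g \<in> GL_lattice V L" and b: "frame absv V L b n"
  shows "frame absv V L (\<lambda>i. g (b i)) n"
proof -
  note G = GL_latticeD[OF g] and bc = frame_carrier[OF b]
  have gc: "g v \<in> carrier V" if "v \<in> carrier V" for v
    using G(1) that by (auto simp: LinearCombinations.module_hom_def)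
  have comb: "fcomb V (\<lambda>i. g (b i)) n y = g (fcomb V b n y)" for y
    by (rule fcomb_hom[OF vectorspace_axioms vectorspace_axioms G(1) bc, symmetric])
  have "g \<zero>\<^bsub>V\<^esub> = g (0 \<odot>\<^bsub>V\<^esub> \<zero>\<^bsub>V\<^esub>)" by simp
  also have "\<dots> = 0 \<odot>\<^bsub>V\<^esub> g \<zero>\<^bsub>V\<^esub>" by (rule LinearCombinations.module_hom_smult[OF G(1)]) simp_all
  finally have g0: "g \<zero>\<^bsub>V\<^esub> = \<zero>\<^bsub>V\<^esub>" using gc[of "\<zero>\<^bsub>V\<^esub>"] by simp
  show ?thesis unfolding frame_def
  proof (intro conjI allI impI)
    show "g (b i) \<in> carrier V" if "i < n" for i using gc bc that by blast
    have "carrier V = g ` range (fcomb V b n)"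
      using G(2) frame_surj[OF b] by (simp add: bij_betw_def)
    then show "carrier V = range (fcomb V (\<lambda>i. g (b i)) n)" by (simp add: comb image_image)
    show "y i = 0" if y: "fcomb V (\<lambda>i. g (b i)) n y = \<zero>\<^bsub>V\<^esub>" and i: "i < n" for y i
    proof -
      have "g (fcomb V b n y) = g \<zero>\<^bsub>V\<^esub>" using y g0 by (simp add: comb)
      then have "fcomb V b n y = \<zero>\<^bsub>V\<^esub>"
        by (rule inj_onD[OF bij_betw_imp_inj_on[OF G(2)]]) (simp_all add: bc)
      then show ?thesis using frame_indep[OF b _ i] by blast
    qed
    have "L = g ` fcomb V b n ` {x. \<forall>i<n. absv (x i) \<le> 1}" using G(3) frame_lattice[OF b] by simp
    then show "L = fcomb V (\<lambda>i. g (b i)) n ` {x. \<forall>i<n. absv (x i) \<le> 1}" by (simp add: comb image_image)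
  qed
qed

text \<open>The map with the same coordinates with respect to the other basis.\<close>

lemma GL_lattice_frame_change:
  assumes b: "frame absv V L b n" and b': "frame absv V L b' n"
  shows "\<exists>g\<in>GL_lattice V L. \<forall>i<n. g (b i) = b' i"
proof -
  note bc = frame_carrier[OF b] and bc' = frame_carrier[OF b']
  define g where "g = (\<lambda>v. fcomb V b' n (SOME y. v = fcomb V b n y))"
  have gf: "g (fcomb V b n y) = fcomb V b' n y" for y
  proof -
    have eq: "fcomb V b n y = fcomb V b n (SOME z. fcomb V b n y = fcomb V b n z)"
      by (rule someI[of "\<lambda>z. fcomb V b n y = fcomb V b n z" y]) (rule refl)
    show ?thesis unfolding g_def
    proof (rule fcomb_cong[OF bc'])
      show "(SOME z. fcomb V b n y = fcomb V b n z) i = y i" if "i < n" for i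
        using frame_inj[OF b eq that] by simp
    qed simp_all
  qed
  have car: "carrier V = range (fcomb V b n)" "carrier V = range (fcomb V b' n)"
    by (rule frame_surj[OF b] frame_surj[OF b'])+
  have hom: "g \<in> LinearCombinations.module_hom class_ring V V"
    unfolding LinearCombinations.module_hom_def
  proof (intro CollectI conjI allI impI Pi_I)
    show "g v \<in> carrier V" if "v \<in> carrier V" for v using bc' by (simp add: g_def)
    show "g (u \<oplus>\<^bsub>V\<^esub> v) = g u \<oplus>\<^bsub>V\<^esub> g v" if uv: "u \<in> carrier V \<and> v \<in> carrier V" for u v
    proof -
      obtain y z where "u = fcomb V b n y" "v = fcomb V b n z" using uv unfolding car(1) by blast
      then show ?thesis using bc bc' by (simp add: fcomb_add gf)
    qed
    show "g (c \<odot>\<^bsub>V\<^esub> v) = c \<odot>\<^bsub>V\<^esub> g v" if cv: "c \<in> carrier class_ring \<and> v \<in> carrier V" for c v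
    proof -
      obtain y where "v = fcomb V b n y" using cv unfolding car(1) by blast
      then show ?thesis using bc bc' by (simp add: fcomb_smult gf)
    qed
  qed
  have "bij_betw g (carrier V) (carrier V)"
  proof (rule bij_betw_imageI)
    show "inj_on g (carrier V)"
    proof (rule inj_onI)
      fix u v assume "u \<in> carrier V" "v \<in> carrier V" and eq: "g u = g v"
      then obtain y z where yz: "u = fcomb V b n y" "v = fcomb V b n z" unfolding car(1) by blast
      have "fcomb V b' n y = fcomb V b' n z" using eq by (simp add: yz gf)
      then show "u = v" unfolding yz using frame_inj[OF b'] bc by (intro fcomb_cong) auto
    qed
    show "g ` carrier V = carrier V" by (subst car(1), subst car(2)) (simp add: image_image gf)
  qed
  moreover have "g ` L = L"
  proof -
    have "g ` L = g ` fcomb V b n ` {x. \<forall>i<n. absv (x i) \<le> 1}" using frame_lattice[OF b] by simp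
    also have "\<dots> = fcomb V b' n ` {x. \<forall>i<n. absv (x i) \<le> 1}" by (simp add: image_image gf)
    also have "\<dots> = L" using frame_lattice[OF b'] by simp
    finally show ?thesis .
  qed
  moreover have "linear_map class_ring V V g"
    using hom vectorspace_axioms module_axioms
    by (simp add: linear_map_def mod_hom_def mod_hom_axioms_def)
  ultimately have "g \<in> GL_lattice V L" by (simp add: GL_lattice_def)
  moreover have "\<forall>i<n. g (b i) = b' i"
  proof (intro allI impI)
    fix i assume i: "i < n"
    show "g (b i) = b' i"
      using gf[of "\<lambda>j. if j = i then 1 else 0"] fcomb_single[of n b i 1] fcomb_single[of n b' i 1] bc bc' i
      by simp
  qed
  ultimately show ?thesis by blast
qed

text \<open>An element of \<open>GL\<close> carries a normal form to one with the same exponents, and the position vector is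
  read off from the exponents. Conversely, equal exponents make the element of \<open>GL\<close> that carries
  one basis to the other carry one pair of subspaces to the other. The exponents are finite, so \<open>d\<close> is
  the number of infinite entries.\<close>

theorem normal_form_GL_iff:
  assumes nf: "normal_form p L E F b n d l m x" and nf': "normal_form p L E' F' b' n d' l m' x'"
    and p: "absv p = eps absv"
  shows "(\<exists>g\<in>GL_lattice V L. g ` E = E' \<and> g ` F = F') \<longleftrightarrow>
    map (\<lambda>i. enat (x i)) [0..<m] @ replicate d \<infinity> = map (\<lambda>i. enat (x' i)) [0..<m'] @ replicate d' \<infinity>"
    (is "?L \<longleftrightarrow> ?R")
proof
  assume ?L
  then obtain g where g: "g \<in> GL_lattice V L" "g ` E = E'" "g ` F = F'" by blast
  note G = GL_latticeD[OF g(1)]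
  have b: "frame absv V L b n" and lm: "d + m \<le> l" "l + m \<le> n"
    and x: "\<forall>i j. i \<le> j \<longrightarrow> j < m \<longrightarrow> x i \<le> x j"
    and W: "E \<inter> F = range (fcomb V b d)" and F: "F = range (fcomb V b l)"
    and E: "E = range (fcomb V (position_family (\<lambda>i. p ^ x i) b d l) (d + m))"
    using nf unfolding normal_form_def by blast+
  note bc = frame_carrier[OF b]
  have sub: "E \<subseteq> carrier V" "F \<subseteq> carrier V"
    unfolding E F using bc lm position_family_closed[OF bc lm] by auto
  have "E' \<inter> F' = g ` (E \<inter> F)"
    unfolding g(2,3)[symmetric] using G(2) sub by (intro inj_on_image_Int[symmetric]) (auto simp: bij_betw_def)
  then have "normal_form p L E' F' (\<lambda>i. g (b i)) n d l m x"
    using normal_form_image[OF G(1) nf refl] frame_image[OF g(1) b] lm x g(2,3)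
    unfolding normal_form_def by simp
  from position_vector_normal_form(1)[OF this p] position_vector_normal_form(1)[OF nf' p]
  show ?R by simp
next
  assume eq: ?R
  have cnt: "length (filter (\<lambda>z. z = \<infinity>) (map (\<lambda>i. enat (y i)) ks @ replicate e \<infinity>)) = e" for y ks e
    by (simp add: filter_map o_def)
  have dd: "d = d'" using cnt[of x "[0..<m]" d] cnt[of x' "[0..<m']" d'] eq by simp
  then have maps: "map (\<lambda>i. enat (x i)) [0..<m] = map (\<lambda>i. enat (x' i)) [0..<m']" using eq by simp
  then have mm: "m = m'" by (metis length_map length_upt diff_zero)
  have xx: "x i = x' i" if "i < m" for i using arg_cong[OF maps, of "\<lambda>l. l ! i"] that mm by simp
  have b: "frame absv V L b n" and b': "frame absv V L b' n"
    using nf nf' unfolding normal_form_def by blast+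
  obtain g where g: "g \<in> GL_lattice V L" "\<And>i. i < n \<Longrightarrow> g (b i) = b' i"
    using GL_lattice_frame_change[OF b b'] by blast
  note im = normal_form_image[OF GL_latticeD(1)[OF g(1)] nf g(2)]
  have "g ` F = F'" using im(2) nf' unfolding normal_form_def by simp
  moreover have "g ` E = E'"
  proof -
    have lm: "d + m \<le> l" "l + m \<le> n" using nf unfolding normal_form_def by blast+
    have "fcomb V (position_family (\<lambda>i. p ^ x i) b' d l) (d + m) y =
        fcomb V (position_family (\<lambda>i. p ^ x' i) b' d l) (d + m) y" for y
    proof (rule fcomb_cong)
      fix i assume i: "i < d + m"
      show "position_family (\<lambda>i. p ^ x i) b' d l i \<in> carrier V"
        using frame_carrier[OF b'] lm i by (rule position_family_closed)
      show "position_family (\<lambda>i. p ^ x i) b' d l i = position_family (\<lambda>i. p ^ x' i) b' d l i"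
        using xx i by (simp add: position_family_def)
    qed simp
    then show ?thesis using im(1) nf' dd mm unfolding normal_form_def by simp
  qed
  ultimately show ?L using g(1) by blast
qed

end

theorem corollary4p2p7:
  fixes absv :: "'k::field_char_0 \<Rightarrow> real"
    and V :: "('k, 'v) module"
    and V\<^sub>R E F E' F' :: "'v set"
    and n k l :: nat
  assumes "nonarch_local_field absv"
    and "vectorspace class_ring V"
    and "vectorspace.fin_dim class_ring V"
    and "vectorspace.dim class_ring V = n"
    and "linear_R_structure absv V V\<^sub>R"
    and "VectorSpace.subspace class_ring E V" and "subspace_dim V E = k"
    and "VectorSpace.subspace class_ring E' V" and "subspace_dim V E' = k"
    and "VectorSpace.subspace class_ring F V" and "subspace_dim V F = l"
    and "VectorSpace.subspace class_ring F' V" and "subspace_dim V F' = l"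
  shows "(\<exists>g \<in> GL_lattice V V\<^sub>R. g ` E = E' \<and> g ` F = F') \<longleftrightarrow>
         position_vector absv V V\<^sub>R E F = position_vector absv V V\<^sub>R E' F'"
proof -
  interpret local_K_space absv V
    using assms(1,2) by (simp add: local_K_space_def K_space_iff)
  obtain p where p: "absv p = eps absv" using uniformizer by blast
  obtain b N where b: "frame absv V V\<^sub>R b N" using lattice_frame_exists[OF assms(3,5)] by blast
  show ?thesis
  proof (cases "k \<le> l")
    case True
    obtain b1 d1 l1 m1 x1 where nf: "normal_form p V\<^sub>R E F b1 N d1 l1 m1 x1"
      using normal_form_exists[OF b assms(6,10) _ p] True assms(7,11) by auto
    obtain b2 d2 l2 m2 x2 where nf': "normal_form p V\<^sub>R E' F' b2 N d2 l2 m2 x2"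
      using normal_form_exists[OF b assms(8,12) _ p] True assms(9,13) by auto
    have "l1 = l2" using dim_normal_form(2)[OF nf p] dim_normal_form(2)[OF nf' p] assms(11,13) by simp
    then show ?thesis
      using normal_form_GL_iff[OF nf _ p] nf' position_vector_normal_form(1)[OF nf p]
        position_vector_normal_form(1)[OF nf' p] by simp
  next
    case False
    obtain b1 d1 l1 m1 x1 where nf: "normal_form p V\<^sub>R F E b1 N d1 l1 m1 x1"
      using normal_form_exists[OF b assms(10,6) _ p] False assms(7,11) by auto
    obtain b2 d2 l2 m2 x2 where nf': "normal_form p V\<^sub>R F' E' b2 N d2 l2 m2 x2"
      using normal_form_exists[OF b assms(12,8) _ p] False assms(9,13) by auto
    have "l1 = l2" using dim_normal_form(2)[OF nf p] dim_normal_form(2)[OF nf' p] assms(7,9) by simp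
    moreover have "subspace_dim V F < subspace_dim V E" "subspace_dim V F' < subspace_dim V E'"
      using False assms by simp_all
    ultimately show ?thesis
      using normal_form_GL_iff[OF nf _ p] nf' position_vector_normal_form(2)[OF nf p]
        position_vector_normal_form(2)[OF nf' p] by (simp add: conj_commute)
  qed
qed

end
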